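(* Let $k$ be an algebraically closed field of characteristic $p\neq 2,3$. A scheme $X\in\mathrm{Hilb}_6^{aG,0}(\mathbb P^4_k)$ can be obtained via the British construction if and only if it can be obtained via the Scandinavian construction.
   Context: $\mathrm{Hilb}_6^{aG,0}(\mathbb P^4_k)$ is the locus in the Hilbert scheme $\mathrm{Hilb}_6(\mathbb P^4_k)$ (of subschemes of dimension $0$ and degree $6$) of the arithmetically Gorenstein subschemes (i.e. with Gorenstein homogeneous coordinate ring) not contained in a hyperplane. Scandinavian construction: let $M=(m_{i,j})_{0\le i,j\le 2}$ be a $3\times3$ matrix of linear forms in $k[x_0,\dots,x_4]$ such that the ideal $F_2(M)$ generated by the $2\times2$ minors of $M$ has depth $4$ (the maximal possible value). $X$ is obtained via the Scandinavian construction if its homogeneous ideal is $F_2(M)$ for some such $M$. British construction: a $6\times6$ matrix $N$ with entries in a polynomial ring over $k$ is called antisymmetric and extrasymmetric if there are a $3\times3$ antisymmetric matrix $A$, a $3\times3$ symmetric matrix $S$ and $q\in k$ such that $N=\begin{pmatrix}A&S\\-S&-qA\end{pmatrix}$. Let $N$ be such a matrix whose entries are linear forms in $k[x_0,\dots,x_4]$, and let $Pf_4(N)$ be the ideal generated by the pfaffians of order $4$ of $N$ (the pfaffians of its principal $4\times4$ submatrices). $X$ is obtained via the British construction if its homogeneous ideal is $Pf_4(N)$ for some such $N$. *)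

theory Defs
  imports
    "HOL-Library.Poly_Mapping"
    "HOL-Library.Numeral_Type"
    "HOL-Library.Extended_Nat"
    "HOL-Algebra.QuotRing"
    "HOL-Algebra.Ring_Divisibility"
    "HOL-Algebra.Algebraic_Closure_Type"
    "Jordan_Normal_Form.Missing_VectorSpace"
    "Jordan_Normal_Form.Determinant"
    "Jordan_Normal_Form.DL_Submatrix"
begin

section \<open>Commutative algebra\<close>

text \<open>
  \<open>localization R P\<close> is the localization of \<open>R\<close> at the prime ideal \<open>P\<close>. Its elements are the
  classes of the pairs \<open>(a, s)\<close>, standing for the fractions \<open>a / s\<close> with \<open>s\<close> outside \<open>P\<close>.
\<close>

definition frac_rel ::
  "('a, 'r) ring_scheme \<Rightarrow> 'a set \<Rightarrow> (('a \<times> 'a) \<times> ('a \<times> 'a)) set" where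
  "frac_rel R P = {((a, s), (b, t)) | a s b t.
     a \<in> carrier R \<and> b \<in> carrier R \<and> s \<in> carrier R - P \<and> t \<in> carrier R - P \<and>
     (\<exists>u \<in> carrier R - P. u \<otimes>\<^bsub>R\<^esub> (a \<otimes>\<^bsub>R\<^esub> t \<ominus>\<^bsub>R\<^esub> b \<otimes>\<^bsub>R\<^esub> s) = \<zero>\<^bsub>R\<^esub>)}"

definition localization :: "('a, 'r) ring_scheme \<Rightarrow> 'a set \<Rightarrow> ('a \<times> 'a) set ring" where
  "localization R P =
     \<lparr>carrier = (carrier R \<times> (carrier R - P)) // frac_rel R P,
      monoid.mult = (\<lambda>U V. \<Union>x\<in>U. \<Union>y\<in>V.
        frac_rel R P `` {(fst x \<otimes>\<^bsub>R\<^esub> fst y, snd x \<otimes>\<^bsub>R\<^esub> snd y)}),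
      one = frac_rel R P `` {(\<one>\<^bsub>R\<^esub>, \<one>\<^bsub>R\<^esub>)},
      ring.zero = frac_rel R P `` {(\<zero>\<^bsub>R\<^esub>, \<one>\<^bsub>R\<^esub>)},
      add = (\<lambda>U V. \<Union>x\<in>U. \<Union>y\<in>V.
        frac_rel R P `` {(fst x \<otimes>\<^bsub>R\<^esub> snd y \<oplus>\<^bsub>R\<^esub> fst y \<otimes>\<^bsub>R\<^esub> snd x, snd x \<otimes>\<^bsub>R\<^esub> snd y)})\<rparr>"

definition regular_module :: "('a, 'r) ring_scheme \<Rightarrow> ('a, 'a) module" where
  "regular_module R =
     \<lparr>carrier = carrier R, monoid.mult = monoid.mult R, one = one R,
      ring.zero = ring.zero R, add = add R, module.smult = monoid.mult R\<rparr>"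

text \<open>
  In the lifting property, the test modules \<open>M\<close> and \<open>N\<close> have their elements in the type of the
  elements of \<open>R\<close>. These include \<open>R\<close> and its ideals, so by Baer's criterion the restriction
  to this type does not enlarge the class of injective modules.
\<close>

definition injective_module :: "('a, 'r) ring_scheme \<Rightarrow> ('a, 'm) module \<Rightarrow> bool" where
  "injective_module R E \<longleftrightarrow> module R E \<and>
     (\<forall>(M :: ('a, 'a) module) (N :: ('a, 'a) module) i f.
        mod_hom R M N i \<and> inj_on i (carrier M) \<and> mod_hom R M E f \<longrightarrow>
        (\<exists>g. mod_hom R N E g \<and> (\<forall>x \<in> carrier M. g (i x) = f x)))"

text \<open>
  \<open>R\<close> has a finite injective resolution \<open>0 \<rightarrow> R \<rightarrow> E 0 \<rightarrow> E 1 \<rightarrow> \<dots> \<rightarrow> E n \<rightarrow> 0\<close> as a module over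
  itself, whose terms have elements in the type \<open>'m\<close>. HOL cannot quantify existentially over
  types inside a formula, so \<open>'m\<close> is an argument. As a free type variable in a hypothesis of a
  theorem it imposes no bound on the size of the modules.
\<close>

definition finite_self_injective_dimension ::
  "'m itself \<Rightarrow> ('a, 'r) ring_scheme \<Rightarrow> bool" where
  "finite_self_injective_dimension _ R \<longleftrightarrow>
     (\<exists>(n :: nat) (E :: nat \<Rightarrow> ('a, 'm) module) \<epsilon> d.
        (\<forall>i. injective_module R (E i)) \<and>
        (\<forall>i > n. carrier (E i) = {\<zero>\<^bsub>E i\<^esub>}) \<and>
        mod_hom R (regular_module R) (E 0) \<epsilon> \<and>
        (\<forall>i. mod_hom R (E i) (E (Suc i)) (d i)) \<and>
        inj_on \<epsilon> (carrier R) \<and>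
        \<epsilon> ` carrier R = {x \<in> carrier (E 0). d 0 x = \<zero>\<^bsub>E 1\<^esub>} \<and>
        (\<forall>i. d i ` carrier (E i) =
               {x \<in> carrier (E (Suc i)). d (Suc i) x = \<zero>\<^bsub>E (Suc (Suc i))\<^esub>}))"

definition gorenstein_ring :: "'m itself \<Rightarrow> ('a, 'r) ring_scheme \<Rightarrow> bool" where
  "gorenstein_ring TYPE('m) R \<longleftrightarrow> cring R \<and> noetherian_ring R \<and>
     (\<forall>P. maximalideal P R \<longrightarrow> finite_self_injective_dimension TYPE('m) (localization R P))"

definition regular_sequence :: "('a, 'r) ring_scheme \<Rightarrow> 'a list \<Rightarrow> bool" where
  "regular_sequence R xs \<longleftrightarrow> set xs \<subseteq> carrier R \<and> Idl\<^bsub>R\<^esub> (set xs) \<noteq> carrier R \<and>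
     (\<forall>i < length xs. \<forall>y \<in> carrier R.
        xs ! i \<otimes>\<^bsub>R\<^esub> y \<in> Idl\<^bsub>R\<^esub> (set (take i xs)) \<longrightarrow> y \<in> Idl\<^bsub>R\<^esub> (set (take i xs)))"

definition ideal_depth :: "('a, 'r) ring_scheme \<Rightarrow> 'a set \<Rightarrow> enat" where
  "ideal_depth R I = Sup {enat (length xs) | xs. regular_sequence R xs \<and> set xs \<subseteq> I}"


section \<open>Subschemes of projective four-space\<close>

text \<open>
  The five elements of the numeral type \<open>5\<close> index the variables; a monomial is the finitely
  supported function of its exponents.
\<close>

type_synonym 'k poly5 = "(5 \<Rightarrow>\<^sub>0 nat) \<Rightarrow>\<^sub>0 'k"

abbreviation poly5_ring :: "'k :: field poly5 ring" where
  "poly5_ring \<equiv> ring_of_type_algebra"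

definition const5 :: "'k :: field \<Rightarrow> 'k poly5" where
  "const5 c = Poly_Mapping.single 0 c"

definition monom_degree :: "(5 \<Rightarrow>\<^sub>0 nat) \<Rightarrow> nat" where
  "monom_degree m = (\<Sum>i\<in>UNIV. Poly_Mapping.lookup m i)"

text \<open>The forms of degree \<open>d\<close>, including \<open>0\<close>.\<close>

definition forms :: "nat \<Rightarrow> 'k :: field poly5 set" where
  "forms d = {f. \<forall>m \<in> Poly_Mapping.keys f. monom_degree m = d}"

definition homogeneous_ideal :: "'k :: field poly5 set \<Rightarrow> bool" where
  "homogeneous_ideal I \<longleftrightarrow> ideal I poly5_ring \<and> I = Idl\<^bsub>poly5_ring\<^esub> (I \<inter> (\<Union>d. forms d))"

text \<open>Saturation with respect to the ideal generated by the variables.\<close>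

definition saturated :: "'k :: field poly5 set \<Rightarrow> bool" where
  "saturated I \<longleftrightarrow> (\<forall>f. (\<exists>n. \<forall>g \<in> forms n. g * f \<in> I) \<longrightarrow> f \<in> I)"

text \<open>
  The dimension of the degree \<open>d\<close> part of the quotient by \<open>I\<close>. All forms of degree \<open>d\<close> make up
  a finite-dimensional space, so the difference is the dimension of the quotient space.
\<close>

definition hilbert_function :: "'k :: field poly5 set \<Rightarrow> nat \<Rightarrow> nat" where
  "hilbert_function I d =
     vector_space.dim (\<lambda>c f. const5 c * f) (forms d :: 'k poly5 set) -
     vector_space.dim (\<lambda>c f. const5 c * f) (I \<inter> forms d)"

text \<open>
  A closed subscheme of projective four-space is given by its homogeneous ideal, the unique
  saturated homogeneous ideal defining it. It has dimension \<open>0\<close> and degree \<open>6\<close> iff its Hilbert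
  polynomial is the constant \<open>6\<close>.
\<close>

definition Hilb6_P4 :: "'k :: field poly5 set set" where
  "Hilb6_P4 = {I. homogeneous_ideal I \<and> saturated I \<and>
     (\<forall>\<^sub>F d in sequentially. hilbert_function I d = 6)}"

abbreviation homogeneous_coordinate_ring :: "'k :: field poly5 set \<Rightarrow> 'k poly5 set ring" where
  "homogeneous_coordinate_ring I \<equiv> poly5_ring Quot I"

text \<open>A subscheme lies in the hyperplane \<open>l = 0\<close> iff \<open>l\<close> belongs to its homogeneous ideal.\<close>

definition in_hyperplane :: "'k :: field poly5 set \<Rightarrow> bool" where
  "in_hyperplane I \<longleftrightarrow> (\<exists>l \<in> forms 1. l \<noteq> 0 \<and> l \<in> I)"

definition Hilb6_aG_0_P4 :: "'m itself \<Rightarrow> 'k :: field poly5 set set" where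
  "Hilb6_aG_0_P4 TYPE('m) = {I \<in> Hilb6_P4.
     gorenstein_ring TYPE('m) (homogeneous_coordinate_ring I) \<and> \<not> in_hyperplane I}"

definition F2 :: "'k :: field poly5 mat \<Rightarrow> 'k poly5 set" where
  "F2 M = Idl\<^bsub>poly5_ring\<^esub> {det (submatrix M I J) | I J.
     I \<subseteq> {..<dim_row M} \<and> J \<subseteq> {..<dim_col M} \<and> card I = 2 \<and> card J = 2}"

definition scandinavian :: "'k :: field poly5 set \<Rightarrow> bool" where
  "scandinavian I \<longleftrightarrow> (\<exists>M \<in> carrier_mat 3 3.
     elements_mat M \<subseteq> forms 1 \<and> ideal_depth poly5_ring (F2 M) = 4 \<and> I = F2 M)"

definition antisym_extrasym :: "'k :: field poly5 mat \<Rightarrow> bool" where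
  "antisym_extrasym N \<longleftrightarrow> (\<exists>A \<in> carrier_mat 3 3. \<exists>S \<in> carrier_mat 3 3. \<exists>q :: 'k.
     transpose_mat A = - A \<and> transpose_mat S = S \<and>
     N = four_block_mat A S (- S) (- (const5 q \<cdot>\<^sub>m A)))"

definition pfaffian4 :: "'a :: comm_ring_1 mat \<Rightarrow> 'a" where
  "pfaffian4 P = P $$ (0,1) * P $$ (2,3) - P $$ (0,2) * P $$ (1,3) + P $$ (0,3) * P $$ (1,2)"

definition Pf4 :: "'k :: field poly5 mat \<Rightarrow> 'k poly5 set" where
  "Pf4 N = Idl\<^bsub>poly5_ring\<^esub> {pfaffian4 (submatrix N I I) | I. I \<subseteq> {..<dim_row N} \<and> card I = 4}"

definition british :: "'k :: field poly5 set \<Rightarrow> bool" where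
  "british I \<longleftrightarrow> (\<exists>N \<in> carrier_mat 6 6.
     antisym_extrasym N \<and> elements_mat N \<subseteq> forms 1 \<and> I = Pf4 N)"

end

theory Submission
  imports Defs "HOL-Analysis.Cartesian_Space"
begin

text \<open>
  Writing \<open>a = (A\<^sub>1\<^sub>2, A\<^sub>2\<^sub>0, A\<^sub>0\<^sub>1)\<close>, the pfaffians of order 4 of \<open>N\<close> generate the ideal of the entries of
  \<open>adj S + q a a\<^sup>T\<close> and of \<open>S a\<close>, while the \<open>2 \<times> 2\<close> minors of \<open>S + r A\<close> generate the same ideal with
  \<open>q = r\<^sup>2\<close>. Splitting \<open>M\<close> into its symmetric and antisymmetric parts gives the British form with
  \<open>q = 1\<close>, and conversely any \<open>q \<noteq> 0\<close> has a square root. For \<open>q = 0\<close> the entries of \<open>S\<close> together with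
  one more linear form span the five-dimensional space of linear forms, because the scheme is nonempty.
  So after a change of basis at most one \<open>a\<^sub>i\<close> lies outside the span of the six entries of \<open>S\<close>, which
  are linearly dependent. The action of \<open>GL\<^sub>3\<close> then brings \<open>S\<close> and \<open>a\<close> to a few normal forms, and for each of these an explicit deformation
  of \<open>S\<close> is a \<open>3 \<times> 3\<close> matrix with the same ideal of minors. The remaining cases would need fewer than
  nine generators, which the Hilbert function excludes.

  The ideal has depth 4 whatever its presentation: some linear form \<open>ell\<close> is a nonzerodivisor modulo \<open>I\<close>,
  every linear form is integral over \<open>k[ell]\<close> modulo \<open>I\<close>, and the four integral equations for
  coordinates complementary to \<open>ell\<close> form a regular sequence. Regular sequences of length 5 in \<open>I\<close> are
  excluded by counting dimensions.
\<close>

section \<open>Ideals and polynomials in five variables\<close>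

text \<open>For \<open>q = 0\<close> the minors of \<open>S + r A\<close> with \<open>r = 0\<close>
  lose the relations \<open>S a\<close>, so \<open>S\<close> itself has to be changed. The guide is
  the rank-one locus: where \<open>S = v v^T\<close> with \<open>v = (v0, v1, v2)\<close>, a linear
  relation among the entries of \<open>S\<close> is a conic in \<open>v\<close>, and
  \<open>S a = v (v . a)\<close>, so only \<open>v . a\<close> counts. If \<open>a\<close> lies in
  the span of the entries, then \<open>v . a\<close> is a cubic and any one conic suffices. If
  \<open>a0\<close> lies outside, only base changes preserving the line \<open>v0 = 0\<close> are
  allowed, but there are two independent conics. A conic meeting this line in two distinct points
  becomes \<open>v1 v2 = h v0^2\<close>. Otherwise the pencil contains a conic that is tangent to
  the line and one that contains it. The vector \<open>v\<close> is only a heuristic. The identities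
  it suggests are checked as ideal memberships in the entries of \<open>S\<close>, so points where
  \<open>S\<close> is not of this form cause no gap. Division by 2 serves to complete squares and to
  split matrices. Division by 3 removes the second term of a binary cubic, and \<open>3 ~= 0\<close>
  also provides a value of the deformation parameter.\<close>

interpretation ideal_mod: Modules.module "(*) :: 'a::comm_ring_1 \<Rightarrow> 'a \<Rightarrow> 'a"
  by unfold_locales (simp_all add: algebra_simps)

lemmas [simp del] = ideal_mod.scale_scale

text \<open>Moves ideals from the carrier-based ring to the type class, where \<open>span\<close>
  and the ring simplification rules are available.\<close>

lemma ideal_iff_subspace: "ideal J (ring_of_type_algebra :: 'a::comm_ring_1 ring) \<longleftrightarrow> ideal_mod.subspace J"
proof -
  interpret R: cring "ring_of_type_algebra :: 'a ring" by (rule cring_from_type_algebra)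
  have neg: "\<ominus>\<^bsub>ring_of_type_algebra\<^esub> x = - x" for x :: 'a
    by (rule R.minus_equality) (simp_all add: ring_of_type_algebra_def)
  show ?thesis
  proof
    assume "ideal J (ring_of_type_algebra :: 'a ring)"
    then interpret ideal J "ring_of_type_algebra :: 'a ring" .
    show "ideal_mod.subspace J"
      using additive_subgroup.zero_closed[OF is_additive_subgroup] a_closed I_l_closed
      by (auto simp: ideal_mod.subspace_def ring_of_type_algebra_def)
  next
    assume J: "ideal_mod.subspace J"
    show "ideal J (ring_of_type_algebra :: 'a ring)"
    proof (rule idealI)
      show "ring (ring_of_type_algebra :: 'a ring)" by (rule R.ring_axioms)
      show "subgroup J (add_monoid (ring_of_type_algebra :: 'a ring))"
        using ideal_mod.subspace_0[OF J] ideal_mod.subspace_add[OF J] ideal_mod.subspace_neg[OF J] neg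
        by unfold_locales (auto simp: a_inv_def ring_of_type_algebra_def)
    qed (use J in \<open>auto simp: ring_of_type_algebra_def mult.commute dest: ideal_mod.subspace_scale\<close>)
  qed
qed

lemma genideal_eq_span: "Idl\<^bsub>ring_of_type_algebra\<^esub> S = ideal_mod.span (S :: 'a::comm_ring_1 set)"
  unfolding genideal_def ideal_iff_subspace ideal_mod.span_def hull_def by auto


\<comment> \<open>Restricting a polynomial to some of its monomials\<close>
alias keys = Poly_Mapping.keys
alias lookup = Poly_Mapping.lookup

lemma poly_mapping_sum_single: "(\<Sum>m\<in>keys f. Poly_Mapping.single m (lookup f m)) = f"
  by (rule poly_mapping_eqI) (simp add: lookup_sum lookup_single when_def sum.delta in_keys_iff)

lemma mult_sum_single:
  "f * g = (\<Sum>a\<in>keys f. \<Sum>b\<in>keys g. Poly_Mapping.single (a + b) (lookup f a * lookup g b))"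
proof -
  have "f * g = (\<Sum>a\<in>keys f. Poly_Mapping.single a (lookup f a)) * (\<Sum>b\<in>keys g. Poly_Mapping.single b (lookup g b))"
    by (simp add: poly_mapping_sum_single)
  then show ?thesis
    by (simp only: sum_product mult_single)
qed

text \<open>Serves twice: with the total degree it yields homogeneous components, with the exponent
  of one variable the terms containing a given power of that variable.\<close>

definition part :: "('a \<Rightarrow> bool) \<Rightarrow> ('a \<Rightarrow>\<^sub>0 'b::zero) \<Rightarrow> 'a \<Rightarrow>\<^sub>0 'b" where
  "part P = Poly_Mapping.mapp (\<lambda>m c. if P m then c else 0)"

lemma lookup_part: "lookup (part P f) m = (if P m then lookup f m else 0)"
  by (simp add: part_def lookup_mapp when_def in_keys_iff)

lemma keys_part: "keys (part P f) = {m \<in> keys f. P m}"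
  by (auto simp: in_keys_iff lookup_part split: if_splits)

lemma part_eq_self: "(\<And>m. m \<in> keys f \<Longrightarrow> P m) \<Longrightarrow> part P f = f"
  by (rule poly_mapping_eqI) (auto simp: lookup_part in_keys_iff)

lemma part_eq_0: "(\<And>m. m \<in> keys f \<Longrightarrow> \<not> P m) \<Longrightarrow> part P f = 0"
  by (rule poly_mapping_eqI) (auto simp: lookup_part in_keys_iff)

lemma part_add: "part P (f + g) = part P f + part P (g :: 'a \<Rightarrow>\<^sub>0 'b::monoid_add)"
  by (rule poly_mapping_eqI) (simp add: lookup_part lookup_add)

lemma part_0 [simp]: "part P 0 = 0"
  by (rule poly_mapping_eqI) (simp add: lookup_part)

lemma part_sum: "part P (sum f A) = (\<Sum>x\<in>A. part P (f x :: 'a \<Rightarrow>\<^sub>0 'b::comm_monoid_add))"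
  by (induction A rule: infinite_finite_induct) (simp_all add: part_add)

lemma part_single: "part P (Poly_Mapping.single m c) = (if P m then Poly_Mapping.single m c else 0)"
  by (rule poly_mapping_eqI) (auto simp: lookup_part lookup_single when_def)

text \<open>If all monomials of \<open>g\<close> shift the condition in the same way, the cut passes
  through multiplication by \<open>g\<close>. This covers \<open>g\<close> homogeneous in all
  variables and \<open>g\<close> homogeneous in a single one.\<close>

lemma part_mult:
  fixes f g :: "'a::monoid_add \<Rightarrow>\<^sub>0 'b::semiring_0"
  assumes "\<And>a b. a \<in> keys g \<Longrightarrow> P (a + b) \<longleftrightarrow> Q b"
  shows "part P (g * f) = g * part Q f"
proof -
  have "part P (g * f) = (\<Sum>a\<in>keys g. \<Sum>b\<in>keys f. if Q b then Poly_Mapping.single (a + b) (lookup g a * lookup f b) else 0)"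
    unfolding mult_sum_single[of g f] part_sum part_single
    by (intro sum.cong refl) (use assms in auto)
  also have "\<dots> = (\<Sum>a\<in>keys g. \<Sum>b\<in>keys (part Q f). Poly_Mapping.single (a + b) (lookup g a * lookup (part Q f) b))"
    by (intro sum.cong refl sum.mono_neutral_cong_right) (auto simp: keys_part lookup_part)
  finally show ?thesis
    by (simp only: mult_sum_single[of g "part Q f"])
qed

lemma const5_hom [simp]:
  "const5 0 = 0" "const5 1 = 1" "const5 (a + b) = const5 a + const5 b" "const5 (a * b) = const5 a * const5 b"
  "const5 (a - b) = const5 a - const5 b" "const5 (- a) = - const5 a"
  by (simp_all add: const5_def single_add single_diff single_uminus mult_single)

lemma const5_numeral [simp]: "const5 (numeral n) = numeral n"
  by (simp add: const5_def)

lemma lookup_const5_mult: "lookup (const5 c * f) m = c * lookup f m"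
  unfolding const5_def mult_map_scale_conv_mult[symmetric]
  by (simp add: Poly_Mapping.map.rep_eq when_def)

text \<open>The second linear structure on polynomials: \<open>ideal_mod.span\<close> is the
  generated ideal, \<open>poly5.span\<close> the span over the field.\<close>

interpretation poly5: Vector_Spaces.vector_space "\<lambda>c f. const5 c * (f :: 'k::field poly5)"
  by unfold_locales (simp_all add: algebra_simps)

lemmas [simp del] = poly5.scale_scale

section \<open>Evaluation at points and substitution of polynomials\<close>

definition peval :: "('k::field \<Rightarrow> 'b::comm_ring_1) \<Rightarrow> (5 \<Rightarrow> 'b) \<Rightarrow> 'k poly5 \<Rightarrow> 'b" where
  "peval \<iota> x f = (\<Sum>m\<in>keys f. \<iota> (lookup f m) * (\<Prod>i\<in>UNIV. x i ^ lookup m i))"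

definition var5 :: "5 \<Rightarrow> 'k::field poly5" where
  "var5 i = Poly_Mapping.single (Poly_Mapping.single i 1) 1"

text \<open>The coefficient map stays general because two instances are needed: the identity, for
  values at points of \<open>k^5\<close>, and \<open>const5\<close>, for substituting polynomials
  for the variables.\<close>

locale coefficient_hom =
  fixes \<iota> :: "'k::field \<Rightarrow> 'b::comm_ring_1"
  assumes hom_add: "\<iota> (a + b) = \<iota> a + \<iota> b" and hom_mult: "\<iota> (a * b) = \<iota> a * \<iota> b"
    and hom_0: "\<iota> 0 = 0" and hom_1: "\<iota> 1 = 1"
begin

lemma peval_single: "peval \<iota> x (Poly_Mapping.single m c) = \<iota> c * (\<Prod>i\<in>UNIV. x i ^ lookup m i)"
  by (simp add: peval_def hom_0)

lemma peval_0 [simp]: "peval \<iota> x 0 = 0"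
  by (simp add: peval_def)

lemma peval_add: "peval \<iota> x (f + g) = peval \<iota> x f + peval \<iota> x g"
  unfolding peval_def by (rule setsum_keys_plus_distrib) (simp_all add: hom_0 hom_add distrib_right)

lemma peval_sum: "peval \<iota> x (sum f A) = (\<Sum>a\<in>A. peval \<iota> x (f a))"
  by (induction A rule: infinite_finite_induct) (simp_all add: peval_add)

lemma peval_mult: "peval \<iota> x (f * g) = peval \<iota> x f * peval \<iota> x g"
proof -
  have "peval \<iota> x (f * g) = (\<Sum>a\<in>keys f. \<Sum>b\<in>keys g.
      (\<iota> (lookup f a) * (\<Prod>i\<in>UNIV. x i ^ lookup a i)) * (\<iota> (lookup g b) * (\<Prod>i\<in>UNIV. x i ^ lookup b i)))"
    unfolding mult_sum_single[of f g] peval_sum peval_single hom_mult lookup_add power_add prod.distrib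
    by (simp only: mult_ac)
  then show ?thesis
    by (simp only: peval_def sum_product)
qed

lemma peval_const5 [simp]: "peval \<iota> x (const5 c) = \<iota> c"
  by (simp add: const5_def peval_single)

lemma peval_1 [simp]: "peval \<iota> x 1 = 1"
  using peval_const5[of x 1] by (simp add: hom_1)

lemma peval_power: "peval \<iota> x (f ^ n) = peval \<iota> x f ^ n"
  by (induction n) (simp_all add: peval_mult)

lemma peval_prod: "peval \<iota> x (prod f A) = (\<Prod>a\<in>A. peval \<iota> x (f a))"
  by (induction A rule: infinite_finite_induct) (simp_all add: peval_mult)

lemma peval_var5 [simp]: "peval \<iota> x (var5 i) = x i"
proof -
  have "(\<Prod>j\<in>UNIV. x j ^ lookup (Poly_Mapping.single i 1 :: 5 \<Rightarrow>\<^sub>0 nat) j) = (\<Prod>j\<in>UNIV. if j = i then x j else 1)"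
    by (rule prod.cong) (auto simp: lookup_single when_def)
  then show ?thesis
    by (simp add: var5_def peval_single hom_1)
qed

lemma peval_span:
  assumes "f \<in> ideal_mod.span F" and "\<And>g. g \<in> F \<Longrightarrow> peval \<iota> x g \<in> ideal_mod.span G"
  shows "peval \<iota> x f \<in> ideal_mod.span G"
  using assms(1)
proof (induction rule: ideal_mod.span_induct_alt)
  case base
  then show ?case by (simp add: ideal_mod.span_zero)
next
  case (step c g y)
  then show ?case
    by (simp add: peval_add peval_mult assms(2) ideal_mod.span_add ideal_mod.span_scale)
qed

end

interpretation field_hom: coefficient_hom "\<lambda>a :: 'k::field. a"
  by unfold_locales simp_all

interpretation const5_hom: coefficient_hom "const5 :: 'k::field \<Rightarrow> 'k poly5"
  by unfold_locales simp_all

lemma var5_power: "var5 i ^ n = (Poly_Mapping.single (Poly_Mapping.single i n) 1 :: 'k::field poly5)"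
proof (induction n)
  case (Suc n)
  have "var5 i ^ Suc n = Poly_Mapping.single (Poly_Mapping.single i 1 + Poly_Mapping.single i n) (1 :: 'k)"
    by (simp only: power_Suc Suc) (simp add: var5_def mult_single)
  then show ?case
    by (simp only: single_add[symmetric] plus_1_eq_Suc)
qed (simp only: power_0 single_zero single_one)

lemma prod_single_1:
  "finite A \<Longrightarrow> (\<Prod>i\<in>A. Poly_Mapping.single (f i) (1 :: 'b::comm_semiring_1)) = Poly_Mapping.single (\<Sum>i\<in>A. f i :: 'a::comm_monoid_add) 1"
  by (induction A rule: finite_induct) (simp_all add: mult_single)

lemma sum_single_lookup: "(\<Sum>i\<in>UNIV. Poly_Mapping.single i (lookup m i)) = (m :: 'a::finite \<Rightarrow>\<^sub>0 'b::comm_monoid_add)"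
  by (rule poly_mapping_eqI) (simp add: lookup_sum lookup_single when_def)

lemma single_eq_prod_var5: "Poly_Mapping.single m c = const5 c * (\<Prod>i\<in>UNIV. var5 i ^ lookup m i)"
  unfolding var5_power prod_single_1[OF finite] sum_single_lookup const5_def mult_single by simp

lemma peval_const5_var5 [simp]: "peval const5 var5 f = f"
  by (simp add: peval_def single_eq_prod_var5[symmetric] poly_mapping_sum_single)

lemma peval_peval:
  "peval const5 x (peval const5 y f) = peval const5 (\<lambda>i. peval const5 x (y i)) f"
  unfolding peval_def[of const5 y f] const5_hom.peval_sum const5_hom.peval_mult const5_hom.peval_prod
    const5_hom.peval_power const5_hom.peval_const5
  by (simp only: peval_def[of const5 "\<lambda>i. peval const5 x (y i)"])

no_notation Matrix.vec_index (infixl "$" 100)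
no_notation Formal_Power_Series.fps.fps_nth (infixl "$" 75)

section \<open>Forms, homogeneous components and linear forms\<close>

lemma monom_degree_add [simp]: "monom_degree (a + b) = monom_degree a + monom_degree b"
  by (simp add: monom_degree_def lookup_add sum.distrib)

lemma forms_0 [simp]: "0 \<in> forms d"
  by (simp add: forms_def)

lemma forms_add: "f \<in> forms d \<Longrightarrow> g \<in> forms d \<Longrightarrow> f + g \<in> forms d"
  using keys_add[of f g] by (auto simp: forms_def)

lemma forms_mult: "f \<in> forms d \<Longrightarrow> g \<in> forms e \<Longrightarrow> f * g \<in> forms (d + e)"
  using keys_mult[of f g] by (fastforce simp: forms_def)

lemma const5_forms: "const5 c \<in> forms 0"
  by (simp add: forms_def const5_def monom_degree_def)

lemma forms_scale: "f \<in> forms d \<Longrightarrow> const5 c * f \<in> forms d"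
  using forms_mult[OF const5_forms] by fastforce

lemma forms_subspace: "poly5.subspace (forms d)"
  by (simp add: poly5.subspace_def forms_add forms_scale)

lemma forms_sum: "(\<And>a. a \<in> A \<Longrightarrow> f a \<in> forms d) \<Longrightarrow> sum f A \<in> forms d"
  by (rule poly5.subspace_sum[OF forms_subspace])

lemma forms_diff: "f \<in> forms d \<Longrightarrow> g \<in> forms d \<Longrightarrow> f - g \<in> forms d"
  by (rule poly5.subspace_diff[OF forms_subspace])

lemma forms_uminus: "f \<in> forms d \<Longrightarrow> - f \<in> forms d"
  by (rule poly5.subspace_neg[OF forms_subspace])

lemma forms_power: "f \<in> forms d \<Longrightarrow> f ^ n \<in> forms (n * d)"
proof (induction n)
  case 0
  then show ?case using const5_forms[of 1] by simp
next
  case (Suc n)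
  then show ?case using forms_mult[of f d "f ^ n" "n * d"] by simp
qed

lemma var5_forms: "var5 i \<in> forms 1"
proof -
  have "monom_degree (Poly_Mapping.single i 1) = 1"
    by (simp add: monom_degree_def lookup_single when_def)
  then show ?thesis
    by (simp add: forms_def var5_def)
qed

abbreviation comp :: "nat \<Rightarrow> 'k::field poly5 \<Rightarrow> 'k poly5" where
  "comp d \<equiv> part (\<lambda>m. monom_degree m = d)"

lemma comp_forms: "comp d f \<in> forms d"
  by (simp add: forms_def keys_part)

lemma comp_eq_self: "f \<in> forms d \<Longrightarrow> comp d f = f"
  by (rule part_eq_self) (simp add: forms_def)

lemma sum_comp: "f = (\<Sum>d\<in>monom_degree ` keys f. comp d f)"
  by (rule poly_mapping_eqI) (auto simp: lookup_sum lookup_part in_keys_iff)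

lemma comp_forms_mult: "g \<in> forms e \<Longrightarrow> comp (d + e) (g * f) = g * comp d f"
  by (rule part_mult) (auto simp: forms_def)

lemma comp_span:
  assumes "f \<in> ideal_mod.span G" and "G \<subseteq> (\<Union>d. forms d)"
  shows "comp d f \<in> ideal_mod.span G"
  using assms(1)
proof (induction rule: ideal_mod.span_induct_alt)
  case base
  then show ?case by (simp add: ideal_mod.span_zero)
next
  case (step c g y)
  then obtain e where "g \<in> forms e" using assms(2) by auto
  \<comment> \<open>The condition \<open>monom_degree m + e = d\<close> avoids the truncated
    difference \<open>d - e\<close>: for \<open>e > d\<close> it selects no monomial.\<close>
  then have "comp d (c * g) = g * part (\<lambda>m. monom_degree m + e = d) c"
    by (subst mult.commute, intro part_mult) (auto simp: forms_def)
  then show ?case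
    using step by (simp add: part_add mult.commute[of g] ideal_mod.span_add ideal_mod.span_scale ideal_mod.span_base)
qed

text \<open>Linear forms are indexed by coefficient vectors, so that sets of them become subspaces
  of \<open>k^5\<close> with the dimension theory available there.\<close>

definition lin :: "'k::field ^ 5 \<Rightarrow> 'k poly5" where
  "lin c = (\<Sum>i\<in>UNIV. const5 (c $ i) * var5 i)"

lemma lin_forms: "lin c \<in> forms 1"
  unfolding lin_def by (intro forms_sum forms_scale var5_forms)

lemma lin_add: "lin (c + d) = lin c + lin d"
  by (simp add: lin_def distrib_right sum.distrib)

lemma lin_scale: "lin (a *s c) = const5 a * lin c"
  by (simp add: lin_def sum_distrib_left mult_ac)

lemma lin_0 [simp]: "lin 0 = 0"
  by (simp add: lin_def)

lemma lin_axis: "lin (axis i 1) = var5 i"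
proof -
  have "(\<Sum>j\<in>UNIV. const5 (axis i 1 $ j) * var5 j) = (\<Sum>j\<in>UNIV. if j = i then var5 j else 0)"
    by (rule sum.cong) (auto simp: axis_def)
  then show ?thesis
    by (simp add: lin_def)
qed

lemma forms_1_lin:
  assumes "f \<in> forms 1"
  obtains c where "f = lin c"
proof -
  have unit: "\<exists>i. m = Poly_Mapping.single i 1" if m: "monom_degree m = 1" for m :: "5 \<Rightarrow>\<^sub>0 nat"
  proof -
    from m obtain i where i: "lookup m i = 1" "\<forall>j. j \<noteq> i \<longrightarrow> lookup m j = 0"
      unfolding monom_degree_def by (subst (asm) sum_eq_1_iff) auto
    then show ?thesis
      by (intro exI[of _ i] poly_mapping_eqI) (auto simp: lookup_single when_def)
  qed
  have "Poly_Mapping.single m (lookup f m) \<in> range lin" if "m \<in> keys f" for m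
  proof -
    have "monom_degree m = 1"
      using assms that by (simp add: forms_def)
    then obtain i where i: "m = Poly_Mapping.single i 1"
      using unit by (elim exE[OF unit])
    have "Poly_Mapping.single m (lookup f m) = lin (lookup f m *s axis i 1)"
      unfolding lin_scale lin_axis var5_def const5_def mult_single i by simp
    then show ?thesis by (simp only: rangeI)
  qed
  moreover have "x + y \<in> range lin" if "x \<in> range lin" "y \<in> range lin" for x y :: "'a poly5"
    using that lin_add by (metis (no_types, lifting) imageE rangeI)
  moreover have "0 \<in> range lin" by (metis lin_0 rangeI)
  ultimately have "(\<Sum>m\<in>A. Poly_Mapping.single m (lookup f m)) \<in> range lin" if "A \<subseteq> keys f" for A
    using that by (induction A rule: infinite_finite_induct) auto
  from this[OF subset_refl] show ?thesis
    using that by (auto simp: poly_mapping_sum_single)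
qed

lemma (in coefficient_hom) peval_lin: "peval \<iota> x (lin c) = (\<Sum>i\<in>UNIV. \<iota> (c $ i) * x i)"
  by (simp add: lin_def peval_sum peval_mult)

text \<open>Counting monomials in a box instead of in a fixed degree: this crude bound already
  decides the comparison of fifth and sixth powers in the depth argument.\<close>

lemma card_bounded_monomials:
  "finite {m :: 5 \<Rightarrow>\<^sub>0 nat. \<forall>i. lookup m i \<le> N}"
  "card {m :: 5 \<Rightarrow>\<^sub>0 nat. \<forall>i. lookup m i \<le> N} \<le> (N + 1) ^ 5"
proof -
  let ?A = "{m :: 5 \<Rightarrow>\<^sub>0 nat. \<forall>i. lookup m i \<le> N}" and ?B = "UNIV \<rightarrow>\<^sub>E {..N} :: (5 \<Rightarrow> nat) set"
  have inj: "inj_on lookup ?A"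
    by (intro inj_onI poly_mapping_eqI) simp
  have sub: "lookup ` ?A \<subseteq> ?B" by auto
  have fin: "finite ?B" by (intro finite_PiE) auto
  show "finite ?A"
    using finite_subset[OF sub fin] inj finite_imageD by blast
  have "card ?B = (N + 1) ^ 5"
    by (subst card_PiE) auto
  then show "card ?A \<le> (N + 1) ^ 5"
    using card_inj_on_le[OF inj sub fin] by simp
qed

lemma lookup_le_monom_degree: "lookup m i \<le> monom_degree m"
  unfolding monom_degree_def by (rule member_le_sum) auto

lemma in_span_monomials:
  assumes "keys f \<subseteq> S"
  shows "f \<in> poly5.span ((\<lambda>m. Poly_Mapping.single m 1) ` S)"
proof -
  have "Poly_Mapping.single m (lookup f m) \<in> poly5.span ((\<lambda>m. Poly_Mapping.single m 1) ` S)" if "m \<in> keys f" for m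
  proof -
    have "Poly_Mapping.single m (lookup f m) = const5 (lookup f m) * Poly_Mapping.single m 1"
      by (simp add: const5_def mult_single)
    moreover have "m \<in> S"
      using that assms by (rule rev_subsetD)
    ultimately show ?thesis
      by (simp only:) (rule poly5.span_scale, rule poly5.span_base, rule imageI)
  qed
  then have "(\<Sum>m\<in>keys f. Poly_Mapping.single m (lookup f m)) \<in> poly5.span ((\<lambda>m. Poly_Mapping.single m 1) ` S)"
    by (rule poly5.span_sum)
  then show ?thesis
    by (simp add: poly_mapping_sum_single)
qed

lemma monomials_independent: "poly5.independent ((\<lambda>m. Poly_Mapping.single m 1) ` S)"
proof -
  have "Poly_Mapping.single m 1 \<notin> poly5.span ((\<lambda>m. Poly_Mapping.single m 1) ` S - {Poly_Mapping.single m (1 :: 'a)})" for m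
  proof
    assume "Poly_Mapping.single m 1 \<in> poly5.span ((\<lambda>m. Poly_Mapping.single m 1) ` S - {Poly_Mapping.single m (1 :: 'a)})"
    moreover have "poly5.span ((\<lambda>m. Poly_Mapping.single m 1) ` S - {Poly_Mapping.single m (1 :: 'a)}) \<subseteq> {f. lookup f m = 0}"
      by (intro poly5.span_minimal) (auto simp: poly5.subspace_def lookup_add lookup_const5_mult lookup_single when_def)
    ultimately show False by auto
  qed
  then show ?thesis
    unfolding poly5.dependent_def by blast
qed

section \<open>Nonzerodivisors modulo a saturated ideal of degree six\<close>

text \<open>Euclid's argument: one plus the product of all \<open>X - a\<close> is nonconstant but
  takes only the value 1.\<close>

lemma infinite_alg_closed: "infinite (UNIV :: 'k::alg_closed_field set)"
proof
  assume fin: "finite (UNIV :: 'k set)"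
  define p where "p = (\<Prod>a\<in>(UNIV :: 'k set). [:- a, 1:]) + 1"
  have "degree (\<Prod>a\<in>(UNIV :: 'k set). [:- a, 1:]) = card (UNIV :: 'k set)"
    by (subst degree_prod_eq_sum_degree) auto
  moreover have "card (UNIV :: 'k set) > 0"
    using fin by (simp add: finite_UNIV_card_ge_0)
  ultimately have "degree p > 0"
    unfolding p_def by (subst degree_add_eq_left) auto
  then obtain x where "poly p x = 0"
    using alg_closed_imp_poly_has_root by blast
  moreover have "poly p x = 1"
    using fin by (simp add: p_def poly_prod)
  ultimately show False by simp
qed

text \<open>Let \<open>c\<close> avoid the earlier subspaces and suppose it lies in the new one,
  \<open>A\<close>. For \<open>m\<close> outside \<open>A\<close> the line \<open>m + t c\<close>
  never enters \<open>A\<close>, and it meets each earlier \<open>B\<close> for at most one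
  \<open>t\<close>, since two values would put \<open>c\<close> into \<open>B\<close>. An infinite
  field leaves a good \<open>t\<close>.\<close>

lemma avoid_subspaces:
  fixes \<A> :: "('k::field ^ 'n) set set"
  assumes "infinite (UNIV :: 'k set)" and "finite \<A>"
    and "\<And>A. A \<in> \<A> \<Longrightarrow> vec.subspace A \<and> A \<noteq> UNIV"
  shows "\<exists>c. \<forall>A\<in>\<A>. c \<notin> A"
  using assms(2,3)
proof (induction \<A> rule: finite_induct)
  case (insert A \<A>)
  then obtain c where c: "\<forall>B\<in>\<A>. c \<notin> B" by auto
  from insert obtain m where m: "m \<notin> A" by blast
  have A: "vec.subspace A" and B: "B \<in> \<A> \<Longrightarrow> vec.subspace B" for B
    using insert by auto
  show ?case
  proof (cases "c \<in> A")
    case True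
    have "finite {t. m + t *s c \<in> B}" if "B \<in> \<A>" for B
    proof (rule ccontr)
      assume inf: "infinite {t. m + t *s c \<in> B}"
      then obtain t where t: "m + t *s c \<in> B"
        by (metis (mono_tags) Collect_empty_eq finite.emptyI)
      obtain u where u: "m + u *s c \<in> B" "u \<noteq> t"
        by (metis (no_types, lifting) inf finite.emptyI finite_insert finite_subset insertCI mem_Collect_eq subsetI)
      have "(u - t) *s c \<in> B"
        using vec.subspace_diff[OF B[OF that] u(1) t] by (simp add: vec.scale_left_diff_distrib)
      then have "inverse (u - t) *s ((u - t) *s c) \<in> B"
        by (rule vec.subspace_scale[OF B[OF that]])
      then show False using u(2) c that by simp
    qed
    then have "finite (\<Union>B\<in>\<A>. {t. m + t *s c \<in> B})"
      using insert by blast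
    then obtain t where t: "t \<notin> (\<Union>B\<in>\<A>. {t. m + t *s c \<in> B})"
      using assms(1) ex_new_if_finite by blast
    have "m + t *s c \<notin> A"
      using m vec.subspace_diff[OF A _ vec.subspace_scale[OF A True], of "m + t *s c" t] by auto
    with t show ?thesis by blast
  qed (use c in blast)
qed simp

text \<open>A basis of \<open>W\<close> stays independent when the \<open>f i\<close> are added one
  by one. Stating independence modulo \<open>W\<close> through coefficient sums makes the quotient
  space unnecessary.\<close>

lemma independent_mod_dim:
  assumes W: "poly5.subspace W" and WF: "W \<subseteq> F" and F: "F \<subseteq> poly5.span B" "finite B"
    and f: "\<And>i. i < n \<Longrightarrow> f i \<in> F"
    and ind: "\<And>c. (\<Sum>i<n. const5 (c i) * f i) \<in> W \<Longrightarrow> \<forall>i<n. c i = 0"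
  shows "poly5.dim W + n \<le> poly5.dim F"
proof -
  obtain D where D: "D \<subseteq> W" "poly5.independent D" "W \<subseteq> poly5.span D" "card D = poly5.dim W"
    using poly5.basis_exists by blast
  have finD: "finite D"
    using poly5.independent_span_bound[OF F(2) D(2)] D(1) WF F(1) by blast
  have step: "poly5.independent (D \<union> f ` {..<k}) \<and> card (D \<union> f ` {..<k}) = card D + k" if "k \<le> n" for k
    using that
  proof (induction k)
    case 0
    then show ?case using D by simp
  next
    case (Suc k)
    \<comment> \<open>An explicit description of the span so far, from which the coefficients of a
      dependence of \<open>f k\<close> can be read off.\<close>
    define T where "T = {w + (\<Sum>i<k. const5 (c i) * f i) | w c. w \<in> W}"
    have T_I: "x \<in> T" if "w \<in> W" "x = w + (\<Sum>i<k. const5 (c i) * f i)" for x w c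
      using that unfolding T_def by blast
    have "poly5.subspace T"
      unfolding poly5.subspace_def
    proof (intro conjI ballI allI)
      show "0 \<in> T"
        by (rule T_I[OF poly5.subspace_0[OF W], of _ "\<lambda>_. 0"]) simp
    next
      fix x y assume "x \<in> T" "y \<in> T"
      then obtain w c w' c' where *: "w \<in> W" "w' \<in> W" "x = w + (\<Sum>i<k. const5 (c i) * f i)"
        "y = w' + (\<Sum>i<k. const5 (c' i) * f i)"
        unfolding T_def by blast
      show "x + y \<in> T"
        by (rule T_I[OF poly5.subspace_add[OF W *(1,2)], of _ "\<lambda>i. c i + c' i"])
          (simp add: *(3,4) sum.distrib distrib_right)
    next
      fix a x assume "x \<in> T"
      then obtain w c where *: "w \<in> W" "x = w + (\<Sum>i<k. const5 (c i) * f i)"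
        unfolding T_def by blast
      show "const5 a * x \<in> T"
        by (rule T_I[OF poly5.subspace_scale[OF W *(1)], of _ a "\<lambda>i. a * c i"])
          (simp add: *(2) sum_distrib_left distrib_left mult.assoc)
    qed
    moreover have "D \<union> f ` {..<k} \<subseteq> T"
    proof
      fix x assume "x \<in> D \<union> f ` {..<k}"
      then consider "x \<in> W" | i where "i < k" "x = f i" using D(1) by blast
      then show "x \<in> T"
      proof cases
        case 1
        then show ?thesis by (rule T_I[of _ _ "\<lambda>_. 0"]) simp
      next
        case 2
        have "(\<Sum>j<k. const5 (if j = i then 1 else 0) * f j) = (\<Sum>j<k. if j = i then f j else 0)"
          by (rule sum.cong) auto
        also have "\<dots> = f i" using 2(1) by simp
        finally show ?thesis
          by (intro T_I[OF poly5.subspace_0[OF W], of _ "\<lambda>j. if j = i then 1 else 0"]) (simp add: 2(2))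
      qed
    qed
    ultimately have span: "poly5.span (D \<union> f ` {..<k}) \<subseteq> T"
      by (intro poly5.span_minimal)
    have fk: "f k \<notin> poly5.span (D \<union> f ` {..<k})"
    proof
      assume "f k \<in> poly5.span (D \<union> f ` {..<k})"
      then obtain w c where w: "w \<in> W" "f k = w + (\<Sum>i<k. const5 (c i) * f i)"
        using span unfolding T_def by blast
      define c' where "c' = (\<lambda>i. if i < k then - c i else if i = k then 1 else 0)"
      have "(\<Sum>i<n. const5 (c' i) * f i) = (\<Sum>i<Suc k. const5 (c' i) * f i)"
        by (rule sum.mono_neutral_right) (use Suc.prems in \<open>auto simp: c'_def\<close>)
      also have "\<dots> = (\<Sum>i<k. - (const5 (c i) * f i)) + f k"
        by (simp add: c'_def)
      also have "\<dots> = w"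
        by (simp add: w(2) sum_negf)
      finally have "(\<Sum>i<n. const5 (c' i) * f i) \<in> W" using w(1) by simp
      from ind[OF this] Suc.prems have "c' k = 0" by simp
      then show False by (simp add: c'_def)
    qed
    have ins: "D \<union> f ` {..<Suc k} = insert (f k) (D \<union> f ` {..<k})"
      by (auto simp: lessThan_Suc)
    have "f k \<notin> D \<union> f ` {..<k}"
      by (rule contrapos_nn[OF fk poly5.span_base])
    moreover have "finite (D \<union> f ` {..<k})"
      using finD by simp
    moreover have "poly5.independent (insert (f k) (D \<union> f ` {..<k}))"
      using Suc fk by (intro poly5.independent_insertI) auto
    ultimately show ?case
      unfolding ins using Suc by simp
  qed
  have "D \<union> f ` {..<n} \<subseteq> F" using D(1) WF f by auto
  moreover obtain E where E: "E \<subseteq> F" "poly5.independent E" "F \<subseteq> poly5.span E" "card E = poly5.dim F"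
    using poly5.basis_exists by blast
  moreover have "finite E"
    using poly5.independent_span_bound[OF F(2) E(2)] E(1) F(1) by blast
  ultimately have "card (D \<union> f ` {..<n}) \<le> card E"
    using subset_trans[of "D \<union> f ` {..<n}" F "poly5.span E"] poly5.independent_span_bound[of E "D \<union> f ` {..<n}"] step[of n] by simp
  then show ?thesis
    using step[of n] D(4) E(4) by simp
qed

text \<open>A greedy choice: while \<open>card G + n < card H\<close>, the set \<open>H\<close>
  cannot lie in the span of \<open>G\<close> and the \<open>n\<close> elements already chosen, so it
  contains a new one.\<close>

lemma exists_independent_mod:
  assumes W: "poly5.subspace W" and WF: "W \<subseteq> poly5.span G" "finite G" "card G + n \<le> card H"
    and H: "poly5.independent H" "H \<subseteq> F" "finite H"
  shows "\<exists>f. (\<forall>i<n. f i \<in> F) \<and> (\<forall>c. (\<Sum>i<n. const5 (c i) * f i) \<in> W \<longrightarrow> (\<forall>i<n. c i = 0))"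
  using WF(3)
proof (induction n)
  case (Suc n)
  then obtain f where f: "\<forall>i<n. f i \<in> F" "\<forall>c. (\<Sum>i<n. const5 (c i) * f i) \<in> W \<longrightarrow> (\<forall>i<n. c i = 0)"
    by auto
  have "\<not> H \<subseteq> poly5.span (G \<union> f ` {..<n})"
  proof
    assume "H \<subseteq> poly5.span (G \<union> f ` {..<n})"
    then have "card H \<le> card (G \<union> f ` {..<n})"
      using WF(2) by (intro conjunct2[OF poly5.independent_span_bound[OF _ H(1)]]) simp_all
    also have "\<dots> \<le> card G + card (f ` {..<n})" by (rule card_Un_le)
    also have "\<dots> \<le> card G + n" using card_image_le[of "{..<n}" f] by simp
    finally show False using Suc.prems by simp
  qed
  then obtain h where h: "h \<in> H" "h \<notin> poly5.span (G \<union> f ` {..<n})" by blast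
  define f' where "f' = f(n := h)"
  have "\<forall>i<Suc n. c i = 0" if c: "(\<Sum>i<Suc n. const5 (c i) * f' i) \<in> W" for c
  proof -
    have eq: "(\<Sum>i<Suc n. const5 (c i) * f' i) = (\<Sum>i<n. const5 (c i) * f i) + const5 (c n) * h"
      by (simp add: f'_def)
    have "c n = 0"
    proof (rule ccontr)
      assume nz: "c n \<noteq> 0"
      have "W \<subseteq> poly5.span (G \<union> f ` {..<n})"
        by (rule subset_trans[OF WF(1) poly5.span_mono]) simp
      moreover have "(\<Sum>i<n. const5 (c i) * f i) \<in> poly5.span (G \<union> f ` {..<n})"
        by (intro poly5.span_sum poly5.span_scale poly5.span_base) auto
      ultimately have "const5 (c n) * h \<in> poly5.span (G \<union> f ` {..<n})"
        using poly5.span_diff[OF subsetD[OF _ c[unfolded eq]]] by fastforce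
      then have "const5 (inverse (c n)) * (const5 (c n) * h) \<in> poly5.span (G \<union> f ` {..<n})"
        by (rule poly5.span_scale)
      moreover have "const5 (inverse (c n)) * (const5 (c n) * h) = h"
        using nz by (simp add: mult.assoc[symmetric] const5_hom(4)[symmetric] del: const5_hom(4))
      ultimately show False using h(2) by simp
    qed
    then show ?thesis
      using c eq f(2) by (auto simp: less_Suc_eq)
  qed
  moreover have "\<forall>i<Suc n. f' i \<in> F"
    using f(1) h(1) H(2) by (auto simp: f'_def less_Suc_eq)
  ultimately show ?case by blast
qed simp

lemma finite_span_forms:
  obtains B :: "'k::field poly5 set" where "finite B" "forms d \<subseteq> poly5.span B"
proof -
  let ?S = "{m :: 5 \<Rightarrow>\<^sub>0 nat. \<forall>i. lookup m i \<le> d}"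
  let ?B = "(\<lambda>m. Poly_Mapping.single m (1 :: 'k)) ` ?S"
  have "finite ?B"
    by (rule finite_imageI, rule card_bounded_monomials(1))
  moreover have "forms d \<subseteq> poly5.span ?B"
  proof
    fix f :: "'k poly5" assume "f \<in> forms d"
    then have "keys f \<subseteq> ?S"
      using lookup_le_monom_degree unfolding forms_def by force
    then show "f \<in> poly5.span ?B"
      by (rule in_span_monomials)
  qed
  ultimately show ?thesis by (rule that)
qed

section \<open>Saturated graded ideals of degree six and a linear nonzerodivisor\<close>

locale six_points =
  fixes I :: "'k::alg_closed_field poly5 set"
  assumes subspace: "ideal_mod.subspace I"
    and comp_closed: "f \<in> I \<Longrightarrow> comp d f \<in> I"
    and saturated: "(\<And>g. g \<in> forms n \<Longrightarrow> g * f \<in> I) \<Longrightarrow> f \<in> I"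
    and eventually_6: "\<exists>d0. \<forall>d\<ge>d0. hilbert_function I d = 6"
begin

lemmas I_0 = ideal_mod.subspace_0[OF subspace]
  and I_add = ideal_mod.subspace_add[OF subspace]
  and I_mult = ideal_mod.subspace_scale[OF subspace]
  and I_sum = ideal_mod.subspace_sum[OF subspace]

lemma I_mult_right: "f \<in> I \<Longrightarrow> f * g \<in> I"
  using I_mult[of f g] by (simp add: mult.commute)

definition d0 :: nat where
  "d0 = (SOME d0. \<forall>d\<ge>d0. hilbert_function I d = 6)"

lemma hilbert_function_6: "d0 \<le> d \<Longrightarrow> hilbert_function I d = 6"
  using someI_ex[OF eventually_6] unfolding d0_def by blast

lemma poly5_subspace: "poly5.subspace (I \<inter> forms d)"
  unfolding poly5.subspace_def
  by (auto intro: I_0 I_add I_mult forms_add forms_scale)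

text \<open>The quotient has dimension 6 in every degree from \<open>d0\<close> on. The degree of
  the scheme enters the later arguments mainly in this form.\<close>

lemma seven_dependent:
  fixes f :: "nat \<Rightarrow> 'k poly5"
  assumes e: "d0 \<le> e" and f: "\<And>i. i < 7 \<Longrightarrow> f i \<in> forms e"
  obtains c where "\<exists>i<7. c i \<noteq> (0 :: 'k)" "(\<Sum>i<7. const5 (c i) * f i) \<in> I"
proof -
  have "\<exists>c. (\<exists>i<7. c i \<noteq> 0) \<and> (\<Sum>i<7. const5 (c i) * f i) \<in> I"
  proof (rule ccontr)
    assume contr: "\<not> ?thesis"
    obtain B where B: "finite B" "(forms e :: 'k poly5 set) \<subseteq> poly5.span B"
      by (rule finite_span_forms)
    have "poly5.dim (I \<inter> forms e) + 7 \<le> poly5.dim (forms e :: 'k poly5 set)"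
      by (rule independent_mod_dim[OF poly5_subspace _ B(2,1) f]) (use contr in auto)
    then show False
      using hilbert_function_6[OF e] by (simp add: hilbert_function_def)
  qed
  then show ?thesis using that by blast
qed

definition ann :: "'k poly5 \<Rightarrow> ('k ^ 5) set" where
  "ann f = {c. lin c * f \<in> I}"

lemma ann_subspace: "vec.subspace (ann f)"
  unfolding vec.subspace_def ann_def
  by (auto simp: I_0 lin_add lin_scale distrib_right mult.assoc intro: I_add I_mult)

lemma ann_proper: "f \<notin> I \<Longrightarrow> ann f \<noteq> UNIV"
proof
  assume "f \<notin> I" "ann f = UNIV"
  have "g * f \<in> I" if g: "g \<in> forms 1" for g
  proof -
    obtain c where "g = lin c" by (rule forms_1_lin[OF g])
    then show ?thesis using \<open>ann f = UNIV\<close> unfolding ann_def by auto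
  qed
  then show False using saturated[of 1 f] \<open>f \<notin> I\<close> by blast
qed

text \<open>The annihilators of these forms are the degree-one parts of the associated primes of \<open>I\<close>.\<close>

definition maximal_ann :: "'k poly5 \<Rightarrow> bool" where
  "maximal_ann f \<longleftrightarrow> f \<notin> I \<and> (\<exists>d. f \<in> forms d) \<and>
     (\<forall>h d. h \<in> forms d \<longrightarrow> h \<notin> I \<longrightarrow> ann f \<subseteq> ann h \<longrightarrow> ann h = ann f)"

lemma ann_mult: "ann f \<subseteq> ann (g * f)"
  using I_mult unfolding ann_def by (auto simp: mult.left_commute)

text \<open>The substitute for primeness of a maximal annihilator: the product is still outside
  \<open>I\<close> and its annihilator can only have grown, so maximality forces equality.\<close>

lemma maximal_ann_lin:
  assumes "maximal_ann f" "c \<notin> ann f"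
  shows "maximal_ann (lin c * f) \<and> ann (lin c * f) = ann f"
proof -
  obtain d where d: "f \<in> forms d" using assms(1) unfolding maximal_ann_def by blast
  have 1: "lin c * f \<in> forms (1 + d)" by (rule forms_mult[OF lin_forms d])
  have 2: "lin c * f \<notin> I" using assms(2) by (simp add: ann_def)
  have eq: "ann (lin c * f) = ann f"
    using assms(1) 1 2 ann_mult unfolding maximal_ann_def by blast
  show ?thesis
    using assms(1) 1 2 unfolding maximal_ann_def eq by blast
qed

lemma maximal_ann_prod:
  assumes "maximal_ann f" "finite A" "\<And>i. i \<in> A \<Longrightarrow> c i \<notin> ann f"
  shows "maximal_ann ((\<Prod>i\<in>A. lin (c i)) * f) \<and> ann ((\<Prod>i\<in>A. lin (c i)) * f) = ann f"
  using assms(2,3)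
proof (induction A rule: finite_induct)
  case (insert i A)
  then have IH: "maximal_ann ((\<Prod>i\<in>A. lin (c i)) * f)" "ann ((\<Prod>i\<in>A. lin (c i)) * f) = ann f"
    by auto
  have eq: "(\<Prod>i\<in>insert i A. lin (c i)) * f = lin (c i) * ((\<Prod>i\<in>A. lin (c i)) * f)"
    using insert by (simp add: mult.assoc)
  show ?case
    unfolding eq using maximal_ann_lin[OF IH(1), of "c i"] IH(2) insert.prems[of i] by simp
qed (use assms(1) in simp)

text \<open>Annihilators are subspaces of \<open>k^5\<close>, so one of largest dimension containing
  \<open>c\<close> exists.\<close>

lemma maximal_ann_exists:
  assumes "f \<in> forms d" "f \<notin> I" "c \<in> ann f"
  obtains h where "maximal_ann h" "c \<in> ann h"
proof -
  define S where "S = {n. \<exists>h d. h \<in> forms d \<and> h \<notin> I \<and> c \<in> ann h \<and> n = vec.dim (ann h)}"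
  have "vec.dim (A :: ('k ^ 5) set) \<le> 5" for A
    using vec.dim_subset_UNIV[of A] by (simp add: vec.dimension_def card_cart_basis)
  then have "finite S"
    by (intro finite_subset[of S "{..5}"]) (auto simp: S_def)
  moreover have "S \<noteq> {}" using assms unfolding S_def by blast
  ultimately have "Max S \<in> S" by (rule Max_in)
  then obtain h d' where h: "h \<in> forms d'" "h \<notin> I" "c \<in> ann h" "vec.dim (ann h) = Max S"
    unfolding S_def by auto
  have "ann h' = ann h" if h': "h' \<in> forms e" "h' \<notin> I" "ann h \<subseteq> ann h'" for h' e
  proof -
    have "vec.dim (ann h') \<in> S" using h' h(3) unfolding S_def by blast
    then have "vec.dim (ann h') \<le> vec.dim (ann h)"
      using \<open>finite S\<close> h(4) by simp
    then show ?thesis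
      using vec.subspace_dim_equal[OF ann_subspace ann_subspace h'(3)] by simp
  qed
  then have "maximal_ann h"
    using h(1,2) unfolding maximal_ann_def by blast
  then show ?thesis using h(3) that by blast
qed

lemma zero_divisor_comp:
  assumes "lin c * f \<in> I" "f \<notin> I"
  obtains h d where "h \<in> forms d" "h \<notin> I" "c \<in> ann h"
proof -
  obtain d where d: "comp d f \<notin> I"
    using assms(2) sum_comp[of f] I_sum[of "monom_degree ` keys f" "\<lambda>d. comp d f"] by metis
  have "comp (d + 1) (lin c * f) = lin c * comp d f"
    by (rule comp_forms_mult[OF lin_forms])
  then have "lin c * comp d f \<in> I"
    using comp_closed[OF assms(1), of "d + 1"] by simp
  then show ?thesis
    using that[OF comp_forms d] by (simp add: ann_def)
qed

text \<open>If every linear form were a zero divisor, one could choose seven pairs in turn: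
  \<open>c j\<close> outside the annihilators of all earlier \<open>f i\<close>, and
  \<open>f j\<close> with maximal annihilator containing \<open>c j\<close>. Brought to one large
  degree, the seven forms turn out independent modulo \<open>I\<close>, one too many.\<close>

lemma nonzerodivisor_exists:
  "\<exists>c. \<forall>f. lin c * f \<in> I \<longrightarrow> f \<in> I"
proof (rule ccontr)
  assume "\<not> ?thesis"
  then have max: "\<exists>h. maximal_ann h \<and> c \<in> ann h" for c
    using zero_divisor_comp[of c] maximal_ann_exists[of _ _ c] by metis
  have avoid: "\<exists>c. \<forall>f\<in>F. c \<notin> ann f" if "finite F" "\<forall>f\<in>F. maximal_ann f" for F
  proof -
    have "\<exists>c. \<forall>A\<in>ann ` F. c \<notin> A"
      by (rule avoid_subspaces[OF infinite_alg_closed])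
        (use that ann_subspace ann_proper in \<open>auto simp: maximal_ann_def\<close>)
    then show ?thesis by blast
  qed
  have seq: "\<exists>f c. \<forall>j<n. maximal_ann (f j) \<and> c j \<in> ann (f j) \<and> (\<forall>i<j. c j \<notin> ann (f i))" for n :: nat
  proof (induction n)
    case (Suc n)
    then obtain f c where IH: "\<forall>j<n. maximal_ann (f j) \<and> c j \<in> ann (f j) \<and> (\<forall>i<j. c j \<notin> ann (f i))"
      by blast
    obtain c' where c': "\<forall>h\<in>f ` {..<n}. c' \<notin> ann h"
      using avoid[of "f ` {..<n}"] IH by auto
    obtain f' where f': "maximal_ann f'" "c' \<in> ann f'" using max by blast
    have "\<forall>j<Suc n. maximal_ann ((f(n := f')) j) \<and> (c(n := c')) j \<in> ann ((f(n := f')) j) \<and>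
        (\<forall>i<j. (c(n := c')) j \<notin> ann ((f(n := f')) i))"
      using IH c' f' by (auto simp: less_Suc_eq)
    then show ?case by blast
  qed simp
  obtain f c where fc: "\<forall>j<7::nat. maximal_ann (f j) \<and> c j \<in> ann (f j) \<and> (\<forall>i<j. c j \<notin> ann (f i))"
    using seq[of 7] by (elim exE)
  obtain x where x: "\<forall>j<7. x \<notin> ann (f j)"
    using avoid[of "f ` {..<7}"] fc by auto
  obtain deg where deg: "\<forall>j<7. f j \<in> forms (deg j)"
    using fc unfolding maximal_ann_def by metis
  \<comment> \<open>A common degree that is at least \<open>d0\<close> and at least every
    \<open>deg j\<close>. Multiplying by powers of \<open>lin x\<close>, which avoids all seven
    annihilators, reaches it without changing them.\<close>
  define E where "E = d0 + (\<Sum>j<7. deg j)"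
  have degE: "deg j \<le> E" if "j < 7" for j
    using member_le_sum[of j "{..<7}" deg] that unfolding E_def by simp
  define g where "g = (\<lambda>j. (\<Prod>i<E - deg j. lin x) * f j)"
  have g: "maximal_ann (g j) \<and> ann (g j) = ann (f j)" if "j < 7" for j
    unfolding g_def by (rule maximal_ann_prod) (use that fc x in auto)
  have gE: "g j \<in> forms E" if "j < 7" for j
  proof -
    have "(\<Prod>i<E - deg j. lin x) * f j \<in> forms ((E - deg j) * 1 + deg j)"
      unfolding prod_constant card_lessThan by (intro forms_mult forms_power lin_forms) (use deg that in auto)
    then show ?thesis using degE[OF that] by (simp add: g_def)
  qed
  obtain a where a: "\<exists>i<7. a i \<noteq> 0" "(\<Sum>i<7. const5 (a i) * g i) \<in> I"
    using seven_dependent[of E g] gE unfolding E_def by auto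
  have "a j = 0" if "j < 7" for j
    using that
  proof (induction j rule: less_induct)
    case (less j)
    \<comment> \<open>This product kills every \<open>g i\<close> with \<open>i > j\<close>, since
      it contains a factor from \<open>ann (g i)\<close>. It leaves \<open>g j\<close> outside
      \<open>I\<close>, because all its factors were chosen outside \<open>ann (f j)\<close>. The
      terms with \<open>i < j\<close> vanish by induction.\<close>
    define P where "P = (\<Prod>i\<in>{j<..<7}. lin (c i))"
    have "P * (\<Sum>i<7. const5 (a i) * g i) = (\<Sum>i<7. const5 (a i) * (P * g i))"
      by (simp add: sum_distrib_left mult.left_commute)
    also have "\<dots> = const5 (a j) * (P * g j) + (\<Sum>i\<in>{..<7} - {j}. const5 (a i) * (P * g i))"
      by (rule sum.remove) (use less in auto)
    finally have eq: "P * (\<Sum>i<7. const5 (a i) * g i) = \<dots>" .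
    have rest: "(\<Sum>i\<in>{..<7} - {j}. const5 (a i) * (P * g i)) \<in> I"
    proof (rule I_sum)
      fix i assume i: "i \<in> {..<7} - {j}"
      show "const5 (a i) * (P * g i) \<in> I"
      proof (cases "i < j")
        case True
        then show ?thesis using less i by (simp add: I_0)
      next
        case False
        then have ij: "i \<in> {j<..<7}" using i by auto
        have "P = (\<Prod>i\<in>{j<..<7} - {i}. lin (c i)) * lin (c i)"
          unfolding P_def by (subst prod.remove[OF _ ij]) (simp_all add: mult.commute)
        moreover have "lin (c i) * g i \<in> I"
          using fc g ij unfolding ann_def by auto
        ultimately have "P * g i \<in> I"
          by (simp add: mult.assoc I_mult)
        then show ?thesis by (rule I_mult)
      qed
    qed
    have all: "P * (\<Sum>i<7. const5 (a i) * g i) \<in> I"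
      by (rule I_mult[OF a(2)])
    have 1: "const5 (a j) * (P * g j) \<in> I"
      using ideal_mod.subspace_diff[OF subspace all rest] unfolding eq by simp
    have "maximal_ann (P * g j)"
      unfolding P_def
      by (rule conjunct1[OF maximal_ann_prod]) (use g[OF less.prems] fc in auto)
    then have 2: "P * g j \<notin> I"
      by (simp add: maximal_ann_def)
    show "a j = 0"
    proof (rule ccontr)
      assume nz: "a j \<noteq> 0"
      have "const5 (inverse (a j)) * (const5 (a j) * (P * g j)) \<in> I"
        by (rule I_mult[OF 1])
      moreover have "const5 (inverse (a j)) * (const5 (a j) * (P * g j)) = P * g j"
        unfolding mult.assoc[symmetric] const5_hom(4)[symmetric] using nz by simp
      ultimately show False using 2 by simp
    qed
  qed
  then show False using a(1) by blast
qed

end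

lemma forms_0_const:
  assumes "f \<in> forms 0"
  shows "f = const5 (lookup f 0)"
proof (rule poly_mapping_eqI)
  fix m
  have "m = 0" if "m \<in> keys f"
    using assms that lookup_le_monom_degree[of m] unfolding forms_def by (auto intro!: poly_mapping_eqI)
  then show "lookup f m = lookup (const5 (lookup f 0)) m"
    by (auto simp: const5_def lookup_single when_def in_keys_iff)
qed

lemma span_forms_in_poly5_span:
  assumes "f \<in> ideal_mod.span F" "F \<subseteq> forms d"
  shows "comp d f \<in> poly5.span F"
  using assms(1)
proof (induction rule: ideal_mod.span_induct_alt)
  case base
  then show ?case by (simp add: poly5.span_zero)
next
  case (step c g y)
  have g: "g \<in> forms d" using step assms(2) by blast
  have "comp (0 + d) (g * c) = g * comp 0 c"
    by (rule comp_forms_mult[OF g])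
  then have "comp d (c * g) = const5 (lookup (comp 0 c) 0) * g"
    using forms_0_const[OF comp_forms[of 0 c]] by (simp add: mult.commute)
  moreover have "const5 (lookup (comp 0 c) 0) * g \<in> poly5.span F"
    by (intro poly5.span_scale poly5.span_base step)
  ultimately show ?case
    using poly5.span_add[OF _ step.IH] by (simp add: part_add)
qed

text \<open>Quadratic monomials in five variables are encoded by subsets: the 5 singletons give
  squares, which explains the exponent 2 in \<open>e\<close>, and the 10 pairs give
  products.\<close>

lemma quadratic_monomials: "\<exists>S. finite S \<and> card S = 15 \<and> (\<forall>m\<in>S. monom_degree m = 2)"
proof -
  define e where "e = (\<lambda>A. (if card (A :: 5 set) = 1 then 2 else 1 :: nat))"
  define q where "q = (\<lambda>A. \<Sum>i\<in>A. Poly_Mapping.single i (e A))"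
  have lookup_q: "lookup (q A) i = (if i \<in> A then e A else 0)" for A i
    by (simp add: q_def lookup_sum lookup_single when_def)
  have "inj_on q T" for T
  proof (rule inj_onI)
    fix A B assume "q A = q B"
    then have "(i \<in> A) = (i \<in> B)" for i
      using lookup_q[of A i] lookup_q[of B i] by (auto simp: e_def split: if_splits)
    then show "A = B" by blast
  qed
  moreover have "monom_degree (q A) = card A * e A" for A
    by (simp add: monom_degree_def lookup_q sum.If_cases)
  moreover define T where "T = {A. card (A :: 5 set) = 1} \<union> {A. card A = 2}"
  moreover have "card T = 15"
  proof -
    have "card {A. card (A :: 5 set) = k} = 5 choose k" for k
      using n_subsets[of "UNIV :: 5 set" k] by simp
    then show ?thesis
      unfolding T_def by (subst card_Un_disjoint) (auto simp: choose_two)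
  qed
  ultimately show ?thesis
    by (intro exI[of _ "q ` T"]) (auto simp: card_image e_def)
qed

lemma inj_single_1: "inj (\<lambda>m. Poly_Mapping.single m (1 :: 'k::field))"
  by (rule injI) (metis lookup_single_eq lookup_single_not_eq zero_neq_one)

lemma var5_independent:
  "poly5.independent (range (var5 :: 5 \<Rightarrow> 'k::field poly5))" "card (range (var5 :: 5 \<Rightarrow> 'k poly5)) = 5"
proof -
  have eq: "range (var5 :: 5 \<Rightarrow> 'k poly5) = (\<lambda>m. Poly_Mapping.single m 1) ` range (\<lambda>i. Poly_Mapping.single i 1)"
    by (auto simp: var5_def)
  show "poly5.independent (range (var5 :: 5 \<Rightarrow> 'k poly5))"
    unfolding eq by (rule monomials_independent)
  have "inj (\<lambda>i :: 5. Poly_Mapping.single i (1 :: nat))"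
    by (rule injI) (metis lookup_single_eq lookup_single_not_eq zero_neq_one)
  then show "card (range (var5 :: 5 \<Rightarrow> 'k poly5)) = 5"
    unfolding eq by (subst card_image[OF inj_on_subset[OF inj_single_1]]) (simp_all add: card_image)
qed

lemma forms_1_span_var5: "forms 1 \<subseteq> poly5.span (range var5)"
proof
  fix f :: "'a poly5" assume "f \<in> forms 1"
  then obtain c where "f = lin c" by (rule forms_1_lin)
  then show "f \<in> poly5.span (range var5)"
    by (simp only: lin_def) (intro poly5.span_sum poly5.span_scale poly5.span_base rangeI)
qed

lemma six_linear_forms_dependent:
  fixes f :: "nat \<Rightarrow> 'k::field poly5"
  assumes f: "\<And>i. i < 6 \<Longrightarrow> f i \<in> forms 1"
  obtains c where "\<exists>i<6. c i \<noteq> 0" "(\<Sum>i<6. const5 (c i) * f i) = 0"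
proof -
  have "\<exists>c. (\<exists>i<6. c i \<noteq> 0) \<and> (\<Sum>i<6. const5 (c i) * f i) = 0"
  proof (rule ccontr)
    assume contr: "\<not> ?thesis"
    have "poly5.dim {0 :: 'k poly5} + 6 \<le> poly5.dim (forms 1 :: 'k poly5 set)"
      by (rule independent_mod_dim[OF poly5.subspace_single_0 _ forms_1_span_var5 _ f]) (use contr in auto)
    moreover have "poly5.dim (forms 1 :: 'k poly5 set) \<le> card (range (var5 :: 5 \<Rightarrow> 'k poly5))"
      by (rule poly5.dim_le_card[OF forms_1_span_var5]) simp
    ultimately show False using var5_independent(2)[where 'k='k] by simp
  qed
  then show ?thesis using that by blast
qed

text \<open>A functional vanishing on \<open>W\<close> but not everywhere; its values on the
  standard basis are the coordinates of a nonzero point at which all linear forms from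
  \<open>W\<close> vanish.\<close>

lemma proper_subspace_annihilator:
  fixes W :: "('k::field ^ 'n) set"
  assumes "vec.subspace W" "W \<noteq> UNIV"
  obtains P where "\<exists>i. P i \<noteq> 0" "\<And>c. c \<in> W \<Longrightarrow> (\<Sum>i\<in>UNIV. c $ i * P i) = 0"
proof -
  interpret vs: vector_space_pair "(*s) :: 'k \<Rightarrow> 'k ^ 'n \<Rightarrow> 'k ^ 'n" "(*) :: 'k \<Rightarrow> 'k \<Rightarrow> 'k"
    by unfold_locales
  obtain x where x: "x \<notin> W" using assms(2) by blast
  obtain B where B: "B \<subseteq> W" "vec.independent B" "W \<subseteq> vec.span B"
    by (rule vec.basis_exists[of W])
  have span: "vec.span B = W"
    by (rule subset_antisym[OF vec.span_minimal[OF B(1) assms(1)] B(3)])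
  have ind: "vec.independent (insert x B)"
    by (rule vec.independent_insertI) (use x span B in auto)
  obtain g where g: "Vector_Spaces.linear (*s) (*) g \<and> (\<forall>y\<in>insert x B. g y = (if y = x then 1 else 0 :: 'k))"
    using vs.linear_independent_extend[OF ind, of "\<lambda>y. if y = x then 1 else 0"] by (elim exE)
  interpret g: Vector_Spaces.linear "(*s)" "(*)" g by (rule conjunct1[OF g])
  have g_sum: "g c = (\<Sum>i\<in>UNIV. c $ i * g (axis i 1))" for c
  proof -
    have "g c = g (\<Sum>i\<in>UNIV. c $ i *s axis i 1)"
      by (simp add: basis_expansion)
    also have "\<dots> = (\<Sum>i\<in>UNIV. c $ i * g (axis i 1))"
      by (simp only: g.sum g.scale)
    finally show ?thesis .
  qed
  have zero: "g y = 0" if "y \<in> W" for y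
    by (rule g.eq_0_on_span[of B]) (use that conjunct2[OF g] x B(1) span in auto)
  have nz: "\<exists>i. g (axis i 1) \<noteq> 0"
  proof (rule ccontr)
    assume "\<not> ?thesis"
    then have "g x = 0" unfolding g_sum[of x] by simp
    then show False using g by simp
  qed
  show ?thesis
    by (rule that[OF nz]) (simp only: g_sum[symmetric] zero)
qed

section \<open>Consequences of the nonzerodivisor for generators and zeros\<close>

context six_points
begin

definition ell :: "'k poly5" where
  "ell = lin (SOME c. \<forall>f. lin c * f \<in> I \<longrightarrow> f \<in> I)"

lemma ell_forms: "ell \<in> forms 1"
  unfolding ell_def by (rule lin_forms)

lemma ell_cancel: "ell * f \<in> I \<Longrightarrow> f \<in> I"
  using spec[OF someI_ex[OF nonzerodivisor_exists], of f] unfolding ell_def by (rule mp)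

lemma ell_power_cancel: "ell ^ n * f \<in> I \<Longrightarrow> f \<in> I"
  by (induction n) (auto dest: ell_cancel simp: mult.assoc)

lemma one_notin: "1 \<notin> I"
proof
  assume "1 \<in> I"
  then have "I = UNIV" using I_mult_right[of 1] by auto
  then show False
    using hilbert_function_6[of d0] by (simp add: hilbert_function_def)
qed

text \<open>There are 15 quadratic monomials. With at most 8 generators, 7 quadrics would be
  independent modulo \<open>I\<close>.\<close>

lemma generators_card:
  assumes "I = ideal_mod.span F" "F \<subseteq> forms 2" "finite F"
  shows "9 \<le> card F"
proof (rule ccontr)
  assume "\<not> 9 \<le> card F"
  then have card: "card F + 7 \<le> 15" by simp
  obtain S :: "(5 \<Rightarrow>\<^sub>0 nat) set" where S: "finite S" "card S = 15" "\<forall>m\<in>S. monom_degree m = 2"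
    using quadratic_monomials by blast
  define H where "H = (\<lambda>m. Poly_Mapping.single m (1 :: 'k)) ` S"
  have H: "H \<subseteq> forms 2" "finite H" "card H = 15"
    using S card_image[OF inj_on_subset[OF inj_single_1[where 'k='k]], of S] by (auto simp: H_def forms_def)
  have "I \<inter> forms 2 \<subseteq> poly5.span F"
  proof
    fix f assume f: "f \<in> I \<inter> forms 2"
    then have "comp 2 f \<in> poly5.span F"
      using assms by (intro span_forms_in_poly5_span) auto
    then show "f \<in> poly5.span F" using f comp_eq_self[of f 2] by simp
  qed
  then obtain f where f: "\<forall>i<7. f i \<in> forms 2"
    "\<forall>c. (\<Sum>i<7. const5 (c i) * f i) \<in> I \<inter> forms 2 \<longrightarrow> (\<forall>i<7::nat. c i = 0)"
    using exists_independent_mod[OF poly5_subspace _ assms(3) _ monomials_independent[where 'a='k, of S, folded H_def] H(1,2), of 2 7]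
      card H(3) by auto
  \<comment> \<open>Multiplication by a power of \<open>ell\<close> carries the seven quadrics
    injectively into a degree where the quotient has dimension 6.\<close>
  have "ell ^ d0 * f i \<in> forms (d0 * 1 + 2)" if "i < 7" for i
    by (intro forms_mult forms_power ell_forms) (use f(1) that in auto)
  then obtain c where c: "\<exists>i<7. c i \<noteq> 0" "(\<Sum>i<7. const5 (c i) * (ell ^ d0 * f i)) \<in> I"
    by (rule seven_dependent[rotated]) auto
  have "(\<Sum>i<7. const5 (c i) * (ell ^ d0 * f i)) = ell ^ d0 * (\<Sum>i<7. const5 (c i) * f i)"
    by (simp add: sum_distrib_left mult.left_commute)
  then have "(\<Sum>i<7. const5 (c i) * f i) \<in> I"
    using c(2) ell_power_cancel by metis
  moreover have "(\<Sum>i<7. const5 (c i) * f i) \<in> forms 2"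
    by (intro forms_sum forms_scale) (use f(1) in auto)
  ultimately show False using f(2) c(1) by blast
qed

text \<open>Multiplication by \<open>ell\<close> is eventually bijective on the six-dimensional graded pieces of the
  quotient, so every linear form is integral over the polynomial ring in \<open>ell\<close>.\<close>

lemma monic_relation:
  assumes y: "y \<in> forms 1"
  obtains d k c where "c k \<noteq> 0" "(\<Sum>i\<le>k. const5 (c i) * (y ^ (d + i) * ell ^ (k - i))) \<in> I"
proof -
  \<comment> \<open>Seven forms of one degree. The extra factor \<open>y ^ d0\<close> only raises
    that degree to the range where the Hilbert function is known to be 6.\<close>
  have "y ^ (d0 + i) * ell ^ (6 - i) \<in> forms (d0 + 6)" if "i < 7" for i
  proof -
    have "y ^ (d0 + i) * ell ^ (6 - i) \<in> forms ((d0 + i) * 1 + (6 - i) * 1)"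
      by (intro forms_mult forms_power y ell_forms)
    then show ?thesis using that by simp
  qed
  then obtain c where c: "\<exists>i<7. c i \<noteq> 0" "(\<Sum>i<7. const5 (c i) * (y ^ (d0 + i) * ell ^ (6 - i))) \<in> I"
    by (rule seven_dependent[rotated]) auto
  \<comment> \<open>With \<open>k\<close> the last index carrying a nonzero coefficient, the whole
    relation is divisible by \<open>ell ^ (6 - k)\<close>, which can be cancelled. The relation that
    remains has a constant leading coefficient in \<open>y\<close>.\<close>
  define k where "k = Max {i. i < 7 \<and> c i \<noteq> 0}"
  have fin: "finite {i. i < 7 \<and> c i \<noteq> 0}" by simp
  have "k \<in> {i. i < 7 \<and> c i \<noteq> 0}"
    unfolding k_def by (rule Max_in[OF fin]) (use c(1) in auto)
  then have k: "k < 7" "c k \<noteq> 0" by auto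
  have above: "c i = 0" if "k < i" "i < 7" for i
    using Max_ge[OF fin, of i] that unfolding k_def by (metis (mono_tags, lifting) mem_Collect_eq not_le)
  have "(\<Sum>i<7. const5 (c i) * (y ^ (d0 + i) * ell ^ (6 - i))) = (\<Sum>i\<le>k. const5 (c i) * (y ^ (d0 + i) * ell ^ (6 - i)))"
    by (rule sum.mono_neutral_right) (use k above in \<open>auto simp: not_le\<close>)
  also have "\<dots> = ell ^ (6 - k) * (\<Sum>i\<le>k. const5 (c i) * (y ^ (d0 + i) * ell ^ (k - i)))"
    unfolding sum_distrib_left
  proof (rule sum.cong)
    fix i assume "i \<in> {..k}"
    then have "6 - i = (6 - k) + (k - i)" using k(1) by auto
    then have "ell ^ (6 - i) = ell ^ (6 - k) * ell ^ (k - i)"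
      by (simp only: power_add)
    then show "const5 (c i) * (y ^ (d0 + i) * ell ^ (6 - i)) = ell ^ (6 - k) * (const5 (c i) * (y ^ (d0 + i) * ell ^ (k - i)))"
      by (simp only: mult_ac)
  qed simp
  finally have "ell ^ (6 - k) * (\<Sum>i\<le>k. const5 (c i) * (y ^ (d0 + i) * ell ^ (k - i))) \<in> I"
    using c(2) by simp
  then show ?thesis
    using that[of c k d0] k(2) ell_power_cancel by blast
qed

text \<open>At a zero of \<open>I\<close> on \<open>ell = 0\<close>, the integral equation of the
  coordinate \<open>var5 i\<close> loses every term except its leading one.\<close>

lemma no_common_zero:
  assumes zero: "\<And>f. f \<in> I \<Longrightarrow> peval (\<lambda>a. a) P f = 0" and ell: "peval (\<lambda>a. a) P ell = 0"
  shows "P i = 0"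
proof -
  obtain d k c where c: "c k \<noteq> 0" "(\<Sum>j\<le>k. const5 (c j) * (var5 i ^ (d + j) * ell ^ (k - j))) \<in> I"
    by (rule monic_relation[OF var5_forms])
  have "0 = (\<Sum>j\<le>k. c j * (P i ^ (d + j) * 0 ^ (k - j)))"
    using zero[OF c(2)] ell
    by (simp add: field_hom.peval_sum field_hom.peval_mult field_hom.peval_power)
  also have "\<dots> = (\<Sum>j\<le>k. if j = k then c k * P i ^ (d + k) else 0)"
    by (rule sum.cong) auto
  also have "\<dots> = c k * P i ^ (d + k)" by simp
  finally show "P i = 0" using c(1) by simp
qed

text \<open>Otherwise a nonzero point would be a common zero of \<open>ell\<close> and
  \<open>F\<close>, hence of \<open>I\<close>.\<close>

lemma forms_1_span:
  assumes F: "F \<subseteq> forms 1" "I \<subseteq> ideal_mod.span F" and y: "y \<in> forms 1"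
  shows "y \<in> poly5.span (insert ell F)"
proof (rule ccontr)
  assume notin: "y \<notin> poly5.span (insert ell F)"
  define W where "W = {c. lin c \<in> poly5.span (insert ell F)}"
  have "vec.subspace W"
    by (auto simp: vec.subspace_def W_def lin_add lin_scale poly5.span_zero intro: poly5.span_add poly5.span_scale)
  moreover have "W \<noteq> UNIV"
  proof -
    obtain c where "y = lin c" by (rule forms_1_lin[OF y])
    then have "c \<notin> W" using notin by (simp add: W_def)
    then show ?thesis by blast
  qed
  ultimately obtain P where P: "\<exists>i. P i \<noteq> 0" "\<And>c. c \<in> W \<Longrightarrow> (\<Sum>i\<in>UNIV. c $ i * P i) = 0"
    using proper_subspace_annihilator by blast
  have zero: "peval (\<lambda>a. a) P f = 0" if "f \<in> insert ell F" for f
  proof -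
    have "f \<in> forms 1" using that F(1) ell_forms by blast
    then obtain c where "f = lin c" by (rule forms_1_lin)
    then show ?thesis
      using P(2)[of c] poly5.span_base[OF that] by (simp add: W_def field_hom.peval_lin)
  qed
  have "peval (\<lambda>a. a) P f = 0" if "f \<in> I" for f
    using field_hom.peval_span[of f F P "{}"] that F(2) zero by auto
  then show False
    using no_common_zero[of P] P(1) zero[of ell] by blast
qed

lemma not_in_three_forms:
  assumes "y1 \<in> forms 1" "y2 \<in> forms 1" "y3 \<in> forms 1"
  shows "\<not> I \<subseteq> ideal_mod.span {y1, y2, y3}"
proof
  assume "I \<subseteq> ideal_mod.span {y1, y2, y3}"
  then have "range var5 \<subseteq> poly5.span (insert ell {y1, y2, y3})"
    using forms_1_span[of "{y1, y2, y3}"] assms var5_forms by auto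
  then have "card (range (var5 :: 5 \<Rightarrow> 'k poly5)) \<le> card (insert ell {y1, y2, y3})"
    by (intro conjunct2[OF poly5.independent_span_bound[OF _ var5_independent(1)]]) simp
  also have "\<dots> \<le> 4"
    by (simp add: card_insert_if)
  finally show False using var5_independent(2)[where 'k='k] by simp
qed

end

section \<open>Depth\<close>

lemma (in coefficient_hom) peval_diff: "peval \<iota> x (f - g) = peval \<iota> x f - peval \<iota> x g"
  using peval_add[of x "f - g" g] by (simp add: eq_diff_eq)

lemma eq_var5_power_mult_peval:
  assumes "\<And>m. m \<in> keys f \<Longrightarrow> lookup m i = n"
  shows "f = var5 i ^ n * peval const5 (var5(i := 1)) f"
proof -
  have "Poly_Mapping.single m (lookup f m) = var5 i ^ n * (const5 (lookup f m) * (\<Prod>j\<in>UNIV. (var5(i := 1)) j ^ lookup m j))"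
    if "m \<in> keys f" for m
  proof -
    have "(\<Prod>j\<in>UNIV. var5 j ^ lookup m j) = var5 i ^ n * (\<Prod>j\<in>UNIV - {i}. var5 j ^ lookup m j :: 'a poly5)"
      by (subst prod.remove[of UNIV i]) (simp_all add: assms[OF that])
    also have "(\<Prod>j\<in>UNIV - {i}. var5 j ^ lookup m j :: 'a poly5) = (\<Prod>j\<in>UNIV. (var5(i := 1)) j ^ lookup m j)"
      by (subst prod.remove[of UNIV i]) (auto intro: prod.cong)
    finally show ?thesis
      by (simp only: single_eq_prod_var5 mult.left_commute)
  qed
  then have "(\<Sum>m\<in>keys f. Poly_Mapping.single m (lookup f m)) = (\<Sum>m\<in>keys f. var5 i ^ n * (const5 (lookup f m) * (\<Prod>j\<in>UNIV. (var5(i := 1)) j ^ lookup m j)))"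
    by (rule sum.cong[OF refl])
  then show ?thesis
    by (simp only: poly_mapping_sum_single peval_def sum_distrib_left)
qed

lemma keys_multE:
  assumes "m \<in> keys (f * g)"
  obtains a b where "a \<in> keys f" "b \<in> keys g" "m = a + b"
  using assms keys_mult[of f g] by blast

lemma keys_addE:
  assumes "m \<in> keys (f + g)"
  shows "m \<in> keys f \<or> m \<in> keys g"
  using assms keys_add[of f g] by blast

lemma keys_sumE:
  assumes "m \<in> keys (\<Sum>a\<in>A. f a)"
  shows "\<exists>a\<in>A. m \<in> keys (f a)"
  using assms by (induction A rule: infinite_finite_induct) (auto dest: keys_addE)

lemma keys_var5_power: "m \<in> keys (var5 i ^ n :: 'k::field poly5) \<Longrightarrow> m = Poly_Mapping.single i n"
  by (simp add: var5_power)

lemma keys_const5: "m \<in> keys (const5 c) \<Longrightarrow> m = 0"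
  by (simp add: const5_def split: if_splits)

lemma keys_const5_mult: "m \<in> keys (const5 c * f) \<Longrightarrow> m \<in> keys f"
  by (auto simp: in_keys_iff lookup_const5_mult)

text \<open>Since \<open>G\<close> does not involve the variable, its ideal contains the
  coefficients of each of its members in that variable. The top coefficient of \<open>h * y\<close>
  is \<open>a\<close> times that of \<open>y\<close>, so the top part \<open>P\<close> of
  \<open>y\<close> lies in the ideal; it is removed and the degree drops.\<close>

lemma monic_nonzerodivisor:
  assumes G: "\<And>g m. g \<in> G \<Longrightarrow> m \<in> keys g \<Longrightarrow> lookup m i = 0"
    and h: "h = const5 a * var5 i ^ n + h'" "a \<noteq> 0" "\<And>m. m \<in> keys h' \<Longrightarrow> lookup m i < n"
    and y: "h * y \<in> ideal_mod.span G" "\<And>m. m \<in> keys y \<Longrightarrow> lookup m i < N"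
  shows "y \<in> ideal_mod.span G"
  using y
proof (induction N arbitrary: y)
  case 0
  then have "keys y = {}" by blast
  then show ?case by (simp add: ideal_mod.span_zero)
next
  case (Suc N)
  define P where "P = part (\<lambda>m. lookup m i = N) y"
  let ?e = "peval const5 (var5(i := 1))"
  have part_closed: "part (\<lambda>m. lookup m i = l) f \<in> ideal_mod.span G" if "f \<in> ideal_mod.span G" for f l
    using that
  proof (induction rule: ideal_mod.span_induct_alt)
    case base
    then show ?case by (simp add: ideal_mod.span_zero)
  next
    case (step c g z)
    have "part (\<lambda>m. lookup m i = l) (g * c) = g * part (\<lambda>m. lookup m i = l) c"
      by (rule part_mult) (use G[OF step(1)] in \<open>auto simp: lookup_add\<close>)
    then have "part (\<lambda>m. lookup m i = l) (c * g) = part (\<lambda>m. lookup m i = l) c * g"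
      by (simp only: mult.commute)
    then show ?case
      unfolding part_add
      by (metis ideal_mod.span_add ideal_mod.span_base ideal_mod.span_scale step.IH step.hyps(1))
  qed
  have e_closed: "?e f \<in> ideal_mod.span G" if "f \<in> ideal_mod.span G" for f
  proof (rule const5_hom.peval_span[OF that])
    fix g assume "g \<in> G"
    then have "g = var5 i ^ 0 * ?e g"
      using G by (intro eq_var5_power_mult_peval) auto
    then show "?e g \<in> ideal_mod.span G"
      using \<open>g \<in> G\<close> by (simp add: ideal_mod.span_base)
  qed
  \<comment> \<open>Only the leading terms of \<open>h\<close> and \<open>y\<close> can contribute
    exponent \<open>n + N\<close>.\<close>
  have "part (\<lambda>m. lookup m i = n + N) (h * y) = const5 a * var5 i ^ n * P"
  proof -
    have "part (\<lambda>m. lookup m i = n + N) (const5 a * var5 i ^ n * y) = const5 a * var5 i ^ n * P"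
      unfolding P_def by (rule part_mult) (auto simp: lookup_add lookup_single dest!: keys_const5_mult keys_var5_power)
    moreover have "part (\<lambda>m. lookup m i = n + N) (h' * y) = 0"
    proof (rule part_eq_0)
      fix m assume "m \<in> keys (h' * y)"
      then obtain b c where "b \<in> keys h'" "c \<in> keys y" "m = b + c" by (rule keys_multE)
      then show "lookup m i \<noteq> n + N"
        using h(3)[of b] Suc.prems(2)[of c] by (simp add: lookup_add)
    qed
    ultimately show ?thesis
      unfolding h(1) by (simp add: distrib_right part_add)
  qed
  then have "const5 a * var5 i ^ n * P \<in> ideal_mod.span G"
    using part_closed[OF Suc.prems(1), of "n + N"] by simp
  from e_closed[OF this] have "const5 a * ?e P \<in> ideal_mod.span G"
    by (simp add: const5_hom.peval_mult const5_hom.peval_power)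
  from ideal_mod.span_scale[OF this, of "const5 (inverse a)"] have "?e P \<in> ideal_mod.span G"
    unfolding mult.assoc[symmetric] const5_hom(4)[symmetric] using h(2) by simp
  moreover have "P = var5 i ^ N * ?e P"
    by (rule eq_var5_power_mult_peval) (simp add: P_def keys_part)
  ultimately have P: "P \<in> ideal_mod.span G"
    using ideal_mod.span_scale[of "?e P" G "var5 i ^ N"] by simp
  have "y - P \<in> ideal_mod.span G"
  proof (rule Suc.IH)
    show "h * (y - P) \<in> ideal_mod.span G"
      using ideal_mod.span_diff[OF Suc.prems(1) ideal_mod.span_scale[OF P, of h]] by (simp add: right_diff_distrib)
    fix m assume "m \<in> keys (y - P)"
    then have "m \<in> keys y" "lookup m i \<noteq> N"
      by (auto simp: in_keys_iff lookup_minus P_def lookup_part split: if_splits)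
    then show "lookup m i < N"
      using Suc.prems(2)[of m] by simp
  qed
  from ideal_mod.span_add[OF this P] show ?case by simp
qed

lemma regular_sequence_iff:
  "regular_sequence poly5_ring xs \<longleftrightarrow> 1 \<notin> ideal_mod.span (set xs) \<and>
     (\<forall>i < length xs. \<forall>y. xs ! i * y \<in> ideal_mod.span (set (take i xs)) \<longrightarrow> y \<in> ideal_mod.span (set (take i xs)))"
proof -
  have "ideal_mod.span S = UNIV \<longleftrightarrow> 1 \<in> ideal_mod.span S" for S :: "'a poly5 set"
    using ideal_mod.span_scale[of 1 S] by auto
  then show ?thesis
    unfolding regular_sequence_def genideal_eq_span by (simp add: ring_of_type_algebra_def)
qed

context six_points
begin

text \<open>In coordinates where \<open>ell\<close> is the variable \<open>j\<close>, the integral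
  equation of a coordinate \<open>i\<close> other than \<open>j\<close> involves only the variables
  \<open>i\<close> and \<open>j\<close> and has a constant leading coefficient in \<open>i\<close>.
  Each of the four equations is thus monic in a variable absent from its predecessors.\<close>

lemma regular_sequence_exists:
  obtains xs where "regular_sequence poly5_ring xs" "set xs \<subseteq> I" "length xs = 4"
proof -
  obtain c where ell: "ell = lin c" unfolding ell_def by blast
  have "c \<noteq> 0"
    using ell_cancel[of 1] one_notin I_0 ell by auto
  then obtain j where j: "c $ j \<noteq> 0" by (auto simp: vec_eq_iff)
  \<comment> \<open>The coordinate change sending \<open>ell\<close> to the variable
    \<open>j\<close>, obtained by solving \<open>ell\<close> for a variable with nonzero
    coefficient; \<open>\<psi>\<close> undoes it.\<close>
  define \<phi> where "\<phi> = var5(j := const5 (inverse (c $ j)) * (var5 j - (\<Sum>i\<in>UNIV - {j}. const5 (c $ i) * var5 i)))"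
  define \<psi> where "\<psi> = var5(j := ell)"
  have ell_split: "ell = const5 (c $ j) * var5 j + (\<Sum>i\<in>UNIV - {j}. const5 (c $ i) * var5 i)"
    unfolding ell lin_def by (rule sum.remove) auto
  have inv: "const5 (inverse (c $ j)) * (const5 (c $ j) * f) = f"
    "const5 (c $ j) * (const5 (inverse (c $ j)) * f) = f" for f
    unfolding mult.assoc[symmetric] const5_hom(4)[symmetric] using j by simp_all
  have psi_phi: "peval const5 \<psi> (peval const5 \<phi> f) = f" for f
  proof -
    have "(\<Sum>i\<in>UNIV - {j}. const5 (c $ i) * peval const5 \<psi> (var5 i)) = (\<Sum>i\<in>UNIV - {j}. const5 (c $ i) * var5 i)"
      by (rule sum.cong) (auto simp: \<psi>_def)
    then have "peval const5 \<psi> (\<phi> j) = const5 (inverse (c $ j)) * (ell - (\<Sum>i\<in>UNIV - {j}. const5 (c $ i) * var5 i))"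
      by (simp add: \<phi>_def const5_hom.peval_mult const5_hom.peval_diff const5_hom.peval_sum) (simp add: \<psi>_def)
    then have "peval const5 \<psi> (\<phi> j) = var5 j"
      by (simp add: ell_split inv)
    then have "(\<lambda>i. peval const5 \<psi> (\<phi> i)) = var5"
      by (auto simp: fun_eq_iff \<phi>_def \<psi>_def)
    then show ?thesis
      by (simp only: peval_peval peval_const5_var5)
  qed
  have phi_ell: "peval const5 \<phi> ell = var5 j"
  proof -
    have "(\<Sum>i\<in>UNIV - {j}. const5 (c $ i) * peval const5 \<phi> (var5 i)) = (\<Sum>i\<in>UNIV - {j}. const5 (c $ i) * var5 i)"
      by (rule sum.cong) (auto simp: \<phi>_def)
    then show ?thesis
      by (simp add: ell_split const5_hom.peval_add const5_hom.peval_mult const5_hom.peval_sum) (simp add: \<phi>_def inv)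
  qed
  have "\<forall>i. \<exists>T :: nat \<times> nat \<times> (nat \<Rightarrow> 'k). snd (snd T) (fst (snd T)) \<noteq> 0 \<and>
    (\<Sum>l\<le>fst (snd T). const5 (snd (snd T) l) * (var5 i ^ (fst T + l) * ell ^ (fst (snd T) - l))) \<in> I"
  proof
    fix i
    obtain d k b where b: "b k \<noteq> 0" "(\<Sum>l\<le>k. const5 (b l) * (var5 i ^ (d + l) * ell ^ (k - l))) \<in> I"
      by (rule monic_relation[OF var5_forms[of i]])
    show "\<exists>T :: nat \<times> nat \<times> (nat \<Rightarrow> 'k). snd (snd T) (fst (snd T)) \<noteq> 0 \<and>
      (\<Sum>l\<le>fst (snd T). const5 (snd (snd T) l) * (var5 i ^ (fst T + l) * ell ^ (fst (snd T) - l))) \<in> I"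
      by (rule exI[of _ "(d, k, b)"]) (simp only: fst_conv snd_conv b simp_thms not_False_eq_True)
  qed
  from choice[OF this] obtain T where T: "\<forall>i. snd (snd (T i)) (fst (snd (T i))) \<noteq> (0 :: 'k) \<and>
    (\<Sum>l\<le>fst (snd (T i)). const5 (snd (snd (T i)) l) * (var5 i ^ (fst (T i) + l) * ell ^ (fst (snd (T i)) - l))) \<in> I"
    by (elim exE)
  define d k b where "d = (\<lambda>i. fst (T i))" and "k = (\<lambda>i. fst (snd (T i)))" and "b = (\<lambda>i. snd (snd (T i)))"
  define F where "F = (\<lambda>i. \<Sum>l\<le>k i. const5 (b i l) * (var5 i ^ (d i + l) * ell ^ (k i - l)))"
  have F: "F i \<in> I" "b i (k i) \<noteq> 0" "F i = (\<Sum>l\<le>k i. const5 (b i l) * (var5 i ^ (d i + l) * ell ^ (k i - l)))" for i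
    using spec[OF T, of i] by (simp_all only: F_def d_def k_def b_def simp_thms)
  define js where "js = sorted_list_of_set (UNIV - {j})"
  have set_js: "set js = UNIV - {j}" and "distinct js"
    by (simp_all add: js_def)
  have "length js = card (UNIV - {j} :: 5 set)"
    using distinct_card[OF \<open>distinct js\<close>] set_js by simp
  then have length_js: "length js = 4" by simp
  have phi_F: "peval const5 \<phi> (F i) = (\<Sum>l\<le>k i. const5 (b i l) * (var5 i ^ (d i + l) * var5 j ^ (k i - l)))" if "i \<noteq> j" for i
    using that
    by (simp add: F(3) const5_hom.peval_sum const5_hom.peval_mult const5_hom.peval_power phi_ell) (simp add: \<phi>_def)
  have keys_F: "lookup m i' = 0" if "m \<in> keys (peval const5 \<phi> (F i))" "i \<noteq> j" "i' \<noteq> j" "i' \<noteq> i" for m i i'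
    using that
    by (auto simp: phi_F lookup_add lookup_single when_def dest!: keys_sumE keys_const5 keys_var5_power elim!: keys_multE)
  have "regular_sequence poly5_ring (map F js)"
    unfolding regular_sequence_iff
  proof (intro conjI allI impI)
    have "ideal_mod.span (set (map F js)) \<subseteq> I"
      by (rule ideal_mod.span_minimal[OF _ subspace]) (use F(1) in auto)
    then show "1 \<notin> ideal_mod.span (set (map F js))"
      using one_notin by blast
  next
    fix n y assume "n < length (map F js)"
      and y: "map F js ! n * y \<in> ideal_mod.span (set (take n (map F js)))"
    then have n: "n < length js" by simp
    define i where "i = js ! n"
    have i: "i \<noteq> j" using nth_mem[OF n] set_js by (auto simp: i_def)
    have prev: "i' \<noteq> j \<and> i' \<noteq> i" if "i' \<in> set (take n js)" for i'
    proof -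
      have "i' \<in> set js" using that by (rule in_set_takeD)
      moreover have "i' \<noteq> i"
        using that \<open>distinct js\<close> n by (auto simp: i_def in_set_conv_nth nth_eq_iff_index_eq)
      ultimately show ?thesis using set_js by auto
    qed
    define G where "G = (\<lambda>i'. peval const5 \<phi> (F i')) ` set (take n js)"
    have "peval const5 \<phi> (F i * y) \<in> ideal_mod.span G"
      by (rule const5_hom.peval_span[of _ "F ` set (take n js)"])
        (use y n in \<open>auto simp: i_def take_map G_def intro: ideal_mod.span_base\<close>)
    then have hy: "peval const5 \<phi> (F i) * peval const5 \<phi> y \<in> ideal_mod.span G"
      by (simp only: const5_hom.peval_mult)
    have "finite (insert 0 ((\<lambda>m. lookup m i) ` keys (peval const5 \<phi> y)))"
      by simp
    then have degy: "lookup m i < Suc (Max (insert 0 ((\<lambda>m. lookup m i) ` keys (peval const5 \<phi> y))))"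
      if "m \<in> keys (peval const5 \<phi> y)" for m
      using that by (simp add: less_Suc_eq_le)
    have lead: "peval const5 \<phi> (F i) = const5 (b i (k i)) * var5 i ^ (d i + k i)
        + (\<Sum>l<k i. const5 (b i l) * (var5 i ^ (d i + l) * var5 j ^ (k i - l)))"
      unfolding phi_F[OF i] by (simp only: lessThan_Suc_atMost[symmetric] sum.lessThan_Suc) simp
    have lower: "lookup m i < d i + k i"
      if "m \<in> keys (\<Sum>l<k i. const5 (b i l) * (var5 i ^ (d i + l) * var5 j ^ (k i - l)))" for m
      using that i
      by (auto simp: lookup_add lookup_single when_def dest!: keys_sumE keys_const5 keys_var5_power elim!: keys_multE)
    have free: "lookup m i = 0" if g: "g \<in> G" "m \<in> keys g" for g m
    proof -
      obtain i' where "i' \<in> set (take n js)" "g = peval const5 \<phi> (F i')"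
        using g(1) unfolding G_def by blast
      then show ?thesis using keys_F[of m i' i] prev[of i'] g(2) i by auto
    qed
    have "peval const5 \<phi> y \<in> ideal_mod.span G"
      by (rule monic_nonzerodivisor[OF free lead F(2) lower hy degy])
    then have "peval const5 \<psi> (peval const5 \<phi> y) \<in> ideal_mod.span (F ` set (take n js))"
      by (rule const5_hom.peval_span) (auto simp: G_def psi_phi intro: ideal_mod.span_base)
    then show "y \<in> ideal_mod.span (set (take n (map F js)))"
      by (simp add: psi_phi take_map)
  qed
  then show ?thesis
    using that[of "map F js"] F(1) length_js by auto
qed

end

section \<open>Upper bound for the depth by counting power products\<close>

definition bounded_exponents :: "nat \<Rightarrow> 'k::field poly5 \<Rightarrow> bool" where
  "bounded_exponents e f \<longleftrightarrow> (\<forall>m\<in>keys f. \<forall>i. lookup m i \<le> e)"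

lemma bounded_exponents_mult:
  "bounded_exponents d f \<Longrightarrow> bounded_exponents e g \<Longrightarrow> bounded_exponents (d + e) (f * g)"
  unfolding bounded_exponents_def by (auto elim!: keys_multE simp: lookup_add add_mono)

lemma bounded_exponents_mono: "bounded_exponents d f \<Longrightarrow> d \<le> e \<Longrightarrow> bounded_exponents e f"
  unfolding bounded_exponents_def using le_trans by blast

lemma bounded_exponents_power: "bounded_exponents e f \<Longrightarrow> bounded_exponents (n * e) (f ^ n)"
proof (induction n)
  case 0
  then show ?case by (simp add: bounded_exponents_def)
next
  case (Suc n)
  then show ?case using bounded_exponents_mult[of e f "n * e" "f ^ n"] by simp
qed

lemma bounded_exponents_exists: "\<exists>e. bounded_exponents e f"
proof -
  have "finite (\<Union>m\<in>keys f. range (lookup m))" by simp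
  then obtain e where "\<forall>n\<in>(\<Union>m\<in>keys f. range (lookup m)). n \<le> e"
    using finite_nat_set_iff_bounded_le by blast
  then show ?thesis unfolding bounded_exponents_def by blast
qed

definition independent_modulo :: "'k::field poly5 set \<Rightarrow> ('i \<Rightarrow> 'k poly5) \<Rightarrow> 'i set \<Rightarrow> bool" where
  "independent_modulo J e A \<longleftrightarrow> (\<forall>c. (\<Sum>i\<in>A. const5 (c i) * e i) \<in> J \<longrightarrow> (\<forall>i\<in>A. c i = 0))"

text \<open>The first assumption says that \<open>K\<close> contains everything that is in
  \<open>J\<close> modulo multiples of \<open>f\<close>. A relation modulo \<open>J\<close>
  therefore loses its terms free of \<open>f\<close>, what is left can be divided by
  \<open>f\<close>, and the argument repeats.\<close>

lemma independent_modulo_powers: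
  assumes K: "\<And>w v. w + f * v \<in> J \<Longrightarrow> w \<in> K" and f: "\<And>v. f * v \<in> J \<Longrightarrow> v \<in> J"
    and e: "independent_modulo K e A"
  shows "(\<Sum>n\<le>N. f ^ n * (\<Sum>i\<in>A. const5 (c n i) * e i)) \<in> J \<Longrightarrow> n \<le> N \<Longrightarrow> i \<in> A \<Longrightarrow> c n i = 0"
proof (induction N arbitrary: c n)
  case 0
  then have "(\<Sum>i\<in>A. const5 (c 0 i) * e i) \<in> K"
    using K[of _ 0] by simp
  then show ?case using e 0 unfolding independent_modulo_def by simp
next
  case (Suc N)
  define w where "w = (\<Sum>i\<in>A. const5 (c 0 i) * e i)"
  define v where "v = (\<Sum>n\<le>N. f ^ n * (\<Sum>i\<in>A. const5 (c (Suc n) i) * e i))"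
  have eq: "(\<Sum>n\<le>Suc N. f ^ n * (\<Sum>i\<in>A. const5 (c n i) * e i)) = w + f * v"
    by (subst sum.atMost_Suc_shift) (simp add: w_def v_def sum_distrib_left mult.assoc)
  have wv: "w + f * v \<in> J" using Suc.prems(1) unfolding eq .
  have c0: "\<forall>i\<in>A. c 0 i = 0"
    using K[OF wv] e unfolding independent_modulo_def w_def by blast
  then have "w = 0" unfolding w_def by simp
  then have "v \<in> J" using wv f by simp
  then have "n' \<le> N \<Longrightarrow> c (Suc n') i = 0" for n'
    using Suc.IH[of "\<lambda>n. c (Suc n)" n'] Suc.prems(3) unfolding v_def by simp
  then show ?case
    using c0 Suc.prems(2,3) by (cases n) auto
qed

definition exponent_lists :: "nat \<Rightarrow> nat \<Rightarrow> nat list set" where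
  "exponent_lists N k = {xs. set xs \<subseteq> {..N} \<and> length xs = k}"

lemma exponent_lists_Suc: "exponent_lists N (Suc k) = (\<lambda>(n, xs). n # xs) ` ({..N} \<times> exponent_lists N k)"
  by (auto simp: exponent_lists_def length_Suc_conv image_iff)

lemma sum_exponent_lists_Suc:
  "(\<Sum>xs\<in>exponent_lists N (Suc k). g xs) = (\<Sum>n\<le>N. \<Sum>xs\<in>exponent_lists N k. g (n # xs))"
proof -
  have "inj_on (\<lambda>(n, xs). n # xs) ({..N} \<times> exponent_lists N k)"
    by (auto simp: inj_on_def)
  then show ?thesis
    unfolding exponent_lists_Suc by (simp add: sum.reindex sum.cartesian_product case_prod_unfold)
qed

primrec power_product :: "'b::comm_monoid_mult list \<Rightarrow> nat list \<Rightarrow> 'b" where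
  "power_product [] ns = 1"
| "power_product (f # fs) ns = f ^ hd ns * power_product fs (tl ns)"

lemma bounded_exponents_power_product:
  "(\<And>f. f \<in> set fs \<Longrightarrow> bounded_exponents e f) \<Longrightarrow> ns \<in> exponent_lists N (length fs) \<Longrightarrow>
    bounded_exponents (length fs * (N * e)) (power_product fs ns)"
proof (induction fs arbitrary: ns)
  case Nil
  then show ?case by (simp add: bounded_exponents_def)
next
  case (Cons f fs)
  then obtain n ns' where ns: "ns = n # ns'" "n \<le> N" "ns' \<in> exponent_lists N (length fs)"
    by (auto simp: exponent_lists_Suc)
  have "bounded_exponents (n * e) (f ^ n)"
    using Cons.prems(1) by (intro bounded_exponents_power) simp
  then have "bounded_exponents (N * e) (f ^ n)"
    by (rule bounded_exponents_mono) (simp add: ns(2))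
  moreover have "bounded_exponents (length fs * (N * e)) (power_product fs ns')"
    by (rule Cons.IH) (use Cons.prems(1) ns(3) in auto)
  ultimately show ?case
    using bounded_exponents_mult by (simp add: ns(1))
qed

text \<open>Starting from the powers of \<open>z\<close> modulo the full ideal, the members of the
  sequence are moved from the ideal into the products one at a time, from the last to the first. At
  \<open>k = length fs\<close> the independence is over the zero ideal.\<close>

lemma independent_power_products:
  assumes fs: "\<And>i v. i < length fs \<Longrightarrow> fs ! i * v \<in> ideal_mod.span (set (take i fs)) \<Longrightarrow> v \<in> ideal_mod.span (set (take i fs))"
    and z: "independent_modulo (ideal_mod.span (set fs)) (\<lambda>n. z ^ n) {..N}"
  shows "k \<le> length fs \<Longrightarrow> independent_modulo (ideal_mod.span (set (take (length fs - k) fs)))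
    (power_product (drop (length fs - k) fs @ [z])) (exponent_lists N (Suc k))"
proof (induction k)
  case 0
  have "exponent_lists N 0 = {[]}" by (auto simp: exponent_lists_def)
  then have eq: "(\<Sum>ns\<in>exponent_lists N (Suc 0). const5 (c ns) * power_product [z] ns) = (\<Sum>n\<le>N. const5 (c [n]) * z ^ n)" for c
    by (simp add: sum_exponent_lists_Suc)
  have ex: "ns \<in> exponent_lists N (Suc 0) \<Longrightarrow> \<exists>n\<le>N. ns = [n]" for ns
    by (auto simp: exponent_lists_def length_Suc_conv)
  have "independent_modulo (ideal_mod.span (set fs)) (power_product [z]) (exponent_lists N (Suc 0))"
    unfolding independent_modulo_def eq
  proof (intro allI impI ballI)
    fix c ns assume c: "(\<Sum>n\<le>N. const5 (c [n]) * z ^ n) \<in> ideal_mod.span (set fs)"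
      and "ns \<in> exponent_lists N (Suc 0)"
    then obtain n where n: "n \<le> N" "ns = [n]" using ex by blast
    from z[unfolded independent_modulo_def, rule_format, of "\<lambda>n. c [n]", OF c] n show "c ns = 0"
      by simp
  qed
  then show ?case by (simp del: power_product.simps)
next
  case (Suc k)
  define i where "i = length fs - Suc k"
  have i: "i < length fs" "length fs - k = Suc i" using Suc.prems by (auto simp: i_def)
  define f where "f = fs ! i"
  define J where "J = ideal_mod.span (set (take i fs))"
  define e where "e = power_product (drop (Suc i) fs @ [z])"
  have drop: "drop i fs = f # drop (Suc i) fs"
    using i(1) by (simp add: f_def Cons_nth_drop_Suc)
  have "set (take (Suc i) fs) = insert f (set (take i fs))"
    using i(1) by (simp add: take_Suc_conv_app_nth f_def)
  then have ind: "independent_modulo (ideal_mod.span (insert f (set (take i fs)))) e (exponent_lists N (Suc k))"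
    using Suc.IH Suc.prems i(2) by (simp add: e_def)
  have K: "w \<in> ideal_mod.span (insert f (set (take i fs)))" if "w + f * v \<in> J" for w v
  proof -
    have "w + f * v \<in> ideal_mod.span (insert f (set (take i fs)))"
      using that ideal_mod.span_mono[of "set (take i fs)" "insert f (set (take i fs))"] unfolding J_def by auto
    moreover have "v * f \<in> ideal_mod.span (insert f (set (take i fs)))"
      by (intro ideal_mod.span_scale ideal_mod.span_base) simp
    ultimately show ?thesis
      using ideal_mod.span_diff[of "w + f * v" _ "v * f"] by (simp add: mult.commute)
  qed
  have reg: "v \<in> J" if "f * v \<in> J" for v
    using fs[OF i(1)] that unfolding J_def f_def by blast
  show ?case
    unfolding independent_modulo_def i_def[symmetric] drop J_def[symmetric]
  proof (intro allI impI ballI)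
    fix c ns
    assume sum: "(\<Sum>ns\<in>exponent_lists N (Suc (Suc k)). const5 (c ns) * power_product ((f # drop (Suc i) fs) @ [z]) ns) \<in> J"
      and ns: "ns \<in> exponent_lists N (Suc (Suc k))"
    have "(\<Sum>ns\<in>exponent_lists N (Suc (Suc k)). const5 (c ns) * power_product ((f # drop (Suc i) fs) @ [z]) ns)
        = (\<Sum>n\<le>N. f ^ n * (\<Sum>ns\<in>exponent_lists N (Suc k). const5 (c (n # ns)) * e ns))"
      unfolding sum_exponent_lists_Suc[of _ _ "Suc k"] sum_distrib_left by (simp add: e_def mult.left_commute)
    then have "(\<Sum>n\<le>N. f ^ n * (\<Sum>ns\<in>exponent_lists N (Suc k). const5 (c (n # ns)) * e ns)) \<in> J"
      using sum by simp
    moreover obtain n ns' where "ns = n # ns'" "n \<le> N" "ns' \<in> exponent_lists N (Suc k)"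
      using ns by (auto simp: exponent_lists_Suc[of N "Suc k"])
    ultimately show "c ns = 0"
      using independent_modulo_powers[OF K reg ind, where c = "\<lambda>n ns. c (n # ns)"] by simp
  qed
qed

context six_points
begin

text \<open>Different powers have different degrees, so a relation splits into components
  \<open>const5 (c n) * ell ^ n\<close>; cancelling \<open>ell\<close> leaves a constant in the
  proper ideal \<open>I\<close>.\<close>

lemma ell_powers_independent: "independent_modulo I (\<lambda>n. ell ^ n) {..N}"
  unfolding independent_modulo_def
proof (intro allI impI ballI)
  fix c n assume sum: "(\<Sum>n\<le>N. const5 (c n) * ell ^ n) \<in> I" and n: "n \<in> {..N}"
  have pow: "const5 (c i) * ell ^ i \<in> forms i" for i
    using forms_scale[OF forms_power[OF ell_forms]] by simp
  have "comp n (\<Sum>i\<le>N. const5 (c i) * ell ^ i) = (\<Sum>i\<le>N. if i = n then const5 (c i) * ell ^ i else 0)"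
    unfolding part_sum
  proof (rule sum.cong[OF refl])
    fix i
    show "comp n (const5 (c i) * ell ^ i) = (if i = n then const5 (c i) * ell ^ i else 0)"
      using pow[of i] comp_eq_self[OF pow[of i]] by (auto intro!: part_eq_0 simp: forms_def)
  qed
  also have "\<dots> = const5 (c n) * ell ^ n" using n by simp
  finally have "ell ^ n * const5 (c n) \<in> I"
    using comp_closed[OF sum, of n] by (simp add: mult.commute)
  then have "const5 (c n) \<in> I" by (rule ell_power_cancel)
  then have "const5 (inverse (c n)) * const5 (c n) \<in> I" by (rule I_mult)
  then show "c n = 0"
    using one_notin unfolding const5_hom(4)[symmetric] by (cases "c n = 0") auto
qed

text \<open>The products of powers of five elements of a regular sequence and of \<open>ell\<close> would be too many
  linearly independent polynomials of bounded degree.\<close>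

lemma regular_sequence_length:
  assumes reg: "regular_sequence poly5_ring xs" and I: "set xs \<subseteq> I"
  shows "length xs \<le> 4"
proof (rule ccontr)
  assume "\<not> length xs \<le> 4"
  define fs where "fs = take 5 xs"
  have len: "length fs = 5" using \<open>\<not> length xs \<le> 4\<close> by (simp add: fs_def)
  have regular: "v \<in> ideal_mod.span (set (take i fs))"
    if "i < length fs" "fs ! i * v \<in> ideal_mod.span (set (take i fs))" for i v
  proof -
    have "i < length xs" and "take i fs = take i xs" and "fs ! i = xs ! i"
      using that(1) len by (simp_all add: fs_def min_def split: if_splits)
    then show ?thesis
      using that(2) reg unfolding regular_sequence_iff by simp
  qed
  have "\<exists>e. \<forall>f\<in>set (fs @ [ell]). bounded_exponents e f"
  proof -
    obtain E where E: "\<And>f :: 'k poly5. bounded_exponents (E f) f"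
      using bounded_exponents_exists by metis
    have "bounded_exponents (sum_list (map E (fs @ [ell]))) f" if "f \<in> set (fs @ [ell])" for f
      by (rule bounded_exponents_mono[OF E]) (use that in \<open>simp only: member_le_sum_list image_eqI list.set_map\<close>)
    then show ?thesis by blast
  qed
  then obtain e' where e': "\<forall>f\<in>set (fs @ [ell]). bounded_exponents e' f" by blast
  \<comment> \<open>The successor makes the bound positive, as the estimate
    \<open>6 * (N * e) + 1 <= 6 * e * (N + 1)\<close> requires.\<close>
  define e where "e = Suc e'"
  have e: "bounded_exponents e f" if "f \<in> set (fs @ [ell])" for f
    using e' that bounded_exponents_mono[of e' f e] by (auto simp: e_def)
  \<comment> \<open>Chosen to make \<open>(6 e (N + 1))^5 = N (N + 1)^5\<close>, which is less than
    \<open>(N + 1)^6\<close>, the number of power products of six factors with exponents up to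
    \<open>N\<close>.\<close>
  define N where "N = (6 * e) ^ 5"
  define A where "A = exponent_lists N 6"
  have finA: "finite A" and cardA: "card A = (N + 1) ^ 6"
    unfolding A_def exponent_lists_def by (simp_all add: finite_lists_length_eq card_lists_length_eq)
  have "ideal_mod.span (set fs) \<subseteq> I"
    by (rule ideal_mod.span_minimal[OF _ subspace]) (unfold fs_def, rule order_trans[OF set_take_subset I])
  then have "independent_modulo (ideal_mod.span (set fs)) (\<lambda>n. ell ^ n) {..N}"
    using ell_powers_independent unfolding independent_modulo_def by blast
  from independent_power_products[OF regular this, of 5]
  have ind: "independent_modulo {0} (power_product (fs @ [ell])) A"
    by (simp add: len A_def)
  obtain h where h: "bij_betw h {..<card A} A"
    using ex_bij_betw_nat_finite[OF finA] by (auto simp: lessThan_atLeast0)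
  define F where "F = {f :: 'k poly5. bounded_exponents (6 * (N * e)) f}"
  let ?S = "{m :: 5 \<Rightarrow>\<^sub>0 nat. \<forall>i. lookup m i \<le> 6 * (N * e)}"
  have F: "F \<subseteq> poly5.span ((\<lambda>m. Poly_Mapping.single m 1) ` ?S)"
  proof
    fix f assume "f \<in> F"
    then have "keys f \<subseteq> ?S" unfolding F_def bounded_exponents_def by blast
    then show "f \<in> poly5.span ((\<lambda>m. Poly_Mapping.single m 1) ` ?S)" by (rule in_span_monomials)
  qed
  have finS: "finite ((\<lambda>m. Poly_Mapping.single m (1 :: 'k)) ` ?S)"
    by (rule finite_imageI, rule card_bounded_monomials(1))
  have "poly5.dim {0 :: 'k poly5} + card A \<le> poly5.dim F"
  proof (rule independent_mod_dim[OF poly5.subspace_single_0 _ F finS])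
    show "{0} \<subseteq> F" by (simp add: F_def bounded_exponents_def)
  next
    fix i assume "i < card A"
    then have "h i \<in> A" using bij_betwE[OF h] by auto
    then show "power_product (fs @ [ell]) (h i) \<in> F"
      unfolding F_def using bounded_exponents_power_product[of "fs @ [ell]" e "h i" N] e len by (simp add: A_def)
  next
    fix c assume c: "(\<Sum>i<card A. const5 (c i) * power_product (fs @ [ell]) (h i)) \<in> {0}"
    define c' where "c' = c \<circ> the_inv_into {..<card A} h"
    have inv: "c' (h i) = c i" if "i < card A" for i
      using that h by (simp add: c'_def the_inv_into_f_f bij_betw_def)
    have "(\<Sum>x\<in>A. const5 (c' x) * power_product (fs @ [ell]) x) = (\<Sum>i<card A. const5 (c' (h i)) * power_product (fs @ [ell]) (h i))"
      by (rule sum.reindex_bij_betw[OF h, symmetric])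
    also have "\<dots> = (\<Sum>i<card A. const5 (c i) * power_product (fs @ [ell]) (h i))"
      by (rule sum.cong) (simp_all add: inv)
    finally have "\<forall>x\<in>A. c' x = 0"
      using ind c unfolding independent_modulo_def by simp
    then show "\<forall>i<card A. c i = 0"
      using inv bij_betwE[OF h] by (metis lessThan_iff)
  qed
  also have "poly5.dim F \<le> card ((\<lambda>m. Poly_Mapping.single m (1 :: 'k)) ` ?S)"
    by (rule poly5.dim_le_card[OF F finS])
  also have "\<dots> \<le> card ?S"
    by (rule card_image_le[OF card_bounded_monomials(1)])
  also have "\<dots> \<le> (6 * (N * e) + 1) ^ 5"
    by (rule card_bounded_monomials(2))
  also have "\<dots> \<le> (6 * e * (N + 1)) ^ 5"
    by (rule power_mono) (simp_all add: e_def algebra_simps)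
  also have "\<dots> = N * (N + 1) ^ 5"
    by (simp only: power_mult_distrib[of "6 * e" "N + 1"] N_def[symmetric])
  also have "\<dots> < (N + 1) * (N + 1) ^ 5"
    by (rule mult_strict_right_mono) simp_all
  also have "\<dots> = (N + 1) ^ 6"
    by (subst power_Suc[symmetric]) simp
  finally show False using cardA by simp
qed

lemma ideal_depth_eq_4: "ideal_depth poly5_ring I = 4"
proof -
  obtain xs where xs: "regular_sequence poly5_ring xs" "set xs \<subseteq> I" "length xs = 4"
    by (rule regular_sequence_exists)
  show ?thesis
    unfolding ideal_depth_def
  proof (rule Sup_eqI)
    fix y assume "y \<in> {enat (length xs) | xs. regular_sequence poly5_ring xs \<and> set xs \<subseteq> I}"
    then show "y \<le> 4"
      using regular_sequence_length by (auto simp: numeral_eq_enat)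
  next
    fix y :: enat
    assume "\<And>z. z \<in> {enat (length xs) | xs. regular_sequence poly5_ring xs \<and> set xs \<subseteq> I} \<Longrightarrow> z \<le> y"
    then have "enat (length xs) \<le> y" using xs by blast
    then show "4 \<le> y" using xs(3) by (simp add: numeral_eq_enat)
  qed
qed

end

section \<open>Explicit generators of the two kinds of ideals\<close>

text \<open>The entries of \<open>adj S + q a a\<^sup>T\<close> and of \<open>S a\<close>, where \<open>a = (A\<^sub>1\<^sub>2, A\<^sub>2\<^sub>0, A\<^sub>0\<^sub>1)\<close>.\<close>

definition british_gens :: "'a::comm_ring_1 \<Rightarrow> 'a \<Rightarrow> 'a \<Rightarrow> 'a \<Rightarrow> 'a \<Rightarrow> 'a \<Rightarrow> 'a \<Rightarrow> 'a \<Rightarrow> 'a \<Rightarrow> 'a \<Rightarrow> 'a set" where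
  "british_gens q s00 s01 s02 s11 s12 s22 a0 a1 a2 =
   {s11 * s22 - s12 * s12 + q * (a0 * a0),
    s12 * s02 - s01 * s22 + q * (a0 * a1),
    s01 * s12 - s02 * s11 + q * (a0 * a2),
    s00 * s22 - s02 * s02 + q * (a1 * a1),
    s01 * s02 - s00 * s12 + q * (a1 * a2),
    s00 * s11 - s01 * s01 + q * (a2 * a2),
    s00 * a0 + s01 * a1 + s02 * a2, s01 * a0 + s11 * a1 + s12 * a2, s02 * a0 + s12 * a1 + s22 * a2}"

definition minors3 :: "'a::comm_ring_1 \<Rightarrow> 'a \<Rightarrow> 'a \<Rightarrow> 'a \<Rightarrow> 'a \<Rightarrow> 'a \<Rightarrow> 'a \<Rightarrow> 'a \<Rightarrow> 'a \<Rightarrow> 'a set" where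
  "minors3 m00 m01 m02 m10 m11 m12 m20 m21 m22 =
   {m00 * m11 - m01 * m10,
    m00 * m12 - m02 * m10,
    m01 * m12 - m02 * m11,
    m00 * m21 - m01 * m20,
    m00 * m22 - m02 * m20,
    m01 * m22 - m02 * m21,
    m10 * m21 - m11 * m20,
    m10 * m22 - m12 * m20,
    m11 * m22 - m12 * m21}"

lemma british_gens_subset_iff:
  "british_gens q s00 s01 s02 s11 s12 s22 a0 a1 a2 \<subseteq> J \<longleftrightarrow>
    s11 * s22 - s12 * s12 + q * (a0 * a0) \<in> J \<and>
    s12 * s02 - s01 * s22 + q * (a0 * a1) \<in> J \<and>
    s01 * s12 - s02 * s11 + q * (a0 * a2) \<in> J \<and>
    s00 * s22 - s02 * s02 + q * (a1 * a1) \<in> J \<and>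
    s01 * s02 - s00 * s12 + q * (a1 * a2) \<in> J \<and>
    s00 * s11 - s01 * s01 + q * (a2 * a2) \<in> J \<and>
    s00 * a0 + s01 * a1 + s02 * a2 \<in> J \<and> s01 * a0 + s11 * a1 + s12 * a2 \<in> J \<and> s02 * a0 + s12 * a1 + s22 * a2 \<in> J"
  by (simp add: british_gens_def)

lemma british_gens_0_subset_iff:
  "british_gens 0 s00 s01 s02 s11 s12 s22 a0 a1 a2 \<subseteq> J \<longleftrightarrow>
    s11 * s22 - s12 * s12 \<in> J \<and>
    s12 * s02 - s01 * s22 \<in> J \<and>
    s01 * s12 - s02 * s11 \<in> J \<and>
    s00 * s22 - s02 * s02 \<in> J \<and>
    s01 * s02 - s00 * s12 \<in> J \<and>
    s00 * s11 - s01 * s01 \<in> J \<and>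
    s00 * a0 + s01 * a1 + s02 * a2 \<in> J \<and> s01 * a0 + s11 * a1 + s12 * a2 \<in> J \<and> s02 * a0 + s12 * a1 + s22 * a2 \<in> J"
  by (simp add: british_gens_def)

lemma minors3_subset_iff:
  "minors3 m00 m01 m02 m10 m11 m12 m20 m21 m22 \<subseteq> J \<longleftrightarrow>
    m00 * m11 - m01 * m10 \<in> J \<and>
    m00 * m12 - m02 * m10 \<in> J \<and>
    m01 * m12 - m02 * m11 \<in> J \<and>
    m00 * m21 - m01 * m20 \<in> J \<and>
    m00 * m22 - m02 * m20 \<in> J \<and>
    m01 * m22 - m02 * m21 \<in> J \<and>
    m10 * m21 - m11 * m20 \<in> J \<and>
    m10 * m22 - m12 * m20 \<in> J \<and>
    m11 * m22 - m12 * m21 \<in> J"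
  by (simp add: minors3_def)

lemma combination9:
  assumes "ideal_mod.subspace J"
    and "g1 \<in> J" "g2 \<in> J" "g3 \<in> J" "g4 \<in> J" "g5 \<in> J" "g6 \<in> J" "g7 \<in> J" "g8 \<in> J" "g9 \<in> J"
  shows "ka * g1 + kb * g2 + kc * g3 + kd * g4 + ke * g5 + kf * g6 + kg * g7 + kh * g8 + ki * g9 \<in> J"
  using assms by (intro ideal_mod.subspace_add ideal_mod.subspace_scale)

text \<open>The format of the membership certificates below: \<open>ka\<close> to \<open>ki\<close>
  are the coefficients of the nine generators in the order of \<open>british_gens\<close>.\<close>

lemma british_combination:
  assumes "british_gens q s00 s01 s02 s11 s12 s22 a0 a1 a2 \<subseteq> J" "ideal_mod.subspace J"
    and "x = ka * (s11 * s22 - s12 * s12 + q * (a0 * a0)) + kb * (s12 * s02 - s01 * s22 + q * (a0 * a1)) + kc * (s01 * s12 - s02 * s11 + q * (a0 * a2)) + kd * (s00 * s22 - s02 * s02 + q * (a1 * a1)) + ke * (s01 * s02 - s00 * s12 + q * (a1 * a2)) + kf * (s00 * s11 - s01 * s01 + q * (a2 * a2)) + kg * (s00 * a0 + s01 * a1 + s02 * a2) + kh * (s01 * a0 + s11 * a1 + s12 * a2) + ki * (s02 * a0 + s12 * a1 + s22 * a2)"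
  shows "x \<in> J"
  unfolding assms(3) using assms(1) unfolding british_gens_subset_iff by (intro combination9[OF assms(2)]) simp_all

lemma british_combination_0:
  assumes "british_gens 0 s00 s01 s02 s11 s12 s22 a0 a1 a2 \<subseteq> J" "ideal_mod.subspace J"
    and "x = ka * (s11 * s22 - s12 * s12) + kb * (s12 * s02 - s01 * s22) + kc * (s01 * s12 - s02 * s11) + kd * (s00 * s22 - s02 * s02) + ke * (s01 * s02 - s00 * s12) + kf * (s00 * s11 - s01 * s01) + kg * (s00 * a0 + s01 * a1 + s02 * a2) + kh * (s01 * a0 + s11 * a1 + s12 * a2) + ki * (s02 * a0 + s12 * a1 + s22 * a2)"
  shows "x \<in> J"
  unfolding assms(3) using assms(1) unfolding british_gens_0_subset_iff by (intro combination9[OF assms(2)]) simp_all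

lemma minors3_combination:
  assumes "minors3 m00 m01 m02 m10 m11 m12 m20 m21 m22 \<subseteq> J" "ideal_mod.subspace J"
    and "x = ka * (m00 * m11 - m01 * m10) + kb * (m00 * m12 - m02 * m10) + kc * (m01 * m12 - m02 * m11) + kd * (m00 * m21 - m01 * m20) + ke * (m00 * m22 - m02 * m20) + kf * (m01 * m22 - m02 * m21) + kg * (m10 * m21 - m11 * m20) + kh * (m10 * m22 - m12 * m20) + ki * (m11 * m22 - m12 * m21)"
  shows "x \<in> J"
  unfolding assms(3) using assms(1) unfolding minors3_subset_iff by (intro combination9[OF assms(2)]) simp_all

lemma span_eqI: "S \<subseteq> ideal_mod.span T \<Longrightarrow> T \<subseteq> ideal_mod.span S \<Longrightarrow> ideal_mod.span S = ideal_mod.span T"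
  by (simp add: ideal_mod.span_eq)

lemma unit_mult_closed:
  assumes "ideal_mod.subspace J" "u * x \<in> J" "v * u = 1"
  shows "x \<in> J"
  using ideal_mod.subspace_scale[OF assms(1,2), of v] assms(3) by (simp add: mult.assoc[symmetric])


section \<open>Changes of the presentation that keep the ideal\<close>

lemma british_gens_swap01:
  shows "british_gens 0 s11 s01 s12 s00 s02 s22 a1 a0 a2 \<subseteq> ideal_mod.span (british_gens 0 s00 s01 s02 s11 s12 s22 a0 a1 a2)"
proof -
  note comb = british_combination_0[OF ideal_mod.span_superset ideal_mod.subspace_span]
  show ?thesis
    unfolding british_gens_0_subset_iff
    apply (intro conjI)
    apply (rule comb[where ka = "0" and kb = "0" and kc = "0" and kd = "1" and ke = "0" and kf = "0" and kg = "0" and kh = "0" and ki = "0"], simp add: algebra_simps)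
    apply (rule comb[where ka = "0" and kb = "1" and kc = "0" and kd = "0" and ke = "0" and kf = "0" and kg = "0" and kh = "0" and ki = "0"], simp add: algebra_simps)
    apply (rule comb[where ka = "0" and kb = "0" and kc = "0" and kd = "0" and ke = "1" and kf = "0" and kg = "0" and kh = "0" and ki = "0"], simp add: algebra_simps)
    apply (rule comb[where ka = "1" and kb = "0" and kc = "0" and kd = "0" and ke = "0" and kf = "0" and kg = "0" and kh = "0" and ki = "0"], simp add: algebra_simps)
    apply (rule comb[where ka = "0" and kb = "0" and kc = "1" and kd = "0" and ke = "0" and kf = "0" and kg = "0" and kh = "0" and ki = "0"], simp add: algebra_simps)
    apply (rule comb[where ka = "0" and kb = "0" and kc = "0" and kd = "0" and ke = "0" and kf = "1" and kg = "0" and kh = "0" and ki = "0"], simp add: algebra_simps)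
    apply (rule comb[where ka = "0" and kb = "0" and kc = "0" and kd = "0" and ke = "0" and kf = "0" and kg = "0" and kh = "1" and ki = "0"], simp add: algebra_simps)
    apply (rule comb[where ka = "0" and kb = "0" and kc = "0" and kd = "0" and ke = "0" and kf = "0" and kg = "1" and kh = "0" and ki = "0"], simp add: algebra_simps)
    apply (rule comb[where ka = "0" and kb = "0" and kc = "0" and kd = "0" and ke = "0" and kf = "0" and kg = "0" and kh = "0" and ki = "1"], simp add: algebra_simps)
    done
qed

lemma british_gens_swap12:
  shows "british_gens 0 s00 s02 s01 s22 s12 s11 a0 a2 a1 \<subseteq> ideal_mod.span (british_gens 0 s00 s01 s02 s11 s12 s22 a0 a1 a2)"
proof -
  note comb = british_combination_0[OF ideal_mod.span_superset ideal_mod.subspace_span]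
  show ?thesis
    unfolding british_gens_0_subset_iff
    apply (intro conjI)
    apply (rule comb[where ka = "1" and kb = "0" and kc = "0" and kd = "0" and ke = "0" and kf = "0" and kg = "0" and kh = "0" and ki = "0"], simp add: algebra_simps)
    apply (rule comb[where ka = "0" and kb = "0" and kc = "1" and kd = "0" and ke = "0" and kf = "0" and kg = "0" and kh = "0" and ki = "0"], simp add: algebra_simps)
    apply (rule comb[where ka = "0" and kb = "1" and kc = "0" and kd = "0" and ke = "0" and kf = "0" and kg = "0" and kh = "0" and ki = "0"], simp add: algebra_simps)
    apply (rule comb[where ka = "0" and kb = "0" and kc = "0" and kd = "0" and ke = "0" and kf = "1" and kg = "0" and kh = "0" and ki = "0"], simp add: algebra_simps)
    apply (rule comb[where ka = "0" and kb = "0" and kc = "0" and kd = "0" and ke = "1" and kf = "0" and kg = "0" and kh = "0" and ki = "0"], simp add: algebra_simps)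
    apply (rule comb[where ka = "0" and kb = "0" and kc = "0" and kd = "1" and ke = "0" and kf = "0" and kg = "0" and kh = "0" and ki = "0"], simp add: algebra_simps)
    apply (rule comb[where ka = "0" and kb = "0" and kc = "0" and kd = "0" and ke = "0" and kf = "0" and kg = "1" and kh = "0" and ki = "0"], simp add: algebra_simps)
    apply (rule comb[where ka = "0" and kb = "0" and kc = "0" and kd = "0" and ke = "0" and kf = "0" and kg = "0" and kh = "0" and ki = "1"], simp add: algebra_simps)
    apply (rule comb[where ka = "0" and kb = "0" and kc = "0" and kd = "0" and ke = "0" and kf = "0" and kg = "0" and kh = "1" and ki = "0"], simp add: algebra_simps)
    done
qed

text \<open>The elementary case of \<open>S\<close> going to \<open>g S g^T\<close> and
  \<open>a\<close> to the inverse transpose of \<open>g\<close> applied to \<open>a\<close>, so that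
  \<open>S a\<close> goes to \<open>g (S a)\<close>.\<close>

lemma british_gens_transvection:
  shows "british_gens 0 s00 (s01 + k * s00) s02 (s11 + 2 * k * s01 + k * k * s00) (s12 + k * s02) s22 (a0 - k * a1) a1 a2 \<subseteq> ideal_mod.span (british_gens 0 s00 s01 s02 s11 s12 s22 a0 a1 a2)"
proof -
  note comb = british_combination_0[OF ideal_mod.span_superset ideal_mod.subspace_span]
  show ?thesis
    unfolding british_gens_0_subset_iff
    apply (intro conjI)
    apply (rule comb[where ka = "1" and kb = "- 2 * k" and kc = "0" and kd = "k * k" and ke = "0" and kf = "0" and kg = "0" and kh = "0" and ki = "0"], simp add: algebra_simps)
    apply (rule comb[where ka = "0" and kb = "1" and kc = "0" and kd = "- k" and ke = "0" and kf = "0" and kg = "0" and kh = "0" and ki = "0"], simp add: algebra_simps)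
    apply (rule comb[where ka = "0" and kb = "0" and kc = "1" and kd = "0" and ke = "- k" and kf = "0" and kg = "0" and kh = "0" and ki = "0"], simp add: algebra_simps)
    apply (rule comb[where ka = "0" and kb = "0" and kc = "0" and kd = "1" and ke = "0" and kf = "0" and kg = "0" and kh = "0" and ki = "0"], simp add: algebra_simps)
    apply (rule comb[where ka = "0" and kb = "0" and kc = "0" and kd = "0" and ke = "1" and kf = "0" and kg = "0" and kh = "0" and ki = "0"], simp add: algebra_simps)
    apply (rule comb[where ka = "0" and kb = "0" and kc = "0" and kd = "0" and ke = "0" and kf = "1" and kg = "0" and kh = "0" and ki = "0"], simp add: algebra_simps)
    apply (rule comb[where ka = "0" and kb = "0" and kc = "0" and kd = "0" and ke = "0" and kf = "0" and kg = "1" and kh = "0" and ki = "0"], simp add: algebra_simps)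
    apply (rule comb[where ka = "0" and kb = "0" and kc = "0" and kd = "0" and ke = "0" and kf = "0" and kg = "k" and kh = "1" and ki = "0"], simp add: algebra_simps)
    apply (rule comb[where ka = "0" and kb = "0" and kc = "0" and kd = "0" and ke = "0" and kf = "0" and kg = "0" and kh = "0" and ki = "1"], simp add: algebra_simps)
    done
qed

lemma british_gens_scale:
  shows "british_gens 0 s00 s01 s02 s11 s12 s22 (u * a0) (u * a1) (u * a2) \<subseteq> ideal_mod.span (british_gens 0 s00 s01 s02 s11 s12 s22 a0 a1 a2)"
proof -
  note comb = british_combination_0[OF ideal_mod.span_superset ideal_mod.subspace_span]
  show ?thesis
    unfolding british_gens_0_subset_iff
    apply (intro conjI)
    apply (rule comb[where ka = "1" and kb = "0" and kc = "0" and kd = "0" and ke = "0" and kf = "0" and kg = "0" and kh = "0" and ki = "0"], simp add: algebra_simps)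
    apply (rule comb[where ka = "0" and kb = "1" and kc = "0" and kd = "0" and ke = "0" and kf = "0" and kg = "0" and kh = "0" and ki = "0"], simp add: algebra_simps)
    apply (rule comb[where ka = "0" and kb = "0" and kc = "1" and kd = "0" and ke = "0" and kf = "0" and kg = "0" and kh = "0" and ki = "0"], simp add: algebra_simps)
    apply (rule comb[where ka = "0" and kb = "0" and kc = "0" and kd = "1" and ke = "0" and kf = "0" and kg = "0" and kh = "0" and ki = "0"], simp add: algebra_simps)
    apply (rule comb[where ka = "0" and kb = "0" and kc = "0" and kd = "0" and ke = "1" and kf = "0" and kg = "0" and kh = "0" and ki = "0"], simp add: algebra_simps)
    apply (rule comb[where ka = "0" and kb = "0" and kc = "0" and kd = "0" and ke = "0" and kf = "1" and kg = "0" and kh = "0" and ki = "0"], simp add: algebra_simps)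
    apply (rule comb[where ka = "0" and kb = "0" and kc = "0" and kd = "0" and ke = "0" and kf = "0" and kg = "u" and kh = "0" and ki = "0"], simp add: algebra_simps)
    apply (rule comb[where ka = "0" and kb = "0" and kc = "0" and kd = "0" and ke = "0" and kf = "0" and kg = "0" and kh = "u" and ki = "0"], simp add: algebra_simps)
    apply (rule comb[where ka = "0" and kb = "0" and kc = "0" and kd = "0" and ke = "0" and kf = "0" and kg = "0" and kh = "0" and ki = "u"], simp add: algebra_simps)
    done
qed

text \<open>On \<open>S = v v^T\<close> both vectors \<open>a\<close> and \<open>b\<close> have the
  same cubic \<open>v . a\<close>, after \<open>v1^2\<close> is eliminated by the first assumption.
  Its terms are distributed over \<open>b0\<close> and \<open>b2\<close> alone, and the coefficient
  \<open>2 c\<close> of \<open>v0 v1 v2\<close> is shared equally between them.\<close>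

lemma british_gens_normalize_square:
  assumes "s11 = g0 * s00 + g1 * s02 + g2 * s22"
    and "a0 = t00 * s00 + t01 * s02 + t02 * s22 + t03 * s01 + t04 * s12"
    and "a1 = t10 * s00 + (2 * c - t04 - t23) * s02 + t12 * s22 + t13 * s01 + t14 * s12"
    and "a2 = t20 * s00 + t21 * s02 + t22 * s22 + t23 * s01 + t24 * s12"
    and "b0 = (t00 + t13 * g0) * s00 + (t01 + t20 + t13 * g1 + t14 * g0) * s02 + (t03 + t10) * s01 + c * s12"
    and "b1 = 0"
    and "b2 = (t02 + t21 + t13 * g2 + t14 * g1) * s02 + (t22 + t14 * g2) * s22 + (t24 + t12) * s12 + c * s01"
  shows "british_gens 0 s00 s01 s02 s11 s12 s22 b0 b1 b2 \<subseteq> ideal_mod.span (british_gens 0 s00 s01 s02 s11 s12 s22 a0 a1 a2)"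
proof -
  note comb = british_combination_0[OF ideal_mod.span_superset ideal_mod.subspace_span]
  show ?thesis
    unfolding british_gens_0_subset_iff
    apply (intro conjI)
    apply (rule comb[where ka = "1" and kb = "0" and kc = "0" and kd = "0" and ke = "0" and kf = "0" and kg = "0" and kh = "0" and ki = "0"], simp add: algebra_simps)
    apply (rule comb[where ka = "0" and kb = "1" and kc = "0" and kd = "0" and ke = "0" and kf = "0" and kg = "0" and kh = "0" and ki = "0"], simp add: algebra_simps)
    apply (rule comb[where ka = "0" and kb = "0" and kc = "1" and kd = "0" and ke = "0" and kf = "0" and kg = "0" and kh = "0" and ki = "0"], simp add: algebra_simps)
    apply (rule comb[where ka = "0" and kb = "0" and kc = "0" and kd = "1" and ke = "0" and kf = "0" and kg = "0" and kh = "0" and ki = "0"], simp add: algebra_simps)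
    apply (rule comb[where ka = "0" and kb = "0" and kc = "0" and kd = "0" and ke = "1" and kf = "0" and kg = "0" and kh = "0" and ki = "0"], simp add: algebra_simps)
    apply (rule comb[where ka = "0" and kb = "0" and kc = "0" and kd = "0" and ke = "0" and kf = "1" and kg = "0" and kh = "0" and ki = "0"], simp add: algebra_simps)
    apply (rule comb[where ka = "0" and kb = "t12" and kc = "-1 * t14" and kd = "-1 * g2 * t13 - t02" and ke = "-1 * c + t04" and kf = "t13" and kg = "1" and kh = "0" and ki = "0"], simp only: assms, simp add: algebra_simps)
    apply (rule comb[where ka = "-1 * t12" and kb = "g2 * t13 + t02" and kc = "2 * c - t04 - t23" and kd = "0" and ke = "g0 * t14 + t20" and kf = "-1 * t10" and kg = "0" and kh = "1" and ki = "0"], simp only: assms, simp add: algebra_simps)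
    apply (rule comb[where ka = "t14" and kb = "-1 * c + t23" and kc = "-1 * t13" and kd = "-1 * g0 * t14 - t20" and ke = "t10" and kf = "0" and kg = "0" and kh = "0" and ki = "1"], simp only: assms, simp add: algebra_simps)
    done
qed

lemma british_gens_normalize_square_converse:
  assumes "s11 = g0 * s00 + g1 * s02 + g2 * s22"
    and "a0 = t00 * s00 + t01 * s02 + t02 * s22 + t03 * s01 + t04 * s12"
    and "a1 = t10 * s00 + (2 * c - t04 - t23) * s02 + t12 * s22 + t13 * s01 + t14 * s12"
    and "a2 = t20 * s00 + t21 * s02 + t22 * s22 + t23 * s01 + t24 * s12"
    and "b0 = (t00 + t13 * g0) * s00 + (t01 + t20 + t13 * g1 + t14 * g0) * s02 + (t03 + t10) * s01 + c * s12"
    and "b1 = 0"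
    and "b2 = (t02 + t21 + t13 * g2 + t14 * g1) * s02 + (t22 + t14 * g2) * s22 + (t24 + t12) * s12 + c * s01"
  shows "british_gens 0 s00 s01 s02 s11 s12 s22 a0 a1 a2 \<subseteq> ideal_mod.span (british_gens 0 s00 s01 s02 s11 s12 s22 b0 b1 b2)"
proof -
  note comb = british_combination_0[OF ideal_mod.span_superset ideal_mod.subspace_span]
  show ?thesis
    unfolding british_gens_0_subset_iff
    apply (intro conjI)
    apply (rule comb[where ka = "1" and kb = "0" and kc = "0" and kd = "0" and ke = "0" and kf = "0" and kg = "0" and kh = "0" and ki = "0"], simp add: algebra_simps)
    apply (rule comb[where ka = "0" and kb = "1" and kc = "0" and kd = "0" and ke = "0" and kf = "0" and kg = "0" and kh = "0" and ki = "0"], simp add: algebra_simps)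
    apply (rule comb[where ka = "0" and kb = "0" and kc = "1" and kd = "0" and ke = "0" and kf = "0" and kg = "0" and kh = "0" and ki = "0"], simp add: algebra_simps)
    apply (rule comb[where ka = "0" and kb = "0" and kc = "0" and kd = "1" and ke = "0" and kf = "0" and kg = "0" and kh = "0" and ki = "0"], simp add: algebra_simps)
    apply (rule comb[where ka = "0" and kb = "0" and kc = "0" and kd = "0" and ke = "1" and kf = "0" and kg = "0" and kh = "0" and ki = "0"], simp add: algebra_simps)
    apply (rule comb[where ka = "0" and kb = "0" and kc = "0" and kd = "0" and ke = "0" and kf = "1" and kg = "0" and kh = "0" and ki = "0"], simp add: algebra_simps)
    apply (rule comb[where ka = "0" and kb = "-1 * t12" and kc = "t14" and kd = "g2 * t13 + t02" and ke = "c - t04" and kf = "-1 * t13" and kg = "1" and kh = "0" and ki = "0"], simp only: assms, simp add: algebra_simps)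
    apply (rule comb[where ka = "t12" and kb = "-1 * g2 * t13 - t02" and kc = "-2 * c + t04 + t23" and kd = "0" and ke = "-1 * g0 * t14 - t20" and kf = "t10" and kg = "0" and kh = "1" and ki = "0"], simp only: assms, simp add: algebra_simps)
    apply (rule comb[where ka = "-1 * t14" and kb = "c - t23" and kc = "t13" and kd = "g0 * t14 + t20" and ke = "-1 * t10" and kf = "0" and kg = "0" and kh = "0" and ki = "1"], simp only: assms, simp add: algebra_simps)
    done
qed

text \<open>Here \<open>v1 v2 = h v0^2\<close>. Every monomial of the cubic part of
  \<open>v . a\<close> other than \<open>v1^3\<close> and \<open>v2^3\<close> becomes divisible by
  \<open>v0\<close> and is absorbed into \<open>b0\<close>.\<close>

lemma british_gens_normalize_product:
  assumes "s12 = h * s00"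
    and "a1 = t10 * s00 + t11 * s01 + t12 * s02 + t13 * s11 + t14 * s22"
    and "a2 = t20 * s00 + t21 * s01 + t22 * s02 + t23 * s11 + t24 * s22"
    and "b0 = a0 + t10 * s01 + t11 * s11 + t12 * h * s00 + t14 * h * s02 + t20 * s02 + t21 * h * s00 + t22 * s22 + t23 * h * s01"
    and "b1 = t13 * s11"
    and "b2 = t24 * s22"
  shows "british_gens 0 s00 s01 s02 s11 s12 s22 b0 b1 b2 \<subseteq> ideal_mod.span (british_gens 0 s00 s01 s02 s11 s12 s22 a0 a1 a2)"
proof -
  note comb = british_combination_0[OF ideal_mod.span_superset ideal_mod.subspace_span]
  show ?thesis
    unfolding british_gens_0_subset_iff
    apply (intro conjI)
    apply (rule comb[where ka = "1" and kb = "0" and kc = "0" and kd = "0" and ke = "0" and kf = "0" and kg = "0" and kh = "0" and ki = "0"], simp add: algebra_simps)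
    apply (rule comb[where ka = "0" and kb = "1" and kc = "0" and kd = "0" and ke = "0" and kf = "0" and kg = "0" and kh = "0" and ki = "0"], simp add: algebra_simps)
    apply (rule comb[where ka = "0" and kb = "0" and kc = "1" and kd = "0" and ke = "0" and kf = "0" and kg = "0" and kh = "0" and ki = "0"], simp add: algebra_simps)
    apply (rule comb[where ka = "0" and kb = "0" and kc = "0" and kd = "1" and ke = "0" and kf = "0" and kg = "0" and kh = "0" and ki = "0"], simp add: algebra_simps)
    apply (rule comb[where ka = "0" and kb = "0" and kc = "0" and kd = "0" and ke = "1" and kf = "0" and kg = "0" and kh = "0" and ki = "0"], simp add: algebra_simps)
    apply (rule comb[where ka = "0" and kb = "0" and kc = "0" and kd = "0" and ke = "0" and kf = "1" and kg = "0" and kh = "0" and ki = "0"], simp add: algebra_simps)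
    apply (rule comb[where ka = "0" and kb = "t14" and kc = "t23" and kd = "t22" and ke = "-1 * t12 - t21" and kf = "t11" and kg = "1" and kh = "0" and ki = "0"], simp only: assms, simp add: algebra_simps)
    apply (rule comb[where ka = "-1 * t14" and kb = "-1 * t22" and kc = "t12" and kd = "0" and ke = "h * t14 + t20" and kf = "-1 * h * t23 - t10" and kg = "0" and kh = "1" and ki = "0"], simp only: assms, simp add: algebra_simps)
    apply (rule comb[where ka = "-1 * t23" and kb = "t21" and kc = "-1 * t11" and kd = "-1 * h * t14 - t20" and ke = "h * t23 + t10" and kf = "0" and kg = "0" and kh = "0" and ki = "1"], simp only: assms, simp add: algebra_simps)
    done
qed

lemma british_gens_normalize_product_converse:
  assumes "s12 = h * s00"
    and "a1 = t10 * s00 + t11 * s01 + t12 * s02 + t13 * s11 + t14 * s22"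
    and "a2 = t20 * s00 + t21 * s01 + t22 * s02 + t23 * s11 + t24 * s22"
    and "b0 = a0 + t10 * s01 + t11 * s11 + t12 * h * s00 + t14 * h * s02 + t20 * s02 + t21 * h * s00 + t22 * s22 + t23 * h * s01"
    and "b1 = t13 * s11"
    and "b2 = t24 * s22"
  shows "british_gens 0 s00 s01 s02 s11 s12 s22 a0 a1 a2 \<subseteq> ideal_mod.span (british_gens 0 s00 s01 s02 s11 s12 s22 b0 b1 b2)"
proof -
  note comb = british_combination_0[OF ideal_mod.span_superset ideal_mod.subspace_span]
  show ?thesis
    unfolding british_gens_0_subset_iff
    apply (intro conjI)
    apply (rule comb[where ka = "1" and kb = "0" and kc = "0" and kd = "0" and ke = "0" and kf = "0" and kg = "0" and kh = "0" and ki = "0"], simp add: algebra_simps)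
    apply (rule comb[where ka = "0" and kb = "1" and kc = "0" and kd = "0" and ke = "0" and kf = "0" and kg = "0" and kh = "0" and ki = "0"], simp add: algebra_simps)
    apply (rule comb[where ka = "0" and kb = "0" and kc = "1" and kd = "0" and ke = "0" and kf = "0" and kg = "0" and kh = "0" and ki = "0"], simp add: algebra_simps)
    apply (rule comb[where ka = "0" and kb = "0" and kc = "0" and kd = "1" and ke = "0" and kf = "0" and kg = "0" and kh = "0" and ki = "0"], simp add: algebra_simps)
    apply (rule comb[where ka = "0" and kb = "0" and kc = "0" and kd = "0" and ke = "1" and kf = "0" and kg = "0" and kh = "0" and ki = "0"], simp add: algebra_simps)
    apply (rule comb[where ka = "0" and kb = "0" and kc = "0" and kd = "0" and ke = "0" and kf = "1" and kg = "0" and kh = "0" and ki = "0"], simp add: algebra_simps)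
    apply (rule comb[where ka = "0" and kb = "-1 * t14" and kc = "-1 * t23" and kd = "-1 * t22" and ke = "t12 + t21" and kf = "-1 * t11" and kg = "1" and kh = "0" and ki = "0"], simp only: assms, simp add: algebra_simps)
    apply (rule comb[where ka = "t14" and kb = "t22" and kc = "-1 * t12" and kd = "0" and ke = "-1 * h * t14 - t20" and kf = "h * t23 + t10" and kg = "0" and kh = "1" and ki = "0"], simp only: assms, simp add: algebra_simps)
    apply (rule comb[where ka = "t23" and kb = "-1 * t21" and kc = "t11" and kd = "h * t14 + t20" and ke = "-1 * h * t23 - t10" and kf = "0" and kg = "0" and kh = "0" and ki = "1"], simp only: assms, simp add: algebra_simps)
    done
qed

text \<open>Here \<open>v2^2\<close> is divisible by \<open>v0\<close>. Modulo terms absorbed into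
  \<open>b0\<close>, only \<open>v1^3\<close> and \<open>v1^2 v2\<close> remain, both carried by
  \<open>b1\<close>.\<close>

lemma british_gens_normalize_double:
  assumes "s22 = l0 * s00 + l1 * s01 + l2 * s02"
    and "a1 = t10 * s00 + t11 * s01 + t12 * s02 + t13 * s11 + t14 * s12"
    and "a2 = t20 * s00 + t21 * s01 + t22 * s02 + t23 * s11 + t24 * s12"
    and "b0 = a0 + t10 * s01 + t11 * s11 + t12 * s12 + t20 * s02 + t21 * s12 + t22 * s22 + t24 * (l0 * s01 + l1 * s11 + l2 * s12)"
    and "b1 = t13 * s11 + (t14 + t23) * s12"
    and "b2 = 0"
  shows "british_gens 0 s00 s01 s02 s11 s12 s22 b0 b1 b2 \<subseteq> ideal_mod.span (british_gens 0 s00 s01 s02 s11 s12 s22 a0 a1 a2)"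
proof -
  note comb = british_combination_0[OF ideal_mod.span_superset ideal_mod.subspace_span]
  show ?thesis
    unfolding british_gens_0_subset_iff
    apply (intro conjI)
    apply (rule comb[where ka = "1" and kb = "0" and kc = "0" and kd = "0" and ke = "0" and kf = "0" and kg = "0" and kh = "0" and ki = "0"], simp add: algebra_simps)
    apply (rule comb[where ka = "0" and kb = "1" and kc = "0" and kd = "0" and ke = "0" and kf = "0" and kg = "0" and kh = "0" and ki = "0"], simp add: algebra_simps)
    apply (rule comb[where ka = "0" and kb = "0" and kc = "1" and kd = "0" and ke = "0" and kf = "0" and kg = "0" and kh = "0" and ki = "0"], simp add: algebra_simps)
    apply (rule comb[where ka = "0" and kb = "0" and kc = "0" and kd = "1" and ke = "0" and kf = "0" and kg = "0" and kh = "0" and ki = "0"], simp add: algebra_simps)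
    apply (rule comb[where ka = "0" and kb = "0" and kc = "0" and kd = "0" and ke = "1" and kf = "0" and kg = "0" and kh = "0" and ki = "0"], simp add: algebra_simps)
    apply (rule comb[where ka = "0" and kb = "0" and kc = "0" and kd = "0" and ke = "0" and kf = "1" and kg = "0" and kh = "0" and ki = "0"], simp add: algebra_simps)
    apply (rule comb[where ka = "0" and kb = "-1 * t24" and kc = "t23" and kd = "t22" and ke = "-1 * l2 * t24 - t12 - t21" and kf = "l1 * t24 + t11" and kg = "1" and kh = "0" and ki = "0"], simp only: assms, simp add: algebra_simps)
    apply (rule comb[where ka = "t24" and kb = "-1 * t22" and kc = "l2 * t24 + t12" and kd = "0" and ke = "t20" and kf = "-1 * l0 * t24 - t10" and kg = "0" and kh = "1" and ki = "0"], simp only: assms, simp add: algebra_simps)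
    apply (rule comb[where ka = "-1 * t23" and kb = "t21" and kc = "-1 * l1 * t24 - t11" and kd = "-1 * t20" and ke = "l0 * t24 + t10" and kf = "0" and kg = "0" and kh = "0" and ki = "1"], simp only: assms, simp add: algebra_simps)
    done
qed

lemma british_gens_normalize_double_converse:
  assumes "s22 = l0 * s00 + l1 * s01 + l2 * s02"
    and "a1 = t10 * s00 + t11 * s01 + t12 * s02 + t13 * s11 + t14 * s12"
    and "a2 = t20 * s00 + t21 * s01 + t22 * s02 + t23 * s11 + t24 * s12"
    and "b0 = a0 + t10 * s01 + t11 * s11 + t12 * s12 + t20 * s02 + t21 * s12 + t22 * s22 + t24 * (l0 * s01 + l1 * s11 + l2 * s12)"
    and "b1 = t13 * s11 + (t14 + t23) * s12"
    and "b2 = 0"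
  shows "british_gens 0 s00 s01 s02 s11 s12 s22 a0 a1 a2 \<subseteq> ideal_mod.span (british_gens 0 s00 s01 s02 s11 s12 s22 b0 b1 b2)"
proof -
  note comb = british_combination_0[OF ideal_mod.span_superset ideal_mod.subspace_span]
  show ?thesis
    unfolding british_gens_0_subset_iff
    apply (intro conjI)
    apply (rule comb[where ka = "1" and kb = "0" and kc = "0" and kd = "0" and ke = "0" and kf = "0" and kg = "0" and kh = "0" and ki = "0"], simp add: algebra_simps)
    apply (rule comb[where ka = "0" and kb = "1" and kc = "0" and kd = "0" and ke = "0" and kf = "0" and kg = "0" and kh = "0" and ki = "0"], simp add: algebra_simps)
    apply (rule comb[where ka = "0" and kb = "0" and kc = "1" and kd = "0" and ke = "0" and kf = "0" and kg = "0" and kh = "0" and ki = "0"], simp add: algebra_simps)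
    apply (rule comb[where ka = "0" and kb = "0" and kc = "0" and kd = "1" and ke = "0" and kf = "0" and kg = "0" and kh = "0" and ki = "0"], simp add: algebra_simps)
    apply (rule comb[where ka = "0" and kb = "0" and kc = "0" and kd = "0" and ke = "1" and kf = "0" and kg = "0" and kh = "0" and ki = "0"], simp add: algebra_simps)
    apply (rule comb[where ka = "0" and kb = "0" and kc = "0" and kd = "0" and ke = "0" and kf = "1" and kg = "0" and kh = "0" and ki = "0"], simp add: algebra_simps)
    apply (rule comb[where ka = "0" and kb = "t24" and kc = "-1 * t23" and kd = "-1 * t22" and ke = "l2 * t24 + t12 + t21" and kf = "-1 * l1 * t24 - t11" and kg = "1" and kh = "0" and ki = "0"], simp only: assms, simp add: algebra_simps)
    apply (rule comb[where ka = "-1 * t24" and kb = "t22" and kc = "-1 * l2 * t24 - t12" and kd = "0" and ke = "-1 * t20" and kf = "l0 * t24 + t10" and kg = "0" and kh = "1" and ki = "0"], simp only: assms, simp add: algebra_simps)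
    apply (rule comb[where ka = "t23" and kb = "-1 * t21" and kc = "l1 * t24 + t11" and kd = "t20" and ke = "-1 * l0 * t24 - t10" and kf = "0" and kg = "0" and kh = "0" and ki = "1"], simp only: assms, simp add: algebra_simps)
    done
qed

text \<open>The two presentations have the same quadrics, but minors and relations trade places: up
  to sign, the last two relations \<open>S a\<close> on the right become minors on the left, and two
  minors on the right become relations.\<close>

lemma british_gens_reroot:
  shows "british_gens 0 x s11 s12 s01 s02 (l * s00) s00 (- s01) 0 \<subseteq> ideal_mod.span (british_gens 0 s00 s01 s02 s11 s12 (l * s01) (- x) s11 0)"
proof -
  note comb = british_combination_0[OF ideal_mod.span_superset ideal_mod.subspace_span]
  show ?thesis
    unfolding british_gens_0_subset_iff
    apply (intro conjI)
    apply (rule comb[where ka = "0" and kb = "0" and kc = "0" and kd = "1" and ke = "0" and kf = "0" and kg = "0" and kh = "0" and ki = "0"], simp add: algebra_simps)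
    apply (rule comb[where ka = "0" and kb = "1" and kc = "0" and kd = "0" and ke = "0" and kf = "- l" and kg = "0" and kh = "0" and ki = "0"], simp add: algebra_simps)
    apply (rule comb[where ka = "0" and kb = "0" and kc = "- 1" and kd = "0" and ke = "0" and kf = "0" and kg = "0" and kh = "0" and ki = "0"], simp add: algebra_simps)
    apply (rule comb[where ka = "1" and kb = "0" and kc = "0" and kd = "0" and ke = "0" and kf = "0" and kg = "- l" and kh = "0" and ki = "0"], simp add: algebra_simps)
    apply (rule comb[where ka = "0" and kb = "0" and kc = "0" and kd = "0" and ke = "0" and kf = "0" and kg = "0" and kh = "0" and ki = "1"], simp add: algebra_simps)
    apply (rule comb[where ka = "0" and kb = "0" and kc = "0" and kd = "0" and ke = "0" and kf = "0" and kg = "0" and kh = "- 1" and ki = "0"], simp add: algebra_simps)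
    apply (rule comb[where ka = "0" and kb = "0" and kc = "0" and kd = "0" and ke = "0" and kf = "0" and kg = "- 1" and kh = "0" and ki = "0"], simp add: algebra_simps)
    apply (rule comb[where ka = "0" and kb = "0" and kc = "0" and kd = "0" and ke = "0" and kf = "1" and kg = "0" and kh = "0" and ki = "0"], simp add: algebra_simps)
    apply (rule comb[where ka = "0" and kb = "0" and kc = "0" and kd = "0" and ke = "- 1" and kf = "0" and kg = "0" and kh = "0" and ki = "0"], simp add: algebra_simps)
    done
qed

lemma british_gens_reroot_converse:
  shows "british_gens 0 s00 s01 s02 s11 s12 (l * s01) (- x) s11 0 \<subseteq> ideal_mod.span (british_gens 0 x s11 s12 s01 s02 (l * s00) s00 (- s01) 0)"
proof -
  note comb = british_combination_0[OF ideal_mod.span_superset ideal_mod.subspace_span]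
  show ?thesis
    unfolding british_gens_0_subset_iff
    apply (intro conjI)
    apply (rule comb[where ka = "0" and kb = "0" and kc = "0" and kd = "1" and ke = "0" and kf = "0" and kg = "- l" and kh = "0" and ki = "0"], simp add: algebra_simps)
    apply (rule comb[where ka = "0" and kb = "1" and kc = "0" and kd = "0" and ke = "0" and kf = "0" and kg = "0" and kh = "l" and ki = "0"], simp add: algebra_simps)
    apply (rule comb[where ka = "0" and kb = "0" and kc = "- 1" and kd = "0" and ke = "0" and kf = "0" and kg = "0" and kh = "0" and ki = "0"], simp add: algebra_simps)
    apply (rule comb[where ka = "1" and kb = "0" and kc = "0" and kd = "0" and ke = "0" and kf = "0" and kg = "0" and kh = "0" and ki = "0"], simp add: algebra_simps)
    apply (rule comb[where ka = "0" and kb = "0" and kc = "0" and kd = "0" and ke = "0" and kf = "0" and kg = "0" and kh = "0" and ki = "- 1"], simp add: algebra_simps)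
    apply (rule comb[where ka = "0" and kb = "0" and kc = "0" and kd = "0" and ke = "0" and kf = "0" and kg = "0" and kh = "1" and ki = "0"], simp add: algebra_simps)
    apply (rule comb[where ka = "0" and kb = "0" and kc = "0" and kd = "0" and ke = "0" and kf = "0" and kg = "- 1" and kh = "0" and ki = "0"], simp add: algebra_simps)
    apply (rule comb[where ka = "0" and kb = "0" and kc = "0" and kd = "0" and ke = "0" and kf = "- 1" and kg = "0" and kh = "0" and ki = "0"], simp add: algebra_simps)
    apply (rule comb[where ka = "0" and kb = "0" and kc = "0" and kd = "0" and ke = "1" and kf = "0" and kg = "0" and kh = "0" and ki = "0"], simp add: algebra_simps)
    done
qed

text \<open>Opposite cofactors of \<open>S + r A\<close> have the common part
  \<open>adj S + r^2 a a^T\<close> and differ by \<open>2 r\<close> times an entry of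
  \<open>S a\<close>, up to sign. The converse therefore needs 2 and \<open>r\<close> to be
  invertible.\<close>

lemma minors3_sym_plus_antisym:
  shows "minors3 s00 (s01 + r * a2) (s02 - r * a1) (s01 - r * a2) s11 (s12 + r * a0) (s02 + r * a1) (s12 - r * a0) s22 \<subseteq> ideal_mod.span (british_gens (r * r) s00 s01 s02 s11 s12 s22 a0 a1 a2)"
proof -
  note comb = british_combination[OF ideal_mod.span_superset ideal_mod.subspace_span]
  show ?thesis
    unfolding minors3_subset_iff
    apply (intro conjI)
    apply (rule comb[where ka = "0" and kb = "0" and kc = "0" and kd = "0" and ke = "0" and kf = "1" and kg = "0" and kh = "0" and ki = "0"], simp add: algebra_simps)
    apply (rule comb[where ka = "0" and kb = "0" and kc = "0" and kd = "0" and ke = "- 1" and kf = "0" and kg = "r" and kh = "0" and ki = "0"], simp add: algebra_simps)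
    apply (rule comb[where ka = "0" and kb = "0" and kc = "1" and kd = "0" and ke = "0" and kf = "0" and kg = "0" and kh = "r" and ki = "0"], simp add: algebra_simps)
    apply (rule comb[where ka = "0" and kb = "0" and kc = "0" and kd = "0" and ke = "- 1" and kf = "0" and kg = "- r" and kh = "0" and ki = "0"], simp add: algebra_simps)
    apply (rule comb[where ka = "0" and kb = "0" and kc = "0" and kd = "1" and ke = "0" and kf = "0" and kg = "0" and kh = "0" and ki = "0"], simp add: algebra_simps)
    apply (rule comb[where ka = "0" and kb = "- 1" and kc = "0" and kd = "0" and ke = "0" and kf = "0" and kg = "0" and kh = "0" and ki = "r"], simp add: algebra_simps)
    apply (rule comb[where ka = "0" and kb = "0" and kc = "1" and kd = "0" and ke = "0" and kf = "0" and kg = "0" and kh = "- r" and ki = "0"], simp add: algebra_simps)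
    apply (rule comb[where ka = "0" and kb = "- 1" and kc = "0" and kd = "0" and ke = "0" and kf = "0" and kg = "0" and kh = "0" and ki = "- r"], simp add: algebra_simps)
    apply (rule comb[where ka = "1" and kb = "0" and kc = "0" and kd = "0" and ke = "0" and kf = "0" and kg = "0" and kh = "0" and ki = "0"], simp add: algebra_simps)
    done
qed

lemma minors3_sym_plus_antisym_converse:
  fixes h r :: "'a::comm_ring_1"
  assumes half: "h * 2 = 1"
    and unit: "v * r = 1"
  shows "british_gens (r * r) s00 s01 s02 s11 s12 s22 a0 a1 a2 \<subseteq> ideal_mod.span (minors3 s00 (s01 + r * a2) (s02 - r * a1) (s01 - r * a2) s11 (s12 + r * a0) (s02 + r * a1) (s12 - r * a0) s22)"
proof -
  have unit': "(h * v) * (2 * r) = 1"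
  proof -
    have "(h * v) * (2 * r) = (h * 2) * (v * r)" by (simp only: mult_ac)
    then show ?thesis by (simp add: half unit)
  qed
  note comb = minors3_combination[OF ideal_mod.span_superset ideal_mod.subspace_span]
  show ?thesis
    unfolding british_gens_subset_iff
    apply (intro conjI)
    apply (rule comb[where ka = "0" and kb = "0" and kc = "0" and kd = "0" and ke = "0" and kf = "0" and kg = "0" and kh = "0" and ki = "1"], simp add: algebra_simps)
    apply (rule unit_mult_closed[OF ideal_mod.subspace_span _ half], rule comb[where ka = "0" and kb = "0" and kc = "0" and kd = "0" and ke = "0" and kf = "- 1" and kg = "0" and kh = "- 1" and ki = "0"], simp add: algebra_simps)
    apply (rule unit_mult_closed[OF ideal_mod.subspace_span _ half], rule comb[where ka = "0" and kb = "0" and kc = "1" and kd = "0" and ke = "0" and kf = "0" and kg = "1" and kh = "0" and ki = "0"], simp add: algebra_simps)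
    apply (rule comb[where ka = "0" and kb = "0" and kc = "0" and kd = "0" and ke = "1" and kf = "0" and kg = "0" and kh = "0" and ki = "0"], simp add: algebra_simps)
    apply (rule unit_mult_closed[OF ideal_mod.subspace_span _ half], rule comb[where ka = "0" and kb = "- 1" and kc = "0" and kd = "- 1" and ke = "0" and kf = "0" and kg = "0" and kh = "0" and ki = "0"], simp add: algebra_simps)
    apply (rule comb[where ka = "1" and kb = "0" and kc = "0" and kd = "0" and ke = "0" and kf = "0" and kg = "0" and kh = "0" and ki = "0"], simp add: algebra_simps)
    apply (rule unit_mult_closed[OF ideal_mod.subspace_span _ unit'], rule comb[where ka = "0" and kb = "1" and kc = "0" and kd = "- 1" and ke = "0" and kf = "0" and kg = "0" and kh = "0" and ki = "0"], simp add: algebra_simps)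
    apply (rule unit_mult_closed[OF ideal_mod.subspace_span _ unit'], rule comb[where ka = "0" and kb = "0" and kc = "1" and kd = "0" and ke = "0" and kf = "0" and kg = "- 1" and kh = "0" and ki = "0"], simp add: algebra_simps)
    apply (rule unit_mult_closed[OF ideal_mod.subspace_span _ unit'], rule comb[where ka = "0" and kb = "0" and kc = "0" and kd = "0" and ke = "0" and kf = "1" and kg = "0" and kh = "- 1" and ki = "0"], simp add: algebra_simps)
    done
qed

text \<open>If \<open>S = v v\<^sup>T\<close>, where \<open>v\<^sub>1\<^sup>2\<close> depends linearly on \<open>v\<^sub>0\<^sup>2, v\<^sub>0 v\<^sub>2, v\<^sub>2\<^sup>2\<close>, then \<open>S a = 0\<close> with \<open>a1 = 0\<close> is one cubic
  relation. Moving \<open>q\<close> from \<open>0\<close> to \<open>1\<close> while correcting \<open>s11\<close> alone keeps the ideal for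
  almost all \<open>e\<close>.\<close>

lemma british_gens_deform:
  assumes "s11 = g0 * s00 + g1 * s02 + g2 * s22"
    and "a0 = c30 * s00 + c31 * s02 + c20 * s01 + c * s12"
    and "a2 = c32 * s02 + c33 * s22 + c22 * s12 + c * s01"
    and "s11' = s11 - e * e * (c * c * s11 - (c30 * c32 * s00 + (c30 * c33 + c31 * c32) * s02 + c31 * c33 * s22 + (c30 * c22 + c20 * c32) * s01 + (c31 * c22 + c20 * c33) * s12 + c20 * c22 * s11))"
  shows "british_gens 1 s00 s01 s02 s11' s12 s22 (e * a0) 0 (e * a2) \<subseteq> ideal_mod.span (british_gens 0 s00 s01 s02 s11 s12 s22 a0 0 a2)"
proof -
  note comb = british_combination_0[OF ideal_mod.span_superset ideal_mod.subspace_span]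
  show ?thesis
    unfolding british_gens_subset_iff
    apply (intro conjI)
    apply (rule comb[where ka = "1 + e * e * (c20 * c22 - c * c)" and kb = "e * e * (c * c31 - c20 * c32 - c22 * c30)" and kc = "0" and kd = "e * e * (c30 * c32)" and ke = "- e * e * c * c30" and kf = "0" and kg = "e * e * c30" and kh = "e * e * c20" and ki = "e * e * c31"], simp only: assms, simp add: algebra_simps)
    apply (rule comb[where ka = "0" and kb = "1" and kc = "0" and kd = "0" and ke = "0" and kf = "0" and kg = "0" and kh = "0" and ki = "0"], simp add: algebra_simps)
    apply (rule comb[where ka = "0" and kb = "- e * e * c20 * c33" and kc = "1 + e * e * (c20 * c22 - c * c)" and kd = "e * e * c30 * c33" and ke = "- e * e * c22 * c30" and kf = "0" and kg = "0" and kh = "e * e * c" and ki = "0"], simp only: assms, simp add: algebra_simps)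
    apply (rule comb[where ka = "0" and kb = "0" and kc = "0" and kd = "1" and ke = "0" and kf = "0" and kg = "0" and kh = "0" and ki = "0"], simp add: algebra_simps)
    apply (rule comb[where ka = "0" and kb = "0" and kc = "0" and kd = "0" and ke = "1" and kf = "0" and kg = "0" and kh = "0" and ki = "0"], simp add: algebra_simps)
    apply (rule comb[where ka = "0" and kb = "- e * e * c * c33" and kc = "0" and kd = "e * e * c31 * c33" and ke = "e * e * (c * c32 - c20 * c33 - c22 * c31)" and kf = "1 + e * e * (c20 * c22 - c * c)" and kg = "e * e * c32" and kh = "e * e * c22" and ki = "e * e * c33"], simp only: assms, simp add: algebra_simps)
    apply (rule comb[where ka = "0" and kb = "0" and kc = "0" and kd = "0" and ke = "0" and kf = "0" and kg = "e" and kh = "0" and ki = "0"], simp add: algebra_simps)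
    apply (rule comb[where ka = "0" and kb = "0" and kc = "0" and kd = "0" and ke = "0" and kf = "0" and kg = "0" and kh = "e" and ki = "0"], simp add: algebra_simps)
    apply (rule comb[where ka = "0" and kb = "0" and kc = "0" and kd = "0" and ke = "0" and kf = "0" and kg = "0" and kh = "0" and ki = "e"], simp add: algebra_simps)
    done
qed

lemma british_gens_deform_converse:
  assumes s: "s11 = g0 * s00 + g1 * s02 + g2 * s22"
    and a0: "a0 = c30 * s00 + c31 * s02 + c20 * s01 + c * s12"
    and a2: "a2 = c32 * s02 + c33 * s22 + c22 * s12 + c * s01"
    and s': "s11' = s11 - e * e * (c * c * s11 - (c30 * c32 * s00 + (c30 * c33 + c31 * c32) * s02 + c31 * c33 * s22 + (c30 * c22 + c20 * c32) * s01 + (c31 * c22 + c20 * c33) * s12 + c20 * c22 * s11))"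
    and unit: "f * e = 1"
    and unit': "i * (1 + e * e * (c20 * c22 - c * c)) = 1"
  shows "british_gens 0 s00 s01 s02 s11 s12 s22 a0 0 a2 \<subseteq> ideal_mod.span (british_gens 1 s00 s01 s02 s11' s12 s22 (e * a0) 0 (e * a2))"
proof -
  note comb = british_combination[OF ideal_mod.span_superset ideal_mod.subspace_span]
  show ?thesis
    unfolding british_gens_0_subset_iff
    apply (intro conjI)
    apply (rule unit_mult_closed[OF ideal_mod.subspace_span _ unit'], rule comb[where ka = "1" and kb = "- (e * e * (c * c31 - c20 * c32 - c22 * c30))" and kc = "0" and kd = "- (e * e * (c30 * c32))" and ke = "- (- e * e * c * c30)" and kf = "0" and kg = "- (e * c30)" and kh = "- (e * c20)" and ki = "- (e * c31)"], simp only: s' a0 a2 s, simp add: algebra_simps)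
    apply (rule comb[where ka = "0" and kb = "1" and kc = "0" and kd = "0" and ke = "0" and kf = "0" and kg = "0" and kh = "0" and ki = "0"], simp add: algebra_simps)
    apply (rule unit_mult_closed[OF ideal_mod.subspace_span _ unit'], rule comb[where ka = "0" and kb = "- (- e * e * c20 * c33)" and kc = "1" and kd = "- (e * e * c30 * c33)" and ke = "- (- e * e * c22 * c30)" and kf = "0" and kg = "0" and kh = "- (e * c)" and ki = "0"], simp only: s' a0 a2 s, simp add: algebra_simps)
    apply (rule comb[where ka = "0" and kb = "0" and kc = "0" and kd = "1" and ke = "0" and kf = "0" and kg = "0" and kh = "0" and ki = "0"], simp add: algebra_simps)
    apply (rule comb[where ka = "0" and kb = "0" and kc = "0" and kd = "0" and ke = "1" and kf = "0" and kg = "0" and kh = "0" and ki = "0"], simp add: algebra_simps)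
    apply (rule unit_mult_closed[OF ideal_mod.subspace_span _ unit'], rule comb[where ka = "0" and kb = "- (- e * e * c * c33)" and kc = "0" and kd = "- (e * e * c31 * c33)" and ke = "- (e * e * (c * c32 - c20 * c33 - c22 * c31))" and kf = "1" and kg = "- (e * c32)" and kh = "- (e * c22)" and ki = "- (e * c33)"], simp only: s' a0 a2 s, simp add: algebra_simps)
    apply (rule unit_mult_closed[OF ideal_mod.subspace_span _ unit], rule comb[where ka = "0" and kb = "0" and kc = "0" and kd = "0" and ke = "0" and kf = "0" and kg = "1" and kh = "0" and ki = "0"], simp add: algebra_simps)
    apply (rule unit_mult_closed[OF ideal_mod.subspace_span _ unit], rule comb[where ka = "0" and kb = "0" and kc = "0" and kd = "0" and ke = "0" and kf = "0" and kg = "0" and kh = "1" and ki = "0"], simp add: algebra_simps)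
    apply (rule unit_mult_closed[OF ideal_mod.subspace_span _ unit], rule comb[where ka = "0" and kb = "0" and kc = "0" and kd = "0" and ke = "0" and kf = "0" and kg = "0" and kh = "0" and ki = "1"], simp add: algebra_simps)
    done
qed

text \<open>For \<open>S = v v\<^sup>T\<close> with \<open>v\<^sub>1 v\<^sub>2 = h v\<^sub>0\<^sup>2\<close>, the relation \<open>S a = 0\<close> reads \<open>x v\<^sub>0 = c1 v\<^sub>1\<^sup>3 + c2 v\<^sub>2\<^sup>3\<close>. The matrix
  is a one-parameter deformation of \<open>S\<close> that still has rank one on this curve.\<close>

lemma minors3_product_form:
  shows "minors3 s00 s01 (s02 + e * c1 * s11) (s01 + e * c2 * s22) (s11 + e * c2 * h * s02) (h * s00 + e * x + e * e * c1 * c2 * h * h * s00) s02 (h * s00) (s22 + e * c1 * h * s01) \<subseteq> ideal_mod.span (british_gens 0 s00 s01 s02 s11 (h * s00) s22 (- x) (c1 * s11) (c2 * s22))"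
proof -
  note comb = british_combination_0[OF ideal_mod.span_superset ideal_mod.subspace_span]
  show ?thesis
    unfolding minors3_subset_iff
    apply (intro conjI)
    apply (rule comb[where ka = "0" and kb = "c2 * e" and kc = "0" and kd = "0" and ke = "0" and kf = "1" and kg = "0" and kh = "0" and ki = "0"], simp add: algebra_simps)
    apply (rule comb[where ka = "- c1 * c2 * e * e" and kb = "0" and kc = "0" and kd = "0" and ke = "- 1" and kf = "0" and kg = "- e" and kh = "0" and ki = "0"], simp add: algebra_simps)
    apply (rule comb[where ka = "0" and kb = "0" and kc = "1 + c1 * c2 * e * e * h" and kd = "c2 * e * h" and ke = "0" and kf = "0" and kg = "0" and kh = "- e" and ki = "0"], simp add: algebra_simps)
    apply (rule comb[where ka = "0" and kb = "0" and kc = "0" and kd = "0" and ke = "- 1" and kf = "0" and kg = "0" and kh = "0" and ki = "0"], simp add: algebra_simps)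
    apply (rule comb[where ka = "0" and kb = "0" and kc = "c1 * e" and kd = "1" and ke = "0" and kf = "0" and kg = "0" and kh = "0" and ki = "0"], simp add: algebra_simps)
    apply (rule comb[where ka = "0" and kb = "- 1" and kc = "0" and kd = "0" and ke = "0" and kf = "- c1 * e * h" and kg = "0" and kh = "0" and ki = "0"], simp add: algebra_simps)
    apply (rule comb[where ka = "0" and kb = "0" and kc = "1" and kd = "c2 * e * h" and ke = "0" and kf = "0" and kg = "0" and kh = "0" and ki = "0"], simp add: algebra_simps)
    apply (rule comb[where ka = "0" and kb = "- 1 - c1 * c2 * e * e * h" and kc = "0" and kd = "0" and ke = "0" and kf = "- c1 * e * h" and kg = "0" and kh = "0" and ki = "e"], simp add: algebra_simps)
    apply (rule comb[where ka = "1" and kb = "0" and kc = "0" and kd = "0" and ke = "c1 * c2 * e * e * h * h" and kf = "0" and kg = "e * h" and kh = "0" and ki = "0"], simp add: algebra_simps)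
    done
qed

lemma minors3_product_form_converse:
  assumes unit: "f * e = 1"
    and unit': "i * (1 - c1 * c2 * e * e * h) = 1"
  shows "british_gens 0 s00 s01 s02 s11 (h * s00) s22 (- x) (c1 * s11) (c2 * s22) \<subseteq> ideal_mod.span (minors3 s00 s01 (s02 + e * c1 * s11) (s01 + e * c2 * s22) (s11 + e * c2 * h * s02) (h * s00 + e * x + e * e * c1 * c2 * h * h * s00) s02 (h * s00) (s22 + e * c1 * h * s01))"
proof -
  \<comment> \<open>The minors yield the relations \<open>S a\<close> only after multiplication by
    \<open>e\<close> and by the same unit that recovers the minors of \<open>S\<close>.\<close>
  have unit'': "(f * i) * (e * (1 - c1 * c2 * e * e * h)) = 1"
  proof -
    have "(f * i) * (e * (1 - c1 * c2 * e * e * h)) = (f * e) * (i * (1 - c1 * c2 * e * e * h))" by (simp only: mult_ac)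
    then show ?thesis by (simp add: unit unit')
  qed
  note comb = minors3_combination[OF ideal_mod.span_superset ideal_mod.subspace_span]
  show ?thesis
    unfolding british_gens_0_subset_iff
    apply (intro conjI)
    apply (rule unit_mult_closed[OF ideal_mod.subspace_span _ unit'], rule comb[where ka = "0" and kb = "h" and kc = "0" and kd = "- h * (1 - c1 * c2 * e * e * h)" and ke = "0" and kf = "0" and kg = "0" and kh = "0" and ki = "1"], simp add: algebra_simps)
    apply (rule unit_mult_closed[OF ideal_mod.subspace_span _ unit'], rule comb[where ka = "- c1 * e * h" and kb = "0" and kc = "0" and kd = "0" and ke = "0" and kf = "- 1" and kg = "0" and kh = "0" and ki = "0"], simp add: algebra_simps)
    apply (rule unit_mult_closed[OF ideal_mod.subspace_span _ unit'], rule comb[where ka = "0" and kb = "0" and kc = "0" and kd = "0" and ke = "- c2 * e * h" and kf = "0" and kg = "1" and kh = "0" and ki = "0"], simp add: algebra_simps)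
    apply (rule unit_mult_closed[OF ideal_mod.subspace_span _ unit'], rule comb[where ka = "0" and kb = "0" and kc = "0" and kd = "0" and ke = "1" and kf = "0" and kg = "- c1 * e" and kh = "0" and ki = "0"], simp add: algebra_simps)
    apply (rule comb[where ka = "0" and kb = "0" and kc = "0" and kd = "- 1" and ke = "0" and kf = "0" and kg = "0" and kh = "0" and ki = "0"], simp add: algebra_simps)
    apply (rule unit_mult_closed[OF ideal_mod.subspace_span _ unit'], rule comb[where ka = "1" and kb = "0" and kc = "0" and kd = "0" and ke = "0" and kf = "c2 * e" and kg = "0" and kh = "0" and ki = "0"], simp add: algebra_simps)
    apply (rule unit_mult_closed[OF ideal_mod.subspace_span _ unit''], rule comb[where ka = "0" and kb = "- (1 - c1 * c2 * e * e * h) - c1 * c2 * e * e * h" and kc = "0" and kd = "(1 - c1 * c2 * e * e * h) + c1 * c2 * e * e * h * (1 - c1 * c2 * e * e * h)" and ke = "0" and kf = "0" and kg = "0" and kh = "0" and ki = "- c1 * c2 * e * e"], simp add: algebra_simps)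
    apply (rule unit_mult_closed[OF ideal_mod.subspace_span _ unit''], rule comb[where ka = "0" and kb = "0" and kc = "- (1 - c1 * c2 * e * e * h)" and kd = "0" and ke = "- (1 + c1 * c2 * e * e * h) * c2 * e * h + c2 * e * h" and kf = "0" and kg = "(1 + c1 * c2 * e * e * h) - c1 * c2 * e * e * h" and kh = "0" and ki = "0"], simp add: algebra_simps)
    apply (rule unit_mult_closed[OF ideal_mod.subspace_span _ unit''], rule comb[where ka = "- (1 + c1 * c2 * e * e * h) * c1 * e * h + c1 * e * h" and kb = "0" and kc = "0" and kd = "0" and ke = "0" and kf = "- (1 + c1 * c2 * e * e * h) + c1 * c2 * e * e * h" and kg = "0" and kh = "(1 - c1 * c2 * e * e * h)" and ki = "0"], simp add: algebra_simps)
    done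
qed

section \<open>Reduction of the British form with \<open>q = 0\<close>\<close>

text \<open>The depth condition is separated off; \<open>ideal_depth_eq_4\<close> supplies it for
  every ideal in question.\<close>

definition scandinavian_form :: "'k::field poly5 set \<Rightarrow> bool" where
  "scandinavian_form I \<longleftrightarrow> (\<exists>m00 m01 m02 m10 m11 m12 m20 m21 m22.
     {m00, m01, m02, m10, m11, m12, m20, m21, m22} \<subseteq> forms 1 \<and>
     I = ideal_mod.span (minors3 m00 m01 m02 m10 m11 m12 m20 m21 m22))"

definition british_form :: "'k::field poly5 set \<Rightarrow> 'k poly5 \<Rightarrow> 'k poly5 \<Rightarrow> 'k poly5 \<Rightarrow> 'k poly5 \<Rightarrow> 'k poly5 \<Rightarrow> 'k poly5 \<Rightarrow>
    'k poly5 \<Rightarrow> 'k poly5 \<Rightarrow> 'k poly5 \<Rightarrow> bool" where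
  "british_form I s00 s01 s02 s11 s12 s22 a0 a1 a2 \<longleftrightarrow>
     {s00, s01, s02, s11, s12, s22, a0, a1, a2} \<subseteq> forms 1 \<and>
     I = ideal_mod.span (british_gens 0 s00 s01 s02 s11 s12 s22 a0 a1 a2)"

text \<open>Base changes preserve this space. The position of \<open>a\<close> relative to it
  decides which normal form is reached.\<close>

definition entry_span :: "'k::field poly5 \<Rightarrow> 'k poly5 \<Rightarrow> 'k poly5 \<Rightarrow> 'k poly5 \<Rightarrow> 'k poly5 \<Rightarrow> 'k poly5 \<Rightarrow> 'k poly5 set" where
  "entry_span s00 s01 s02 s11 s12 s22 = poly5.span {s00, s01, s02, s11, s12, s22}"

lemma british_formI:
  assumes "british_form I s00 s01 s02 s11 s12 s22 a0 a1 a2"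
    and "{t00, t01, t02, t11, t12, t22, b0, b1, b2} \<subseteq> forms 1"
    and "british_gens 0 t00 t01 t02 t11 t12 t22 b0 b1 b2 \<subseteq> ideal_mod.span (british_gens 0 s00 s01 s02 s11 s12 s22 a0 a1 a2)"
    and "british_gens 0 s00 s01 s02 s11 s12 s22 a0 a1 a2 \<subseteq> ideal_mod.span (british_gens 0 t00 t01 t02 t11 t12 t22 b0 b1 b2)"
  shows "british_form I t00 t01 t02 t11 t12 t22 b0 b1 b2"
  using assms span_eqI[OF assms(3,4)] unfolding british_form_def by simp

lemma british_swap01:
  assumes "british_form I s00 s01 s02 s11 s12 s22 a0 a1 a2"
  shows "british_form I s11 s01 s12 s00 s02 s22 a1 a0 a2"
  by (rule british_formI[OF assms _ british_gens_swap01 british_gens_swap01]) (use assms in \<open>simp add: british_form_def\<close>)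

lemma british_swap12:
  assumes "british_form I s00 s01 s02 s11 s12 s22 a0 a1 a2"
  shows "british_form I s00 s02 s01 s22 s12 s11 a0 a2 a1"
  by (rule british_formI[OF assms _ british_gens_swap12 british_gens_swap12]) (use assms in \<open>simp add: british_form_def\<close>)

text \<open>In the family \<open>british_Tij\<close> the digits mean that \<open>k\<close> times row
  and column \<open>j\<close> is added to row and column \<open>i\<close>; \<open>a\<close> changes
  contragrediently. All are conjugates of this one by swaps.\<close>

lemma british_T10:
  assumes "british_form I s00 s01 s02 s11 s12 s22 a0 a1 a2"
  shows "british_form I s00 (s01 + const5 k * s00) s02 (s11 + const5 (2 * k) * s01 + const5 (k * k) * s00)
    (s12 + const5 k * s02) s22 (a0 - const5 k * a1) a1 a2"
proof (rule british_formI[OF assms])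
  show "{s00, s01 + const5 k * s00, s02, s11 + const5 (2 * k) * s01 + const5 (k * k) * s00,
    s12 + const5 k * s02, s22, a0 - const5 k * a1, a1, a2} \<subseteq> forms 1"
    using assms unfolding british_form_def by (simp add: forms_add forms_diff forms_scale del: const5_hom)
  show "british_gens 0 s00 (s01 + const5 k * s00) s02 (s11 + const5 (2 * k) * s01 + const5 (k * k) * s00)
    (s12 + const5 k * s02) s22 (a0 - const5 k * a1) a1 a2 \<subseteq> ideal_mod.span (british_gens 0 s00 s01 s02 s11 s12 s22 a0 a1 a2)"
    using british_gens_transvection[of s00 s01 "const5 k" s02 s11 s12 s22 a0 a1 a2] by simp
  have eq: "s01 + const5 k * s00 + (- const5 k) * s00 = s01"
    "s11 + const5 (2 * k) * s01 + const5 (k * k) * s00 + 2 * (- const5 k) * (s01 + const5 k * s00) + (- const5 k) * (- const5 k) * s00 = s11"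
    "s12 + const5 k * s02 + (- const5 k) * s02 = s12" "a0 - const5 k * a1 - (- const5 k) * a1 = a0"
    by (simp_all add: algebra_simps)
  from british_gens_transvection[of s00 "s01 + const5 k * s00" "- const5 k" s02
    "s11 + const5 (2 * k) * s01 + const5 (k * k) * s00" "s12 + const5 k * s02" s22 "a0 - const5 k * a1" a1 a2]
  show "british_gens 0 s00 s01 s02 s11 s12 s22 a0 a1 a2 \<subseteq> ideal_mod.span (british_gens 0 s00 (s01 + const5 k * s00) s02
    (s11 + const5 (2 * k) * s01 + const5 (k * k) * s00) (s12 + const5 k * s02) s22 (a0 - const5 k * a1) a1 a2)"
    unfolding eq .
qed

lemma british_T20:
  assumes "british_form I s00 s01 s02 s11 s12 s22 a0 a1 a2"
  shows "british_form I s00 s01 (s02 + const5 k * s00) s11 (s12 + const5 k * s01)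
    (s22 + const5 (2 * k) * s02 + const5 (k * k) * s00) (a0 - const5 k * a2) a1 a2"
  by (rule british_swap12[OF british_T10[OF british_swap12[OF assms]]])

lemma british_T01:
  assumes "british_form I s00 s01 s02 s11 s12 s22 a0 a1 a2"
  shows "british_form I (s00 + const5 (2 * k) * s01 + const5 (k * k) * s11) (s01 + const5 k * s11) (s02 + const5 k * s12)
    s11 s12 s22 a0 (a1 - const5 k * a0) a2"
  by (rule british_swap01[OF british_T10[OF british_swap01[OF assms]]])

lemma british_T21:
  assumes "british_form I s00 s01 s02 s11 s12 s22 a0 a1 a2"
  shows "british_form I s00 s01 (s02 + const5 k * s01) s11 (s12 + const5 k * s11)
    (s22 + const5 (2 * k) * s12 + const5 (k * k) * s11) a0 (a1 - const5 k * a2) a2"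
  by (rule british_swap01[OF british_T20[OF british_swap01[OF assms]]])

lemma british_T12:
  assumes "british_form I s00 s01 s02 s11 s12 s22 a0 a1 a2"
  shows "british_form I s00 (s01 + const5 k * s02) s02 (s11 + const5 (2 * k) * s12 + const5 (k * k) * s22)
    (s12 + const5 k * s22) s22 a0 a1 (a2 - const5 k * a1)"
  by (rule british_swap12[OF british_T21[OF british_swap12[OF assms]]])

lemma british_T02:
  assumes "british_form I s00 s01 s02 s11 s12 s22 a0 a1 a2"
  shows "british_form I (s00 + const5 (2 * k) * s02 + const5 (k * k) * s22) (s01 + const5 k * s12) (s02 + const5 k * s22)
    s11 s12 s22 a0 a1 (a2 - const5 k * a0)"
  by (rule british_swap01[OF british_T12[OF british_swap01[OF assms]]])

lemma entry_span_subspace: "poly5.subspace (entry_span s00 s01 s02 s11 s12 s22)"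
  unfolding entry_span_def by (rule poly5.subspace_span)

lemmas entry_span_add = poly5.subspace_add[OF entry_span_subspace]
  and entry_span_diff = poly5.subspace_diff[OF entry_span_subspace]
  and entry_span_scale = poly5.subspace_scale[OF entry_span_subspace]

lemma entry_span_base: "{s00, s01, s02, s11, s12, s22} \<subseteq> entry_span s00 s01 s02 s11 s12 s22"
  unfolding entry_span_def by (rule poly5.span_superset)

lemma entry_spanI:
  "x = const5 ka * s00 + const5 kb * s01 + const5 kc * s02 + const5 kd * s11 + const5 ke * s12 + const5 kf * s22 \<Longrightarrow>
    x \<in> entry_span s00 s01 s02 s11 s12 s22"
  using entry_span_base[of s00 s01 s02 s11 s12 s22] by (simp add: entry_span_add entry_span_scale)

lemma entry_spanE:
  assumes "x \<in> entry_span s00 s01 s02 s11 s12 s22"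
  obtains c00 c01 c02 c11 c12 c22 where
    "x = const5 c00 * s00 + const5 c01 * s01 + const5 c02 * s02 + const5 c11 * s11 + const5 c12 * s12 + const5 c22 * s22"
proof -
  from assms obtain c00 c01 c02 c11 c12 c22 where
    "x - const5 c00 * s00 - const5 c01 * s01 - const5 c02 * s02 - const5 c11 * s11 - const5 c12 * s12 - const5 c22 * s22 = 0"
    unfolding entry_span_def poly5.span_breakdown_eq poly5.span_empty singleton_iff by (elim exE)
  then have "x = const5 c00 * s00 + const5 c01 * s01 + const5 c02 * s02 + const5 c11 * s11 + const5 c12 * s12 + const5 c22 * s22"
    by (simp add: algebra_simps)
  then show ?thesis by (rule that)
qed

lemma entry_span_subsetI:
  assumes "{s00, s01, s02, s11, s12, s22} \<subseteq> entry_span t00 t01 t02 t11 t12 t22"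
  shows "entry_span s00 s01 s02 s11 s12 s22 \<subseteq> entry_span t00 t01 t02 t11 t12 t22"
  using poly5.span_minimal[OF assms entry_span_subspace] unfolding entry_span_def .

lemma entry_span_swap01: "entry_span s11 s01 s12 s00 s02 s22 = entry_span s00 s01 s02 s11 s12 s22"
  unfolding entry_span_def by (rule arg_cong[of _ _ poly5.span]) blast

lemma entry_span_swap12: "entry_span s00 s02 s01 s22 s12 s11 = entry_span s00 s01 s02 s11 s12 s22"
  unfolding entry_span_def by (rule arg_cong[of _ _ poly5.span]) blast

lemma entry_span_T10:
  "entry_span s00 s01 s02 s11 s12 s22 \<subseteq> entry_span s00 (s01 + const5 k * s00) s02
    (s11 + const5 (2 * k) * s01 + const5 (k * k) * s00) (s12 + const5 k * s02) s22"
proof (rule entry_span_subsetI, simp only: insert_subset empty_subsetI simp_thms, intro conjI)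
  let ?S = "entry_span s00 (s01 + const5 k * s00) s02
    (s11 + const5 (2 * k) * s01 + const5 (k * k) * s00) (s12 + const5 k * s02) s22"
  show "s00 \<in> ?S" "s02 \<in> ?S" "s22 \<in> ?S"
    using entry_span_base[of s00 "s01 + const5 k * s00" s02 "s11 + const5 (2 * k) * s01 + const5 (k * k) * s00" "s12 + const5 k * s02" s22]
    by simp_all
  show "s01 \<in> ?S"
    by (rule entry_spanI[where ka = "- k" and kb = 1 and kc = 0 and kd = 0 and ke = 0 and kf = 0]) (simp add: algebra_simps)
  show "s11 \<in> ?S"
    by (rule entry_spanI[where ka = "k * k" and kb = "- 2 * k" and kc = 0 and kd = 1 and ke = 0 and kf = 0]) (simp add: algebra_simps)
  show "s12 \<in> ?S"
    by (rule entry_spanI[where ka = 0 and kb = 0 and kc = "- k" and kd = 0 and ke = 1 and kf = 0]) (simp add: algebra_simps)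
qed

lemma entry_span_T20:
  "entry_span s00 s01 s02 s11 s12 s22 \<subseteq> entry_span s00 s01 (s02 + const5 k * s00) s11 (s12 + const5 k * s01)
    (s22 + const5 (2 * k) * s02 + const5 (k * k) * s00)"
  using entry_span_T10[of s00 s02 s01 s22 s12 s11 k] by (simp only: entry_span_swap12)

lemma entry_span_T01:
  "entry_span s00 s01 s02 s11 s12 s22 \<subseteq> entry_span (s00 + const5 (2 * k) * s01 + const5 (k * k) * s11) (s01 + const5 k * s11)
    (s02 + const5 k * s12) s11 s12 s22"
  using entry_span_T10[of s11 s01 s12 s00 s02 s22 k]
  unfolding entry_span_swap01[of s11] .

lemma entry_span_T21:
  "entry_span s00 s01 s02 s11 s12 s22 \<subseteq> entry_span s00 s01 (s02 + const5 k * s01) s11 (s12 + const5 k * s11)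
    (s22 + const5 (2 * k) * s12 + const5 (k * k) * s11)"
  using entry_span_T20[of s11 s01 s12 s00 s02 s22 k]
  unfolding entry_span_swap01[of s11] .

lemma entry_span_T12:
  "entry_span s00 s01 s02 s11 s12 s22 \<subseteq> entry_span s00 (s01 + const5 k * s02) s02 (s11 + const5 (2 * k) * s12 + const5 (k * k) * s22)
    (s12 + const5 k * s22) s22"
  using entry_span_T21[of s00 s02 s01 s22 s12 s11 k] by (simp only: entry_span_swap12)

lemma entry_span_T02:
  "entry_span s00 s01 s02 s11 s12 s22 \<subseteq> entry_span (s00 + const5 (2 * k) * s02 + const5 (k * k) * s22) (s01 + const5 k * s12)
    (s02 + const5 k * s22) s11 s12 s22"
  using entry_span_T12[of s11 s01 s12 s00 s02 s22 k]
  unfolding entry_span_swap01[of s11] .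

section \<open>The case where \<open>a\<close> lies in the span of the entries of
  \<open>S\<close>\<close>

lemma two_three_nonzero:
  assumes "CHAR('k::field) \<noteq> 2" "CHAR('k) \<noteq> 3"
  shows "(2 :: 'k) \<noteq> 0" "(3 :: 'k) \<noteq> 0"
proof -
  have "CHAR('k) \<noteq> 1" by simp
  moreover have "n = 1 \<or> n = 2" if "n dvd 2" for n :: nat
    using dvd_imp_le[OF that] that by (cases "n = 0") auto
  moreover have "n = 1 \<or> n = 3" if "n dvd 3" for n :: nat
  proof -
    have "n = 0 \<or> n = 1 \<or> n = 2 \<or> n = 3" using dvd_imp_le[OF that] by auto
    then show ?thesis using that by auto
  qed
  ultimately have "\<not> CHAR('k) dvd 2" "\<not> CHAR('k) dvd 3" using assms by blast+
  then show "(2 :: 'k) \<noteq> 0" "(3 :: 'k) \<noteq> 0"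
    using of_nat_eq_0_iff_char_dvd[of 2, where 'a='k] of_nat_eq_0_iff_char_dvd[of 3, where 'a='k] by simp_all
qed

lemma const5_inverse_mult: "c \<noteq> 0 \<Longrightarrow> const5 (inverse c) * const5 c = 1"
  unfolding const5_hom(4)[symmetric] by simp

text \<open>One of \<open>e = 1\<close> and \<open>e = 2\<close> works: if the first fails, then
  \<open>D = -1\<close> and the second gives \<open>-3\<close>.\<close>

lemma deformation_parameter:
  fixes D :: "'k::field"
  assumes "(2 :: 'k) \<noteq> 0" "(3 :: 'k) \<noteq> 0"
  obtains e where "e \<noteq> 0" "1 + e * e * D \<noteq> 0"
proof (cases "1 + D = 0")
  case True
  then have D: "D = - 1" by (simp add: add_eq_0_iff)
  have "1 + 2 * 2 * D = - (3 :: 'k)" by (simp add: D)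
  then have "1 + 2 * 2 * D \<noteq> 0"
    using assms(2) by (simp only: neg_equal_0_iff_equal not_False_eq_True)
  with assms(1) show ?thesis by (rule that)
next
  case False
  then show ?thesis using that[of 1] by simp
qed

lemma half_const5:
  assumes "(2 :: 'k::field) \<noteq> 0"
  shows "const5 (inverse (2 :: 'k)) * 2 = 1"
proof -
  have "const5 (inverse (2 :: 'k)) * const5 2 = 1" by (rule const5_inverse_mult[OF assms])
  then show ?thesis by simp
qed

lemma scandinavian_form_of_square:
  fixes I :: "'k::field poly5 set"
  assumes "(2 :: 'k) \<noteq> 0" "r \<noteq> 0"
    and forms: "{s00, s01, s02, s11, s12, s22, a0, a1, a2} \<subseteq> forms 1"
    and I: "I = ideal_mod.span (british_gens (const5 (r * r)) s00 s01 s02 s11 s12 s22 a0 a1 a2)"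
  shows "scandinavian_form I"
proof -
  let ?M = "minors3 s00 (s01 + const5 r * a2) (s02 - const5 r * a1) (s01 - const5 r * a2) s11 (s12 + const5 r * a0)
    (s02 + const5 r * a1) (s12 - const5 r * a0) s22"
  have "ideal_mod.span ?M = ideal_mod.span (british_gens (const5 r * const5 r) s00 s01 s02 s11 s12 s22 a0 a1 a2)"
    by (rule span_eqI[OF minors3_sym_plus_antisym
          minors3_sym_plus_antisym_converse[OF half_const5[OF assms(1)] const5_inverse_mult[OF assms(2)]]])
  then have "I = ideal_mod.span ?M" using I by simp
  moreover have "{s00, s01 + const5 r * a2, s02 - const5 r * a1, s01 - const5 r * a2, s11, s12 + const5 r * a0,
    s02 + const5 r * a1, s12 - const5 r * a0, s22} \<subseteq> forms 1"
    using forms by (simp add: forms_add forms_diff forms_scale)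
  ultimately show ?thesis
    unfolding scandinavian_form_def by blast
qed

lemma scandinavian_square:
  fixes I :: "'k::field poly5 set"
  assumes nz: "(2 :: 'k) \<noteq> 0" "(3 :: 'k) \<noteq> 0"
    and B: "british_form I s00 s01 s02 s11 s12 s22 a0 a1 a2"
    and s11: "s11 = const5 g0 * s00 + const5 g1 * s02 + const5 g2 * s22"
    and a: "{a0, a1, a2} \<subseteq> entry_span s00 s01 s02 s11 s12 s22"
  shows "scandinavian_form I"
proof -
  have reduce: "\<exists>t0 t1 t2 t3 t4. x = const5 t0 * s00 + const5 t1 * s02 + const5 t2 * s22 + const5 t3 * s01 + const5 t4 * s12"
    if mem: "x \<in> entry_span s00 s01 s02 s11 s12 s22" for x
  proof -
    obtain c00 c01 c02 c11 c12 c22 where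
      "x = const5 c00 * s00 + const5 c01 * s01 + const5 c02 * s02 + const5 c11 * s11 + const5 c12 * s12 + const5 c22 * s22"
      by (rule entry_spanE[OF mem])
    then have "x = const5 (c00 + c11 * g0) * s00 + const5 (c02 + c11 * g1) * s02 + const5 (c22 + c11 * g2) * s22
      + const5 c01 * s01 + const5 c12 * s12"
      by (simp add: s11 algebra_simps)
    then show ?thesis by (intro exI)
  qed
  obtain t00 t01 t02 t03 t04 where a0: "a0 = const5 t00 * s00 + const5 t01 * s02 + const5 t02 * s22 + const5 t03 * s01 + const5 t04 * s12"
    using reduce[of a0] a by auto
  obtain t10 t11 t12 t13 t14 where a1: "a1 = const5 t10 * s00 + const5 t11 * s02 + const5 t12 * s22 + const5 t13 * s01 + const5 t14 * s12"
    using reduce[of a1] a by auto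
  obtain t20 t21 t22 t23 t24 where a2: "a2 = const5 t20 * s00 + const5 t21 * s02 + const5 t22 * s22 + const5 t23 * s01 + const5 t24 * s12"
    using reduce[of a2] a by auto
  \<comment> \<open>Half the coefficient of \<open>v0 v1 v2\<close> in \<open>v . a\<close>. The
    equal split turns a product below into a difference of squares.\<close>
  define c where "c = inverse 2 * (t11 + t04 + t23)"
  have "2 * c = t11 + t04 + t23"
    unfolding c_def mult.assoc[symmetric] using nz(1) by simp
  then have "t11 = 2 * c - t04 - t23" by simp
  then have a1': "a1 = const5 t10 * s00 + (2 * const5 c - const5 t04 - const5 t23) * s02 + const5 t12 * s22 + const5 t13 * s01 + const5 t14 * s12"
    unfolding a1 by simp
  \<comment> \<open>The other coefficients of the cubic: the first digit of \<open>c30\<close>,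
    \<open>c31\<close>, \<open>c32\<close>, \<open>c33\<close> marks monomials
    \<open>v0^(3-j) v2^j\<close>, while \<open>c20\<close> and \<open>c22\<close> belong to
    \<open>v0^2 v1\<close> and \<open>v1 v2^2\<close>.\<close>
  define c30 c31 c32 c33 c20 c22 where "c30 = t00 + t13 * g0" and "c31 = t01 + t20 + t13 * g1 + t14 * g0"
    and "c32 = t02 + t21 + t13 * g2 + t14 * g1" and "c33 = t22 + t14 * g2" and "c20 = t03 + t10" and "c22 = t24 + t12"
  define b0 where "b0 = const5 c30 * s00 + const5 c31 * s02 + const5 c20 * s01 + const5 c * s12"
  define b2 where "b2 = const5 c32 * s02 + const5 c33 * s22 + const5 c22 * s12 + const5 c * s01"
  have b0: "b0 = (const5 t00 + const5 t13 * const5 g0) * s00 + (const5 t01 + const5 t20 + const5 t13 * const5 g1 + const5 t14 * const5 g0) * s02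
    + (const5 t03 + const5 t10) * s01 + const5 c * s12"
    by (simp add: b0_def c30_def c31_def c20_def)
  have b2: "b2 = (const5 t02 + const5 t21 + const5 t13 * const5 g2 + const5 t14 * const5 g1) * s02 + (const5 t22 + const5 t14 * const5 g2) * s22
    + (const5 t24 + const5 t12) * s12 + const5 c * s01"
    by (simp add: b2_def c32_def c33_def c22_def)
  have forms: "{s00, s01, s02, s11, s12, s22} \<subseteq> forms 1"
    using B by (simp add: british_form_def)
  have forms_b: "b0 \<in> forms 1" "b2 \<in> forms 1"
    unfolding b0_def b2_def using forms by (simp_all add: forms_add forms_scale)
  have "british_form I s00 s01 s02 s11 s12 s22 b0 0 b2"
    by (rule british_formI[OF B _ british_gens_normalize_square[OF s11 a0 a1' a2 b0 refl b2]
          british_gens_normalize_square_converse[OF s11 a0 a1' a2 b0 refl b2]])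
      (use forms forms_b in simp)
  then have I: "I = ideal_mod.span (british_gens 0 s00 s01 s02 s11 s12 s22 b0 0 b2)"
    by (simp add: british_form_def)
  obtain e where e: "e \<noteq> 0" "1 + e * e * (c20 * c22 - c * c) \<noteq> 0"
    by (rule deformation_parameter[OF nz])
  \<comment> \<open>On \<open>S = v v^T\<close> the relation \<open>v0 b0 + v2 b2 = 0\<close> gives
    \<open>b0 = v2 w\<close>, \<open>b2 = - v0 w\<close>. Put
    \<open>X = c30 v0 + c31 v2 + c20 v1\<close> and \<open>Y = c32 v0 + c33 v2 + c22 v1\<close>.
    Then \<open>w - c v1 = v0 X / v2\<close> and \<open>w + c v1 = - v2 Y / v0\<close>, so
    \<open>w^2 = c^2 v1^2 - X Y\<close>. The new entry is \<open>v1^2 - e^2 w^2\<close>, written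
    linearly in the entries of \<open>S\<close>.\<close>
  define s11' where "s11' = s11 - const5 e * const5 e * (const5 c * const5 c * s11 - (const5 c30 * const5 c32 * s00
    + (const5 c30 * const5 c33 + const5 c31 * const5 c32) * s02 + const5 c31 * const5 c33 * s22
    + (const5 c30 * const5 c22 + const5 c20 * const5 c32) * s01 + (const5 c31 * const5 c22 + const5 c20 * const5 c33) * s12
    + const5 c20 * const5 c22 * s11))"
  have unit: "const5 (inverse (1 + e * e * (c20 * c22 - c * c))) * (1 + const5 e * const5 e * (const5 c20 * const5 c22 - const5 c * const5 c)) = 1"
    using const5_inverse_mult[OF e(2)] by simp
  have "ideal_mod.span (british_gens 1 s00 s01 s02 s11' s12 s22 (const5 e * b0) 0 (const5 e * b2)) = I"
    unfolding I
    by (rule span_eqI[OF british_gens_deform[OF s11 b0_def b2_def s11'_def]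
          british_gens_deform_converse[OF s11 b0_def b2_def s11'_def const5_inverse_mult[OF e(1)] unit]])
  moreover have "s11' \<in> forms 1"
  proof -
    have "s11' = s11 - const5 (e * e) * (const5 (c * c) * s11 - (const5 (c30 * c32) * s00
      + const5 (c30 * c33 + c31 * c32) * s02 + const5 (c31 * c33) * s22
      + const5 (c30 * c22 + c20 * c32) * s01 + const5 (c31 * c22 + c20 * c33) * s12
      + const5 (c20 * c22) * s11))"
      by (simp add: s11'_def)
    then show ?thesis
      using forms by (simp only: forms_add forms_diff forms_scale insert_subset)
  qed
  ultimately show ?thesis
    using forms forms_b
    by (intro scandinavian_form_of_square[OF nz(1) one_neq_zero, of s00 s01 s02 s11' s12 s22 "const5 e * b0" 0 "const5 e * b2"])
      (simp_all add: forms_scale)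
qed

text \<open>Completing the square in \<open>v1\<close> removes the terms \<open>v0 v1\<close> and
  \<open>v1 v2\<close> from the conic.\<close>

lemma scandinavian_square_coefficient:
  fixes I :: "'k::field poly5 set"
  assumes nz: "(2 :: 'k) \<noteq> 0" "(3 :: 'k) \<noteq> 0"
    and B: "british_form I s00 s01 s02 s11 s12 s22 a0 a1 a2"
    and a: "{a0, a1, a2} \<subseteq> entry_span s00 s01 s02 s11 s12 s22"
    and rel: "const5 q00 * s00 + const5 q01 * s01 + const5 q02 * s02 + const5 q11 * s11 + const5 q12 * s12 + const5 q22 * s22 = 0"
    and q11: "q11 \<noteq> 0"
  shows "scandinavian_form I"
proof -
  define \<alpha> \<beta> where "\<alpha> = q01 / (2 * q11)" and "\<beta> = q12 / (2 * q11)"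
  note B' = british_T12[OF british_T10[OF B, of \<alpha>], of \<beta>]
  note span = order_trans[OF entry_span_T10[of s00 s01 s02 s11 s12 s22 \<alpha>] entry_span_T12[where k = \<beta>]]
  show ?thesis
  proof (rule scandinavian_square[OF nz B'])
    have coeffs: "2 * \<alpha> = inverse q11 * q01" "2 * \<beta> = inverse q11 * q12"
      using nz(1) q11 by (simp_all add: \<alpha>_def \<beta>_def field_simps)
    have "const5 (inverse q11) * (const5 q00 * s00 + const5 q01 * s01 + const5 q02 * s02 + const5 q11 * s11 + const5 q12 * s12 + const5 q22 * s22) = 0"
      by (simp add: rel)
    then have "const5 (inverse q11 * q00) * s00 + const5 (2 * \<alpha>) * s01 + const5 (inverse q11 * q02) * s02 + s11
      + const5 (2 * \<beta>) * s12 + const5 (inverse q11 * q22) * s22 = 0"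
      unfolding coeffs using const5_inverse_mult[OF q11] by (simp add: distrib_left mult.assoc[symmetric])
    then have s11: "s11 = - const5 (inverse q11 * q00) * s00 - const5 (2 * \<alpha>) * s01 - const5 (inverse q11 * q02) * s02
      - const5 (2 * \<beta>) * s12 - const5 (inverse q11 * q22) * s22"
      by (simp add: algebra_simps add_eq_0_iff2)
    show "s11 + const5 (2 * \<alpha>) * s01 + const5 (\<alpha> * \<alpha>) * s00 + const5 (2 * \<beta>) * (s12 + const5 \<alpha> * s02) + const5 (\<beta> * \<beta>) * s22
      = const5 (\<alpha> * \<alpha> - inverse q11 * q00) * s00 + const5 (2 * \<alpha> * \<beta> - inverse q11 * q02) * s02 + const5 (\<beta> * \<beta> - inverse q11 * q22) * s22"
      unfolding s11 by (simp add: algebra_simps)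
    show "{a0 - const5 \<alpha> * a1, a1, a2 - const5 \<beta> * a1} \<subseteq> entry_span s00 (s01 + const5 \<alpha> * s00 + const5 \<beta> * s02) s02
      (s11 + const5 (2 * \<alpha>) * s01 + const5 (\<alpha> * \<alpha>) * s00 + const5 (2 * \<beta>) * (s12 + const5 \<alpha> * s02) + const5 (\<beta> * \<beta>) * s22)
      (s12 + const5 \<alpha> * s02 + const5 \<beta> * s22) s22"
      using a span by (simp only: insert_subset empty_subsetI simp_thms) (blast intro: entry_span_diff entry_span_scale)
  qed
qed

text \<open>Six linear forms in five variables satisfy a relation. As the whole of \<open>a\<close>
  is in the span, all base changes are allowed, so a nonzero diagonal coefficient can be
  arranged.\<close>

lemma scandinavian_span_entries:
  fixes I :: "'k::field poly5 set"
  assumes nz: "(2 :: 'k) \<noteq> 0" "(3 :: 'k) \<noteq> 0"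
    and B: "british_form I s00 s01 s02 s11 s12 s22 a0 a1 a2"
    and a: "{a0, a1, a2} \<subseteq> entry_span s00 s01 s02 s11 s12 s22"
  shows "scandinavian_form I"
proof -
  have diagonal: "scandinavian_form I"
    if B: "british_form I s00 s01 s02 s11 s12 s22 a0 a1 a2"
      and a: "{a0, a1, a2} \<subseteq> entry_span s00 s01 s02 s11 s12 s22"
      and rel: "const5 q00 * s00 + const5 q01 * s01 + const5 q02 * s02 + const5 q11 * s11 + const5 q12 * s12 + const5 q22 * s22 = 0"
      and q: "q00 \<noteq> 0 \<or> q11 \<noteq> 0 \<or> q22 \<noteq> 0"
    for s00 s01 s02 s11 s12 s22 a0 a1 a2 q00 q01 q02 q11 q12 q22
  proof -
    consider "q11 \<noteq> 0" | "q00 \<noteq> 0" | "q22 \<noteq> 0" using q by blast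
    then show ?thesis
    proof cases
      case 1
      then show ?thesis by (rule scandinavian_square_coefficient[OF nz B a rel])
    next
      case 2
      have "const5 q11 * s11 + const5 q01 * s01 + const5 q12 * s12 + const5 q00 * s00 + const5 q02 * s02 + const5 q22 * s22 = 0"
        using rel by (simp add: add_ac)
      from scandinavian_square_coefficient[OF nz british_swap01[OF B] _ this 2] show ?thesis
        using a by (simp add: entry_span_swap01[of s11])
    next
      case 3
      have "const5 q00 * s00 + const5 q02 * s02 + const5 q01 * s01 + const5 q22 * s22 + const5 q12 * s12 + const5 q11 * s11 = 0"
        using rel by (simp add: add_ac)
      from scandinavian_square_coefficient[OF nz british_swap12[OF B] _ this 3] show ?thesis
        using a by (simp add: entry_span_swap12)
    qed
  qed
  \<comment> \<open>Adding row and column 1 to row and column 0 rewrites \<open>q01 v0 v1\<close> so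
    that the coefficient \<open>- q01\<close> appears at the diagonal entry
    \<open>s11\<close>.\<close>
  have off_diagonal: "scandinavian_form I"
    if B: "british_form I s00 s01 s02 s11 s12 s22 a0 a1 a2"
      and a: "{a0, a1, a2} \<subseteq> entry_span s00 s01 s02 s11 s12 s22"
      and rel: "const5 q01 * s01 + const5 q02 * s02 + const5 q12 * s12 = 0"
      and q: "q01 \<noteq> 0"
    for s00 s01 s02 s11 s12 s22 a0 a1 a2 q01 q02 q12
  proof (rule diagonal[OF british_T01[OF B, of 1]])
    show "{a0, a1 - const5 1 * a0, a2} \<subseteq> entry_span (s00 + const5 (2 * 1) * s01 + const5 (1 * 1) * s11) (s01 + const5 1 * s11)
      (s02 + const5 1 * s12) s11 s12 s22"
      using a entry_span_T01[of s00 s01 s02 s11 s12 s22 1]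
      by (simp only: insert_subset empty_subsetI simp_thms) (blast intro: entry_span_diff entry_span_scale)
    have "const5 0 * (s00 + const5 (2 * 1) * s01 + const5 (1 * 1) * s11) + const5 q01 * (s01 + const5 1 * s11) + const5 q02 * (s02 + const5 1 * s12)
      + const5 (- q01) * s11 + const5 (q12 - q02) * s12 + const5 0 * s22 = const5 q01 * s01 + const5 q02 * s02 + const5 q12 * s12"
      by (simp add: algebra_simps)
    then show "const5 0 * (s00 + const5 (2 * 1) * s01 + const5 (1 * 1) * s11) + const5 q01 * (s01 + const5 1 * s11) + const5 q02 * (s02 + const5 1 * s12)
      + const5 (- q01) * s11 + const5 (q12 - q02) * s12 + const5 0 * s22 = 0"
      unfolding rel .
  qed (use q in simp)
  define f where "f = (\<lambda>i::nat. [s00, s01, s02, s11, s12, s22] ! i)"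
  have "f i \<in> forms 1" if "i < 6" for i
  proof -
    have "f i \<in> set [s00, s01, s02, s11, s12, s22]"
      unfolding f_def by (rule nth_mem) (use that in simp)
    then show ?thesis using B by (auto simp: british_form_def)
  qed
  then obtain c where c: "\<exists>i<6. c i \<noteq> 0" "(\<Sum>i<6. const5 (c i) * f i) = 0"
    by (rule six_linear_forms_dependent)
  have rel: "const5 (c 0) * s00 + const5 (c 1) * s01 + const5 (c 2) * s02 + const5 (c 3) * s11 + const5 (c 4) * s12 + const5 (c 5) * s22 = 0"
    using c(2) by (simp add: f_def eval_nat_numeral)
  show ?thesis
  proof (cases "c 0 \<noteq> 0 \<or> c 3 \<noteq> 0 \<or> c 5 \<noteq> 0")
    case True
    then show ?thesis by (rule diagonal[OF B a rel])
  next
    case False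
    then have rel': "const5 (c 1) * s01 + const5 (c 2) * s02 + const5 (c 4) * s12 = 0"
      using rel by simp
    have "c 1 \<noteq> 0 \<or> c 2 \<noteq> 0 \<or> c 4 \<noteq> 0"
      using c(1) False by (auto simp: eval_nat_numeral less_Suc_eq)
    then consider "c 1 \<noteq> 0" | "c 2 \<noteq> 0" | "c 4 \<noteq> 0" by blast
    then show ?thesis
    proof cases
      case 1
      then show ?thesis by (rule off_diagonal[OF B a rel'])
    next
      case 2
      have "const5 (c 2) * s02 + const5 (c 1) * s01 + const5 (c 4) * s12 = 0"
        using rel' by (simp add: add_ac)
      from off_diagonal[OF british_swap12[OF B] _ this 2] show ?thesis
        using a by (simp add: entry_span_swap12)
    next
      case 3
      have "const5 (c 4) * s12 + const5 (c 1) * s01 + const5 (c 2) * s02 = 0"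
        using rel' by (simp add: add_ac)
      from off_diagonal[OF british_swap12[OF british_swap01[OF B]] _ this 3] show ?thesis
        using a by (simp add: entry_span_swap12 entry_span_swap01[of s11])
    qed
  qed
qed

section \<open>The form \<open>a0\<close> is free: a conic with two distinct points on
  \<open>v0 = 0\<close>\<close>

lemma scandinavian_product:
  fixes I :: "'k::field poly5 set"
  assumes nz: "(2 :: 'k) \<noteq> 0" "(3 :: 'k) \<noteq> 0"
    and B: "british_form I s00 s01 s02 s11 s12 s22 a0 a1 a2"
    and s12: "s12 = const5 h * s00"
    and a: "{a1, a2} \<subseteq> entry_span s00 s01 s02 s11 s12 s22"
  shows "scandinavian_form I"
proof -
  have reduce: "\<exists>t0 t1 t2 t3 t4. x = const5 t0 * s00 + const5 t1 * s01 + const5 t2 * s02 + const5 t3 * s11 + const5 t4 * s22"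
    if mem: "x \<in> entry_span s00 s01 s02 s11 s12 s22" for x
  proof -
    obtain c00 c01 c02 c11 c12 c22 where
      "x = const5 c00 * s00 + const5 c01 * s01 + const5 c02 * s02 + const5 c11 * s11 + const5 c12 * s12 + const5 c22 * s22"
      by (rule entry_spanE[OF mem])
    then have "x = const5 (c00 + c12 * h) * s00 + const5 c01 * s01 + const5 c02 * s02 + const5 c11 * s11 + const5 c22 * s22"
      by (simp add: s12 algebra_simps)
    then show ?thesis by (intro exI)
  qed
  obtain t10 t11 t12 t13 t14 where a1: "a1 = const5 t10 * s00 + const5 t11 * s01 + const5 t12 * s02 + const5 t13 * s11 + const5 t14 * s22"
    using reduce[of a1] a by auto
  obtain t20 t21 t22 t23 t24 where a2: "a2 = const5 t20 * s00 + const5 t21 * s01 + const5 t22 * s02 + const5 t23 * s11 + const5 t24 * s22"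
    using reduce[of a2] a by auto
  define b0 where "b0 = a0 + const5 t10 * s01 + const5 t11 * s11 + const5 t12 * const5 h * s00 + const5 t14 * const5 h * s02 + const5 t20 * s02
    + const5 t21 * const5 h * s00 + const5 t22 * s22 + const5 t23 * const5 h * s01"
  have forms: "{s00, s01, s02, s11, s12, s22, a0} \<subseteq> forms 1"
    using B by (simp add: british_form_def)
  have forms_b: "b0 \<in> forms 1"
    unfolding b0_def mult.assoc using forms by (simp add: forms_add forms_scale)
  define x where "x = - b0"
  have "british_form I s00 s01 s02 s11 s12 s22 b0 (const5 t13 * s11) (const5 t24 * s22)"
    by (rule british_formI[OF B _ british_gens_normalize_product[OF s12 a1 a2 b0_def refl refl]
          british_gens_normalize_product_converse[OF s12 a1 a2 b0_def refl refl]])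
      (use forms forms_b in \<open>simp add: forms_scale\<close>)
  then have I: "I = ideal_mod.span (british_gens 0 s00 s01 s02 s11 (const5 h * s00) s22 (- x) (const5 t13 * s11) (const5 t24 * s22))"
    by (simp add: british_form_def s12 x_def)
  obtain e where e: "e \<noteq> 0" "1 + e * e * (- (t13 * t24 * h)) \<noteq> 0"
    by (rule deformation_parameter[OF nz])
  have "1 + e * e * (- (t13 * t24 * h)) = 1 - t13 * t24 * e * e * h"
    by (simp add: mult_ac)
  from e(2)[unfolded this] have unit: "const5 (inverse (1 - t13 * t24 * e * e * h)) * (1 - const5 t13 * const5 t24 * const5 e * const5 e * const5 h) = 1"
    using const5_inverse_mult[of "1 - t13 * t24 * e * e * h"] by simp
  \<comment> \<open>On the curve this matrix is the product of the column
    \<open>(v0, v1 + e c2 v2^2 / v0, v2)\<close> and the row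
    \<open>(v0, v1, v2 + e c1 v1^2 / v0)\<close>, with \<open>c1 = t13\<close> and
    \<open>c2 = t24\<close>. The relations \<open>v1 v2 = h v0^2\<close> and
    \<open>x v0 = c1 v1^3 + c2 v2^3\<close> make its entries linear in those of \<open>S\<close> and
    in \<open>x\<close>.\<close>
  let ?m02 = "s02 + const5 e * const5 t13 * s11" and ?m10 = "s01 + const5 e * const5 t24 * s22"
    and ?m11 = "s11 + const5 e * const5 t24 * const5 h * s02"
    and ?m12 = "const5 h * s00 + const5 e * x + const5 e * const5 e * const5 t13 * const5 t24 * const5 h * const5 h * s00"
    and ?m22 = "s22 + const5 e * const5 t13 * const5 h * s01"
  have "I = ideal_mod.span (minors3 s00 s01 ?m02 ?m10 ?m11 ?m12 s02 (const5 h * s00) ?m22)"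
    unfolding I
    by (rule span_eqI[OF minors3_product_form_converse[OF const5_inverse_mult[OF e(1)] unit] minors3_product_form])
  moreover have "{s00, s01, ?m02, ?m10, ?m11, ?m12, s02, const5 h * s00, ?m22} \<subseteq> forms 1"
    unfolding mult.assoc using forms forms_b by (simp add: x_def forms_add forms_diff forms_scale forms_uminus)
  ultimately show ?thesis
    unfolding scandinavian_form_def by (intro exI conjI)
qed

text \<open>Translating \<open>v1\<close> and \<open>v2\<close> by multiples of \<open>v0\<close>
  absorbs the terms \<open>v0 v2\<close> and \<open>v0 v1\<close>, so the conic becomes
  \<open>v1 v2 = h v0^2\<close>.\<close>

lemma scandinavian_product_coefficient:
  fixes I :: "'k::field poly5 set"
  assumes nz: "(2 :: 'k) \<noteq> 0" "(3 :: 'k) \<noteq> 0"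
    and B: "british_form I s00 s01 s02 s11 s12 s22 a0 a1 a2"
    and a: "{a1, a2} \<subseteq> entry_span s00 s01 s02 s11 s12 s22"
    and rel: "const5 q00 * s00 + const5 q01 * s01 + const5 q02 * s02 + const5 q12 * s12 = 0"
    and q12: "q12 \<noteq> 0"
  shows "scandinavian_form I"
proof -
  define \<alpha> \<beta> where "\<alpha> = inverse q12 * q02" and "\<beta> = inverse q12 * q01"
  note B' = british_T20[OF british_T10[OF B, of \<alpha>], of \<beta>]
  note span = order_trans[OF entry_span_T10[of s00 s01 s02 s11 s12 s22 \<alpha>] entry_span_T20[where k = \<beta>]]
  show ?thesis
  proof (rule scandinavian_product[OF nz B'])
    have "const5 (inverse q12) * (const5 q00 * s00 + const5 q01 * s01 + const5 q02 * s02 + const5 q12 * s12) = 0"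
      by (simp add: rel)
    then have eq: "const5 (inverse q12 * q00) * s00 + const5 \<beta> * s01 + const5 \<alpha> * s02 + s12 = 0"
      unfolding \<alpha>_def \<beta>_def using const5_inverse_mult[OF q12] by (simp add: distrib_left mult.assoc[symmetric])
    have "s12 = (const5 (inverse q12 * q00) * s00 + const5 \<beta> * s01 + const5 \<alpha> * s02 + s12)
      - const5 (inverse q12 * q00) * s00 - const5 \<beta> * s01 - const5 \<alpha> * s02"
      by simp
    then have s12: "s12 = - const5 (inverse q12 * q00) * s00 - const5 \<beta> * s01 - const5 \<alpha> * s02"
      unfolding eq by simp
    show "s12 + const5 \<alpha> * s02 + const5 \<beta> * (s01 + const5 \<alpha> * s00) = const5 (\<alpha> * \<beta> - inverse q12 * q00) * s00"
      unfolding s12 by (simp add: algebra_simps)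
    show "{a1, a2} \<subseteq> entry_span s00 (s01 + const5 \<alpha> * s00) (s02 + const5 \<beta> * s00) (s11 + const5 (2 * \<alpha>) * s01 + const5 (\<alpha> * \<alpha>) * s00)
      (s12 + const5 \<alpha> * s02 + const5 \<beta> * (s01 + const5 \<alpha> * s00)) (s22 + const5 (2 * \<beta>) * s02 + const5 (\<beta> * \<beta>) * s00)"
      by (rule order_trans[OF a span])
  qed
qed

lemma quadratic_root:
  fixes a b c :: "'k::alg_closed_field"
  assumes "a \<noteq> 0"
  obtains x where "a * x * x + b * x + c = 0"
proof -
  obtain x where "(\<Sum>k\<le>2. [c, b, a] ! k * x ^ k) = 0"
    using alg_closed[of 2 "\<lambda>k. [c, b, a] ! k"] assms by auto
  then have "a * x * x + b * x + c = 0"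
    by (simp add: eval_nat_numeral algebra_simps)
  then show ?thesis by (rule that)
qed

text \<open>On \<open>v0 = 0\<close> the conic restricts to a binary quadratic form in
  \<open>v1, v2\<close>; nonzero discriminant means two distinct factors, which are made the new
  coordinates. Only rows 1 and 2 are mixed for this, so \<open>a0\<close> is untouched.\<close>

lemma scandinavian_discriminant:
  fixes I :: "'k::alg_closed_field poly5 set"
  assumes nz: "(2 :: 'k) \<noteq> 0" "(3 :: 'k) \<noteq> 0"
    and B: "british_form I s00 s01 s02 s11 s12 s22 a0 a1 a2"
    and a: "{a1, a2} \<subseteq> entry_span s00 s01 s02 s11 s12 s22"
    and rel: "const5 q00 * s00 + const5 q01 * s01 + const5 q02 * s02 + const5 q11 * s11 + const5 q12 * s12 + const5 q22 * s22 = 0"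
    and disc: "q12 * q12 \<noteq> 4 * q11 * q22"
  shows "scandinavian_form I"
proof -
  have main: "scandinavian_form I"
    if B: "british_form I s00 s01 s02 s11 s12 s22 a0 a1 a2"
      and a: "{a1, a2} \<subseteq> entry_span s00 s01 s02 s11 s12 s22"
      and rel: "const5 q00 * s00 + const5 q01 * s01 + const5 q02 * s02 + const5 q11 * s11 + const5 q12 * s12 + const5 q22 * s22 = 0"
      and disc: "q12 * q12 \<noteq> 4 * q11 * q22" and q11: "q11 \<noteq> 0"
    for s00 s01 s02 s11 s12 s22 a0 a1 a2 q00 q01 q02 q11 q12 q22
  proof -
    \<comment> \<open>With \<open>v1 - \<rho> v2\<close> as new \<open>v1\<close>, the root removes
      \<open>v2^2\<close> from the form. The mixed coefficient becomes \<open>q12'\<close>, whose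
      square is the discriminant.\<close>
    obtain \<rho> where \<rho>: "q11 * \<rho> * \<rho> + q12 * \<rho> + q22 = 0"
      by (rule quadratic_root[OF q11])
    define q12' where "q12' = 2 * q11 * \<rho> + q12"
    have "q12' * q12' = 4 * q11 * (q11 * \<rho> * \<rho> + q12 * \<rho> + q22) + (q12 * q12 - 4 * q11 * q22)"
      by (simp add: q12'_def algebra_simps)
    then have q12': "q12' \<noteq> 0" using \<rho> disc by auto
    \<comment> \<open>The remaining form \<open>v1 (q11 v1 + q12' v2)\<close> is
      \<open>q12' v1 (v2 + \<kappa> v1)\<close>, and the second factor becomes the new
      \<open>v2\<close>.\<close>
    define \<kappa> where "\<kappa> = inverse q12' * q11"
    have \<kappa>: "q12' * \<kappa> = q11" using q12' by (simp add: \<kappa>_def mult.assoc[symmetric])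
    note B' = british_T21[OF british_T12[OF B, of "- \<rho>"], of \<kappa>]
    note span = order_trans[OF entry_span_T12[of s00 s01 s02 s11 s12 s22 "- \<rho>"] entry_span_T21[where k = \<kappa>]]
    show ?thesis
    proof (rule scandinavian_product_coefficient[OF nz B' _ _ q12'])
      let ?s01 = "s01 + const5 (- \<rho>) * s02" and ?s11 = "s11 + const5 (2 * - \<rho>) * s12 + const5 (- \<rho> * - \<rho>) * s22"
        and ?s12 = "s12 + const5 (- \<rho>) * s22"
      have q22: "const5 q22 = - const5 (q11 * \<rho> * \<rho> + q12 * \<rho>)"
        using arg_cong[OF \<rho>, of const5] by (simp add: add_eq_0_iff2 add_eq_0_iff algebra_simps)
      have "const5 q00 * s00 + const5 (q01 - \<kappa> * (q02 + \<rho> * q01)) * ?s01 + const5 (q02 + \<rho> * q01) * (s02 + const5 \<kappa> * ?s01) + const5 q12' * (?s12 + const5 \<kappa> * ?s11)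
        = const5 q00 * s00 + const5 q01 * s01 + const5 q02 * s02 + const5 (q12' * \<kappa>) * ?s11 + const5 q12' * ?s12"
        by (simp add: algebra_simps)
      also have "\<dots> = const5 q00 * s00 + const5 q01 * s01 + const5 q02 * s02 + const5 q11 * s11 + const5 q12 * s12 + const5 q22 * s22"
        unfolding \<kappa> q22 by (simp add: q12'_def algebra_simps)
      finally show "const5 q00 * s00 + const5 (q01 - \<kappa> * (q02 + \<rho> * q01)) * ?s01 + const5 (q02 + \<rho> * q01) * (s02 + const5 \<kappa> * ?s01) + const5 q12' * (?s12 + const5 \<kappa> * ?s11) = 0"
        unfolding rel .
      show "{a1 - const5 \<kappa> * (a2 - const5 (- \<rho>) * a1), a2 - const5 (- \<rho>) * a1} \<subseteq>
        entry_span s00 ?s01 (s02 + const5 \<kappa> * ?s01) ?s11 (?s12 + const5 \<kappa> * ?s11) (s22 + const5 (2 * \<kappa>) * ?s12 + const5 (\<kappa> * \<kappa>) * ?s11)"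
        using a span by (simp only: insert_subset empty_subsetI simp_thms) (blast intro: entry_span_diff entry_span_scale)
    qed
  qed
  consider "q11 \<noteq> 0" | "q22 \<noteq> 0" | "q11 = 0" "q22 = 0" by blast
  then show ?thesis
  proof cases
    case 1
    then show ?thesis by (rule main[OF B a rel disc])
  next
    case 2
    have "const5 q00 * s00 + const5 q02 * s02 + const5 q01 * s01 + const5 q22 * s22 + const5 q12 * s12 + const5 q11 * s11 = 0"
      using rel by (simp add: add_ac)
    from main[OF british_swap12[OF B] _ this _ 2] show ?thesis
      using a disc by (simp add: entry_span_swap12 mult_ac)
  next
    case 3
    then show ?thesis
      using rel disc by (intro scandinavian_product_coefficient[OF nz B a, of q00 q01 q02 q12]) auto
  qed
qed

section \<open>The form \<open>a0\<close> is free: a conic tangent to \<open>v0 = 0\<close>\<close>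

lemma british_scale:
  assumes B: "british_form I s00 s01 s02 s11 s12 s22 a0 a1 a2" and c: "c \<noteq> 0"
  shows "british_form I s00 s01 s02 s11 s12 s22 (const5 c * a0) (const5 c * a1) (const5 c * a2)"
proof (rule british_formI[OF B _ british_gens_scale])
  have eq: "const5 (inverse c) * (const5 c * f) = f" for f
    using const5_inverse_mult[OF c] by (simp add: mult.assoc[symmetric])
  show "british_gens 0 s00 s01 s02 s11 s12 s22 a0 a1 a2 \<subseteq>
    ideal_mod.span (british_gens 0 s00 s01 s02 s11 s12 s22 (const5 c * a0) (const5 c * a1) (const5 c * a2))"
    using british_gens_scale[of s00 s01 s02 s11 s12 s22 "const5 (inverse c)" "const5 c * a0" "const5 c * a1" "const5 c * a2"]
    unfolding eq .
qed (use B in \<open>simp add: british_form_def forms_scale\<close>)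

text \<open>Where \<open>s00\<close> vanishes, \<open>S\<close> need not be a square \<open>v v\<^sup>T\<close> up to a unit. The presentation by
  \<open>(a0, s11, s01, s00)\<close> and \<open>(s12, s02)\<close>, which are \<open>1, t, t\<^sup>2, t\<^sup>3\<close> and \<open>w, t w\<close> in an affine chart
  around such a point, is of the first kind.\<close>

lemma scandinavian_reroot:
  fixes I :: "'k::field poly5 set"
  assumes nz: "(2 :: 'k) \<noteq> 0" "(3 :: 'k) \<noteq> 0"
    and B: "british_form I s00 s01 s02 s11 s12 s22 a0 (const5 c * s11) 0" and c: "c \<noteq> 0"
    and s22: "s22 = const5 l * s01" and s00: "l \<noteq> 0 \<or> s00 = const5 u * s01 + const5 v * s02"
  shows "scandinavian_form I"
proof -
  define x where "x = - (const5 (inverse c) * a0)"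
  have eq: "const5 (inverse c) * (const5 c * s11) = s11"
    using const5_inverse_mult[OF c] by (simp add: mult.assoc[symmetric])
  have B1: "british_form I s00 s01 s02 s11 s12 (const5 l * s01) (- x) s11 0"
    using british_scale[OF B, of "inverse c"] c unfolding eq x_def s22 by simp
  have B2: "british_form I x s11 s12 s01 s02 (const5 l * s00) s00 (- s01) 0"
    by (rule british_formI[OF B1 _ british_gens_reroot british_gens_reroot_converse])
      (use B1 forms_uminus[of "- x" 1] in \<open>simp add: british_form_def forms_scale forms_uminus\<close>)
  \<comment> \<open>In the new presentation the vector is \<open>(s00, - s01, 0)\<close>. Its first
    entry lies in the span of the new matrix entries through \<open>l s00\<close> or through the
    assumed expression, so the earlier case applies.\<close>
  show ?thesis
  proof (rule scandinavian_span_entries[OF nz B2], simp only: insert_subset empty_subsetI simp_thms, intro conjI)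
    show "s00 \<in> entry_span x s11 s12 s01 s02 (const5 l * s00)"
    proof (cases "l = 0")
      case True
      then show ?thesis
        using s00 by (intro entry_spanI[where ka = 0 and kb = 0 and kc = 0 and kd = u and ke = v and kf = 0]) simp
    next
      case False
      have "const5 (inverse l) * (const5 l * s00) = s00"
        using const5_inverse_mult[OF False] by (simp add: mult.assoc[symmetric])
      then show ?thesis
        by (intro entry_spanI[where ka = 0 and kb = 0 and kc = 0 and kd = 0 and ke = 0 and kf = "inverse l"]) simp
    qed
    show "- s01 \<in> entry_span x s11 s12 s01 s02 (const5 l * s00)"
      by (rule entry_spanI[where ka = 0 and kb = 0 and kc = 0 and kd = "- 1" and ke = 0 and kf = 0]) simp
    show "0 \<in> entry_span x s11 s12 s01 s02 (const5 l * s00)"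
      by (rule poly5.subspace_0[OF entry_span_subspace])
  qed
qed

lemma british_double_normalize:
  assumes B: "british_form I s00 s01 s02 s11 s12 s22 a0 a1 a2"
    and s22: "s22 = const5 l0 * s00 + const5 l1 * s01 + const5 l2 * s02"
    and a1: "a1 = const5 t10 * s00 + const5 t11 * s01 + const5 t12 * s02 + const5 t13 * s11 + const5 t14 * s12"
    and a2: "a2 = const5 t20 * s00 + const5 t21 * s01 + const5 t22 * s02 + const5 t23 * s11 + const5 t24 * s12"
  shows "\<exists>b0. british_form I s00 s01 s02 s11 s12 s22 b0 (const5 t13 * s11 + const5 (t14 + t23) * s12) 0"
proof -
  define b0 where "b0 = a0 + const5 t10 * s01 + const5 t11 * s11 + const5 t12 * s12 + const5 t20 * s02 + const5 t21 * s12
    + const5 t22 * s22 + const5 t24 * (const5 l0 * s01 + const5 l1 * s11 + const5 l2 * s12)"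
  have forms: "{s00, s01, s02, s11, s12, s22, a0} \<subseteq> forms 1"
    using B by (simp add: british_form_def)
  have forms_b: "b0 \<in> forms 1"
    unfolding b0_def using forms by (simp add: forms_add forms_scale)
  have b1: "const5 t13 * s11 + const5 (t14 + t23) * s12 = const5 t13 * s11 + (const5 t14 + const5 t23) * s12"
    by simp
  have "british_form I s00 s01 s02 s11 s12 s22 b0 (const5 t13 * s11 + const5 (t14 + t23) * s12) 0"
    by (rule british_formI[OF B _ british_gens_normalize_double[OF s22 a1 a2 b0_def b1 refl]
          british_gens_normalize_double_converse[OF s22 a1 a2 b0_def b1 refl]])
      (use forms forms_b in \<open>simp add: forms_add forms_scale del: const5_hom\<close>)
  then show ?thesis by (rule exI)
qed

text \<open>Shifts of \<open>v1\<close> and \<open>v2\<close> by multiples of \<open>v0\<close>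
  change \<open>c v1^3\<close> only by terms divisible by \<open>v0\<close>, which go into
  \<open>b0\<close>. The parameters remain free for simplifying the relation that expresses
  \<open>s22\<close>.\<close>

lemma british_double_shift:
  assumes B: "british_form I s00 s01 s02 s11 s12 s22 a0 (const5 c * s11) 0"
    and s22: "s22 = const5 l0 * s00 + const5 l1 * s01 + const5 l2 * s02"
  shows "\<exists>t11 t12 b0. british_form I s00 (s01 + const5 \<kappa> * s00) (s02 + const5 \<mu> * s00) t11 t12
    (const5 (l0 - l1 * \<kappa> - l2 * \<mu> - \<mu> * \<mu>) * s00 + const5 l1 * (s01 + const5 \<kappa> * s00) + const5 (l2 + 2 * \<mu>) * (s02 + const5 \<mu> * s00))
    b0 (const5 c * t11) 0"
proof -
  let ?s01 = "s01 + const5 \<kappa> * s00" and ?s11 = "s11 + const5 (2 * \<kappa>) * s01 + const5 (\<kappa> * \<kappa>) * s00"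
  note B' = british_T20[OF british_T10[OF B, of \<kappa>], of \<mu>]
  have s22': "s22 + const5 (2 * \<mu>) * s02 + const5 (\<mu> * \<mu>) * s00
    = const5 (l0 - l1 * \<kappa> - l2 * \<mu> - \<mu> * \<mu>) * s00 + const5 l1 * (s01 + const5 \<kappa> * s00) + const5 (l2 + 2 * \<mu>) * (s02 + const5 \<mu> * s00)"
    unfolding s22 by (simp add: algebra_simps)
  have a1: "const5 c * s11 = const5 (c * \<kappa> * \<kappa>) * s00 + const5 (- 2 * c * \<kappa>) * ?s01 + const5 0 * (s02 + const5 \<mu> * s00) + const5 c * ?s11
    + const5 0 * (s12 + const5 \<kappa> * s02 + const5 \<mu> * ?s01)"
    by (simp add: algebra_simps)
  have a2: "0 = const5 0 * s00 + const5 0 * ?s01 + const5 0 * (s02 + const5 \<mu> * s00) + const5 0 * ?s11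
    + const5 0 * (s12 + const5 \<kappa> * s02 + const5 \<mu> * ?s01)"
    by simp
  obtain b0 where "british_form I s00 ?s01 (s02 + const5 \<mu> * s00) ?s11 (s12 + const5 \<kappa> * s02 + const5 \<mu> * ?s01)
    (s22 + const5 (2 * \<mu>) * s02 + const5 (\<mu> * \<mu>) * s00) b0 (const5 c * ?s11 + const5 (0 + 0) * (s12 + const5 \<kappa> * s02 + const5 \<mu> * ?s01)) 0"
    using british_double_normalize[OF B' s22' a1 a2] by (elim exE)
  then have "british_form I s00 ?s01 (s02 + const5 \<mu> * s00) ?s11 (s12 + const5 \<kappa> * s02 + const5 \<mu> * ?s01)
    (const5 (l0 - l1 * \<kappa> - l2 * \<mu> - \<mu> * \<mu>) * s00 + const5 l1 * ?s01 + const5 (l2 + 2 * \<mu>) * (s02 + const5 \<mu> * s00)) b0 (const5 c * ?s11) 0"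
    unfolding s22' by (simp only: add_0 const5_hom(1) mult_zero_left add_0_right)
  then show ?thesis by (intro exI)
qed

context six_points
begin

lemma too_few_generators:
  assumes "I = ideal_mod.span (set xs)" "set xs \<subseteq> forms 2"
  shows "9 \<le> length xs"
  using generators_card[OF assms] card_length[of xs] by simp

lemma british_no_linear_relation:
  assumes B: "british_form I s00 s01 s02 s11 s12 s22 a0 a1 a2"
    and rel: "const5 k0 * (s01 * s12 - s02 * s11) + const5 k1 * (s01 * s02 - s00 * s12) + const5 k2 * (s00 * s11 - s01 * s01) = 0"
  shows "k0 = 0 \<and> k1 = 0 \<and> k2 = 0"
proof -
  let ?g00 = "s11 * s22 - s12 * s12" and ?g01 = "s12 * s02 - s01 * s22" and ?g02 = "s01 * s12 - s02 * s11"
    and ?g11 = "s00 * s22 - s02 * s02" and ?g12 = "s01 * s02 - s00 * s12" and ?g22 = "s00 * s11 - s01 * s01"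
    and ?r0 = "s00 * a0 + s01 * a1 + s02 * a2" and ?r1 = "s01 * a0 + s11 * a1 + s12 * a2" and ?r2 = "s02 * a0 + s12 * a1 + s22 * a2"
  have forms: "f \<in> forms 1" if "f \<in> {s00, s01, s02, s11, s12, s22, a0, a1, a2}" for f
    using B that unfolding british_form_def by blast
  have mult: "f * g \<in> forms 2" if "f \<in> {s00, s01, s02, s11, s12, s22, a0, a1, a2}" "g \<in> {s00, s01, s02, s11, s12, s22, a0, a1, a2}" for f g
    using forms_mult[OF forms[OF that(1)] forms[OF that(2)]] by (simp add: numeral_2_eq_2)
  have quadrics: "{?g00, ?g01, ?g02, ?g11, ?g12, ?g22, ?r0, ?r1, ?r2} \<subseteq> forms 2"
    by (simp only: insert_subset empty_subsetI simp_thms) (intro conjI forms_add forms_diff mult; simp)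
  have I: "I = ideal_mod.span (british_gens 0 s00 s01 s02 s11 s12 s22 a0 a1 a2)"
    using B by (simp add: british_form_def)
  have drop: False if "set xs \<subseteq> {?g00, ?g01, ?g02, ?g11, ?g12, ?g22, ?r0, ?r1, ?r2}" "length xs = 8"
    "{?g00, ?g01, ?g02, ?g11, ?g12, ?g22, ?r0, ?r1, ?r2} \<subseteq> ideal_mod.span (set xs)" for xs
  proof -
    have gens: "british_gens 0 s00 s01 s02 s11 s12 s22 a0 a1 a2 = {?g00, ?g01, ?g02, ?g11, ?g12, ?g22, ?r0, ?r1, ?r2}"
      by (simp only: british_gens_def mult_zero_left add_0_right)
    have "I = ideal_mod.span (set xs)"
      unfolding I gens
      by (rule span_eqI[OF that(3) order_trans[OF that(1) ideal_mod.span_superset]])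
    then show False
      using too_few_generators[of xs] that(1,2) quadrics by auto
  qed
  have solve: "x \<in> ideal_mod.span S" if "const5 k * x + const5 l * y + const5 m * z = 0" "y \<in> S" "z \<in> S" "k \<noteq> 0" for k l m :: 'k and x y z S
  proof -
    have "const5 k * x = (const5 k * x + const5 l * y + const5 m * z) - const5 l * y - const5 m * z" by simp
    then have "const5 k * x = 0 - const5 l * y - const5 m * z" unfolding that(1) .
    moreover have "0 - const5 l * y - const5 m * z \<in> ideal_mod.span S"
      by (intro ideal_mod.span_diff ideal_mod.span_zero ideal_mod.span_scale ideal_mod.span_base that)
    ultimately have "const5 k * x \<in> ideal_mod.span S" by simp
    then show ?thesis
      by (rule unit_mult_closed[OF ideal_mod.subspace_span _ const5_inverse_mult[OF that(4)]])
  qed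
  have "k0 = 0"
  proof (rule ccontr)
    assume nz: "k0 \<noteq> 0"
    let ?xs = "[?g12, ?g22, ?g00, ?g01, ?g11, ?r0, ?r1, ?r2]"
    have "?g02 \<in> ideal_mod.span (set ?xs)"
      by (rule solve[OF rel _ _ nz]) simp_all
    moreover have "set ?xs \<subseteq> ideal_mod.span (set ?xs)" by (rule ideal_mod.span_superset)
    ultimately show False by (intro drop[of ?xs]) simp_all
  qed
  moreover have "k1 = 0"
  proof (rule ccontr)
    assume nz: "k1 \<noteq> 0"
    let ?xs = "[?g02, ?g22, ?g00, ?g01, ?g11, ?r0, ?r1, ?r2]"
    have "const5 k1 * ?g12 + const5 k0 * ?g02 + const5 k2 * ?g22 = 0"
      using rel by (simp only: add_ac)
    then have "?g12 \<in> ideal_mod.span (set ?xs)"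
      by (rule solve[OF _ _ _ nz]) simp_all
    moreover have "set ?xs \<subseteq> ideal_mod.span (set ?xs)" by (rule ideal_mod.span_superset)
    ultimately show False by (intro drop[of ?xs]) simp_all
  qed
  moreover have "k2 = 0"
  proof (rule ccontr)
    assume nz: "k2 \<noteq> 0"
    let ?xs = "[?g02, ?g12, ?g00, ?g01, ?g11, ?r0, ?r1, ?r2]"
    have "const5 k2 * ?g22 + const5 k0 * ?g02 + const5 k1 * ?g12 = 0"
      using rel by (simp only: add_ac)
    then have "?g22 \<in> ideal_mod.span (set ?xs)"
      by (rule solve[OF _ _ _ nz]) simp_all
    moreover have "set ?xs \<subseteq> ideal_mod.span (set ?xs)" by (rule ideal_mod.span_superset)
    ultimately show False by (intro drop[of ?xs]) simp_all
  qed
  ultimately show ?thesis by blast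
qed

text \<open>By Binet-Cauchy, the cross product of the two coefficient vectors pairs with the minors
  of the first two rows to a determinant with vanishing first row. The minors are independent, so
  the cross product is zero.\<close>

lemma first_row_rank:
  assumes B: "british_form I s00 s01 s02 s11 s12 s22 a0 a1 a2"
    and l: "const5 l0 * s00 + const5 l1 * s01 + const5 l2 * s02 = 0"
    and m: "const5 m0 * s00 + const5 m1 * s01 + const5 m2 * s02 = 0"
  shows "l1 * m2 = l2 * m1 \<and> l2 * m0 = l0 * m2 \<and> l0 * m1 = l1 * m0"
proof -
  have "const5 (l1 * m2 - l2 * m1) * (s01 * s12 - s02 * s11) + const5 (l2 * m0 - l0 * m2) * (s01 * s02 - s00 * s12)
    + const5 (l0 * m1 - l1 * m0) * (s00 * s11 - s01 * s01)
    = (const5 l0 * s00 + const5 l1 * s01 + const5 l2 * s02) * (const5 m0 * s01 + const5 m1 * s11 + const5 m2 * s12)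
    - (const5 l0 * s01 + const5 l1 * s11 + const5 l2 * s12) * (const5 m0 * s00 + const5 m1 * s01 + const5 m2 * s02)"
    by (simp add: algebra_simps)
  also have "\<dots> = 0" unfolding l m by simp
  finally show ?thesis
    using british_no_linear_relation[OF B] by fastforce
qed

text \<open>For \<open>c = 0\<close> all generators would lie in the ideal of \<open>s12\<close> and
  two entries of the first row, the third being dependent on them; three linear forms are too
  few.\<close>

lemma double_leading_coefficient:
  assumes B: "british_form I s00 s01 s02 s11 s12 s22 a0 (const5 c * s11 + const5 d * s12) 0"
    and s22: "s22 = const5 l0 * s00 + const5 l1 * s01 + const5 l2 * s02"
    and rel: "const5 m0 * s00 + const5 m1 * s01 + const5 m2 * s02 = 0"
    and m: "m0 \<noteq> 0 \<or> m1 \<noteq> 0 \<or> m2 \<noteq> 0"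
  shows "c \<noteq> 0"
proof
  assume c: "c = 0"
  have contr: False
    if "{s00, s01, s02} \<subseteq> ideal_mod.span {y, z, s12}" "y \<in> forms 1" "z \<in> forms 1" for y z
  proof -
    let ?J = "ideal_mod.span {y, z, s12}"
    have J: "ideal_mod.subspace ?J" by (rule ideal_mod.subspace_span)
    have l: "f * g \<in> ?J" if "f \<in> ?J" for f g
      using ideal_mod.subspace_scale[OF J that, of g] by (simp add: mult.commute)
    have r: "f * g \<in> ?J" if "g \<in> ?J" for f g
      by (rule ideal_mod.subspace_scale[OF J that])
    have s0: "s00 \<in> ?J" "s01 \<in> ?J" "s02 \<in> ?J" using that(1) by simp_all
    have s12: "s12 \<in> ?J" by (rule ideal_mod.span_base) simp
    have s22': "s22 \<in> ?J"
      unfolding s22 by (intro ideal_mod.subspace_add[OF J] r s0)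
    have a1: "const5 c * s11 + const5 d * s12 \<in> ?J"
      unfolding c using r[OF s12] by simp
    have zero: "0 \<in> ?J" by (rule ideal_mod.subspace_0[OF J])
    have "british_gens 0 s00 s01 s02 s11 s12 s22 a0 (const5 c * s11 + const5 d * s12) 0 \<subseteq> ?J"
      unfolding british_gens_0_subset_iff
      by (intro conjI ideal_mod.subspace_add[OF J] ideal_mod.subspace_diff[OF J])
        (rule l, rule s0 s12 s22' | rule r, rule s12 s22' a1 zero)+
    then have "I \<subseteq> ?J"
      using B ideal_mod.span_minimal[OF _ J] by (simp add: british_form_def)
    moreover have "s12 \<in> forms 1" using B by (simp add: british_form_def)
    ultimately show False
      using not_in_three_forms[OF that(2,3)] by blast
  qed
  have solve: "x \<in> ideal_mod.span {y, z, s12}" if "const5 k * x + const5 l * y + const5 m * z = 0" "k \<noteq> 0" for k l m :: 'k and x y z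
  proof -
    have "const5 k * x = (const5 k * x + const5 l * y + const5 m * z) - const5 l * y - const5 m * z" by simp
    then have "const5 k * x = 0 - const5 l * y - const5 m * z" unfolding that(1) .
    moreover have "0 - const5 l * y - const5 m * z \<in> ideal_mod.span {y, z, s12}"
      by (intro ideal_mod.span_diff ideal_mod.span_zero ideal_mod.span_scale ideal_mod.span_base) simp_all
    ultimately have "const5 k * x \<in> ideal_mod.span {y, z, s12}" by simp
    then show ?thesis
      by (rule unit_mult_closed[OF ideal_mod.subspace_span _ const5_inverse_mult[OF that(2)]])
  qed
  have forms: "s00 \<in> forms 1" "s01 \<in> forms 1" "s02 \<in> forms 1"
    using B by (simp_all add: british_form_def)
  from m show False
  proof (elim disjE)
    assume "m0 \<noteq> 0"
    from solve[OF rel this] show False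
      by (intro contr[of s01 s02] forms) (simp add: ideal_mod.span_base)
  next
    assume nz: "m1 \<noteq> 0"
    have "const5 m1 * s01 + const5 m0 * s00 + const5 m2 * s02 = 0"
      using rel by (simp only: add_ac)
    from solve[OF this nz] show False
      by (intro contr[of s00 s02] forms) (simp add: ideal_mod.span_base)
  next
    assume nz: "m2 \<noteq> 0"
    have "const5 m2 * s02 + const5 m0 * s00 + const5 m1 * s01 = 0"
      using rel by (simp only: add_ac)
    from solve[OF this nz] show False
      by (intro contr[of s00 s01] forms) (simp add: ideal_mod.span_base)
  qed
qed

text \<open>The relation for \<open>s22\<close> may be altered by multiples of \<open>rel\<close>
  and by shifts of \<open>v1\<close> and \<open>v2\<close>. The aim is one of the two shapes needed
  for rerooting: \<open>s22 = l s01\<close> with \<open>l\<close> nonzero, or \<open>s22 = 0\<close>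
  with \<open>s00\<close> a combination of \<open>s01\<close> and \<open>s02\<close>.\<close>

lemma scandinavian_double_reduced:
  assumes nz: "(2 :: 'k) \<noteq> 0" "(3 :: 'k) \<noteq> 0"
    and B: "british_form I s00 s01 s02 s11 s12 s22 a0 (const5 c * s11) 0" and c: "c \<noteq> 0"
    and s22: "s22 = const5 l0 * s00 + const5 l1 * s01 + const5 l2 * s02"
    and rel: "const5 m0 * s00 + const5 m1 * s01 + const5 m2 * s02 = 0"
    and m: "m0 \<noteq> 0 \<or> m1 \<noteq> 0 \<or> m2 \<noteq> 0"
  shows "scandinavian_form I"
proof -
  have s22_add: "s22 = const5 (l0 + \<tau> * m0) * s00 + const5 (l1 + \<tau> * m1) * s01 + const5 (l2 + \<tau> * m2) * s02" for \<tau>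
  proof -
    have "const5 (l0 + \<tau> * m0) * s00 + const5 (l1 + \<tau> * m1) * s01 + const5 (l2 + \<tau> * m2) * s02
      = s22 + const5 \<tau> * (const5 m0 * s00 + const5 m1 * s01 + const5 m2 * s02)"
      by (simp add: s22 algebra_simps)
    then show ?thesis unfolding rel by simp
  qed
  show ?thesis
  proof (cases "l1 = 0 \<and> m1 = 0")
    case False
    \<comment> \<open>The multiple of \<open>rel\<close> makes the coefficient \<open>l\<close> of
      \<open>s01\<close> nonzero. Then \<open>\<mu>\<close> removes the term in \<open>s02\<close>
      and \<open>\<kappa>\<close> the term in \<open>s00\<close>.\<close>
    define \<tau> where "\<tau> = (if l1 = 0 then 1 else 0 :: 'k)"
    define l where "l = l1 + \<tau> * m1"
    have l: "l \<noteq> 0" using False by (auto simp: l_def \<tau>_def)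
    define \<mu> where "\<mu> = - (inverse 2 * (l2 + \<tau> * m2))"
    have \<mu>: "l2 + \<tau> * m2 + 2 * \<mu> = 0"
      unfolding \<mu>_def using nz(1) by (simp add: mult.assoc[symmetric])
    define \<kappa> where "\<kappa> = inverse l * (l0 + \<tau> * m0 - (l2 + \<tau> * m2) * \<mu> - \<mu> * \<mu>)"
    have "l * \<kappa> = l0 + \<tau> * m0 - (l2 + \<tau> * m2) * \<mu> - \<mu> * \<mu>"
      unfolding \<kappa>_def using l by (simp add: mult.assoc[symmetric])
    then have \<kappa>: "l0 + \<tau> * m0 - l * \<kappa> - (l2 + \<tau> * m2) * \<mu> - \<mu> * \<mu> = 0" by simp
    obtain t11 t12 b0 where B': "british_form I s00 (s01 + const5 \<kappa> * s00) (s02 + const5 \<mu> * s00) t11 t12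
      (const5 0 * s00 + const5 l * (s01 + const5 \<kappa> * s00) + const5 0 * (s02 + const5 \<mu> * s00)) b0 (const5 c * t11) 0"
      using british_double_shift[OF B s22_add[of \<tau>], of \<kappa> \<mu>] unfolding \<kappa>[unfolded l_def] \<mu> l_def[symmetric] \<kappa> by (elim exE)
    show ?thesis
      by (rule scandinavian_reroot[OF nz B' c, of l]) (simp_all add: l)
  next
    case True
    \<comment> \<open>Without terms in \<open>s01\<close>, both remaining coefficients of
      \<open>s22\<close> must be made zero. Eliminating \<open>\<tau>\<close> leaves a quadratic
      equation for \<open>\<mu>\<close> when \<open>m2\<close> is nonzero; otherwise
      \<open>m0\<close> is nonzero and each unknown is solved for directly.\<close>
    have "\<exists>\<tau> \<mu>. l2 + \<tau> * m2 + 2 * \<mu> = 0 \<and> l0 + \<tau> * m0 + \<mu> * \<mu> = 0"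
    proof (cases "m2 = 0")
      case m2: True
      then have m0: "m0 \<noteq> 0" using m True by simp
      define \<mu> where "\<mu> = - (inverse 2 * l2)"
      have "l2 + 2 * \<mu> = 0"
        unfolding \<mu>_def using nz(1) by (simp add: mult.assoc[symmetric])
      moreover have "l0 + (- (inverse m0 * (l0 + \<mu> * \<mu>))) * m0 + \<mu> * \<mu> = 0"
        using m0 by (simp add: field_simps)
      ultimately show ?thesis
        using m2 by (intro exI[of _ "- (inverse m0 * (l0 + \<mu> * \<mu>))"] exI[of _ \<mu>]) simp
    next
      case False
      obtain \<mu> where \<mu>: "1 * \<mu> * \<mu> + (- (2 * inverse m2 * m0)) * \<mu> + (l0 - inverse m2 * l2 * m0) = 0"
        using quadratic_root[of 1 "- (2 * inverse m2 * m0)" "l0 - inverse m2 * l2 * m0"] by auto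
      define \<tau> where "\<tau> = - (inverse m2 * (l2 + 2 * \<mu>))"
      have "l2 + \<tau> * m2 + 2 * \<mu> = 0"
        using False by (simp add: \<tau>_def field_simps)
      moreover have "l0 + \<tau> * m0 + \<mu> * \<mu> = 1 * \<mu> * \<mu> + (- (2 * inverse m2 * m0)) * \<mu> + (l0 - inverse m2 * l2 * m0)"
        by (simp add: \<tau>_def algebra_simps)
      ultimately show ?thesis using \<mu> by metis
    qed
    then obtain \<tau> \<mu> where \<mu>: "l2 + \<tau> * m2 + 2 * \<mu> = 0" and \<tau>: "l0 + \<tau> * m0 + \<mu> * \<mu> = 0" by blast
    have l1: "l1 + \<tau> * m1 = 0" using True by simp
    have "l2 + \<tau> * m2 = - (2 * \<mu>)" using \<mu> by (simp add: eq_neg_iff_add_eq_0)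
    then have l0: "l0 + \<tau> * m0 - 0 * 0 - (l2 + \<tau> * m2) * \<mu> - \<mu> * \<mu> = 0"
      using \<tau> by (simp add: algebra_simps)
    let ?s02 = "s02 + const5 \<mu> * s00"
    obtain t11 t12 b0 where B': "british_form I s00 (s01 + const5 0 * s00) ?s02 t11 t12
      (const5 0 * s00 + const5 0 * (s01 + const5 0 * s00) + const5 0 * ?s02) b0 (const5 c * t11) 0"
      using british_double_shift[OF B s22_add[of \<tau>], of 0 \<mu>] unfolding \<mu> l1 l0 by (elim exE)
    have rel': "const5 (m0 - m2 * \<mu>) * s00 + const5 m2 * ?s02 = 0"
      using rel True by (simp add: algebra_simps)
    show ?thesis
    proof (cases "m0 - m2 * \<mu> = 0")
      case m0: True
      then have "m2 \<noteq> 0" using m True by auto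
      have "const5 m2 * ?s02 = 0" using rel' unfolding m0 by simp
      then have "const5 (inverse m2) * (const5 m2 * ?s02) = 0" by simp
      then have s02: "?s02 = 0"
        using const5_inverse_mult[OF \<open>m2 \<noteq> 0\<close>] by (simp add: mult.assoc[symmetric])
      \<comment> \<open>Now \<open>s02\<close> and \<open>s22\<close> are both zero, so the minor
        \<open>s00 s22 - s02^2\<close> vanishes identically. The swap moves it to the first two
        rows, where independence of the minors is known.\<close>
      have "british_form I s00 0 s01 0 t12 t11 b0 0 (const5 c * t11)"
        using british_swap12[OF B'] unfolding s02 by simp
      from british_no_linear_relation[OF this, of 0 0 1] show ?thesis by simp
    next
      case False
      have "const5 (inverse (m0 - m2 * \<mu>)) * (const5 (m0 - m2 * \<mu>) * s00 + const5 m2 * ?s02) = 0"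
        unfolding rel' by simp
      then have eq: "s00 + const5 (inverse (m0 - m2 * \<mu>) * m2) * ?s02 = 0"
        unfolding distrib_left mult.assoc[symmetric] const5_inverse_mult[OF False] by simp
      have "s00 = (s00 + const5 (inverse (m0 - m2 * \<mu>) * m2) * ?s02) + const5 0 * (s01 + const5 0 * s00)
        + const5 (- (inverse (m0 - m2 * \<mu>) * m2)) * ?s02"
        by (simp del: const5_hom(4))
      then have "s00 = const5 0 * (s01 + const5 0 * s00) + const5 (- (inverse (m0 - m2 * \<mu>) * m2)) * ?s02"
        unfolding eq by (simp del: const5_hom(4))
      then show ?thesis
        by (intro scandinavian_reroot[OF nz B' c, of 0]) (simp, rule disjI2)
    qed
  qed
qed

lemma scandinavian_double:
  assumes nz: "(2 :: 'k) \<noteq> 0" "(3 :: 'k) \<noteq> 0"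
    and B: "british_form I s00 s01 s02 s11 s12 s22 a0 a1 a2"
    and a: "{a1, a2} \<subseteq> entry_span s00 s01 s02 s11 s12 s22"
    and s22: "s22 = const5 l0 * s00 + const5 l1 * s01 + const5 l2 * s02"
    and rel: "const5 m0 * s00 + const5 m1 * s01 + const5 m2 * s02 = 0"
    and m: "m0 \<noteq> 0 \<or> m1 \<noteq> 0 \<or> m2 \<noteq> 0"
  shows "scandinavian_form I"
proof -
  have reduce: "\<exists>t0 t1 t2 t3 t4. x = const5 t0 * s00 + const5 t1 * s01 + const5 t2 * s02 + const5 t3 * s11 + const5 t4 * s12"
    if mem: "x \<in> entry_span s00 s01 s02 s11 s12 s22" for x
  proof -
    obtain c00 c01 c02 c11 c12 c22 where
      "x = const5 c00 * s00 + const5 c01 * s01 + const5 c02 * s02 + const5 c11 * s11 + const5 c12 * s12 + const5 c22 * s22"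
      by (rule entry_spanE[OF mem])
    then have "x = const5 (c00 + c22 * l0) * s00 + const5 (c01 + c22 * l1) * s01 + const5 (c02 + c22 * l2) * s02
      + const5 c11 * s11 + const5 c12 * s12"
      by (simp add: s22 algebra_simps)
    then show ?thesis by (intro exI)
  qed
  obtain t10 t11 t12 t13 t14 where a1: "a1 = const5 t10 * s00 + const5 t11 * s01 + const5 t12 * s02 + const5 t13 * s11 + const5 t14 * s12"
    using reduce[of a1] a by auto
  obtain t20 t21 t22 t23 t24 where a2: "a2 = const5 t20 * s00 + const5 t21 * s01 + const5 t22 * s02 + const5 t23 * s11 + const5 t24 * s12"
    using reduce[of a2] a by auto
  define c d where "c = t13" and "d = t14 + t23"
  obtain b0 where B1: "british_form I s00 s01 s02 s11 s12 s22 b0 (const5 c * s11 + const5 d * s12) 0"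
    using british_double_normalize[OF B s22 a1 a2] unfolding c_def d_def by (elim exE)
  have c: "c \<noteq> 0" by (rule double_leading_coefficient[OF B1 s22 rel m])
  \<comment> \<open>Replacing \<open>v1\<close> by \<open>v1 + \<kappa> v2\<close> removes
    \<open>v1^2 v2\<close> from \<open>c v1^3 + d v1^2 v2\<close>, as for a depressed cubic; the
    terms with \<open>v2^2\<close> are divisible by \<open>v0\<close>. This divides by 3.\<close>
  define \<kappa> where "\<kappa> = inverse (3 * c) * d"
  have \<kappa>: "3 * c * \<kappa> = d"
    unfolding \<kappa>_def using nz(2) c by (simp add: mult.assoc[symmetric])
  let ?s01 = "s01 + const5 \<kappa> * s02" and ?s11 = "s11 + const5 (2 * \<kappa>) * s12 + const5 (\<kappa> * \<kappa>) * s22" and ?s12 = "s12 + const5 \<kappa> * s22"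
  note B2 = british_T12[OF B1, of \<kappa>]
  have s22': "s22 = const5 l0 * s00 + const5 l1 * ?s01 + const5 (l2 - \<kappa> * l1) * s02"
    unfolding s22 by (simp add: algebra_simps)
  have rel': "const5 m0 * s00 + const5 m1 * ?s01 + const5 (m2 - \<kappa> * m1) * s02 = 0"
    using rel by (simp add: algebra_simps)
  have m': "m0 \<noteq> 0 \<or> m1 \<noteq> 0 \<or> m2 - \<kappa> * m1 \<noteq> 0" using m by auto
  define w where "w = c * \<kappa> * \<kappa> - d * \<kappa>"
  have "const5 c * s11 + const5 d * s12 = const5 c * ?s11 + const5 (d - 2 * c * \<kappa>) * ?s12 + const5 w * s22"
    by (simp add: w_def algebra_simps)
  also have "const5 w * s22 = const5 w * (const5 l0 * s00 + const5 l1 * ?s01 + const5 (l2 - \<kappa> * l1) * s02)"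
    using s22' by (rule arg_cong)
  also have "const5 c * ?s11 + const5 (d - 2 * c * \<kappa>) * ?s12 + \<dots>
    = const5 (w * l0) * s00 + const5 (w * l1) * ?s01 + const5 (w * (l2 - \<kappa> * l1)) * s02 + const5 c * ?s11 + const5 (d - 2 * c * \<kappa>) * ?s12"
    by (simp only: const5_hom(4) distrib_left mult.assoc add_ac)
  finally have a1': "const5 c * s11 + const5 d * s12 = const5 (w * l0) * s00 + const5 (w * l1) * ?s01 + const5 (w * (l2 - \<kappa> * l1)) * s02
    + const5 c * ?s11 + const5 (d - 2 * c * \<kappa>) * ?s12" .
  have scale: "0 - const5 k * (const5 p0 * x0 + const5 p1 * x1 + const5 p2 * x2 + const5 p3 * x3 + const5 p4 * x4)
    = const5 (- k * p0) * x0 + const5 (- k * p1) * x1 + const5 (- k * p2) * x2 + const5 (- k * p3) * x3 + const5 (- k * p4) * x4"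
    for k p0 p1 p2 p3 p4 :: 'k and x0 x1 x2 x3 x4
    by (simp add: algebra_simps)
  have a2': "0 - const5 \<kappa> * (const5 c * s11 + const5 d * s12) = const5 (- \<kappa> * (w * l0)) * s00 + const5 (- \<kappa> * (w * l1)) * ?s01
    + const5 (- \<kappa> * (w * (l2 - \<kappa> * l1))) * s02 + const5 (- \<kappa> * c) * ?s11 + const5 (- \<kappa> * (d - 2 * c * \<kappa>)) * ?s12"
    unfolding a1' by (rule scale)
  have "d - 2 * c * \<kappa> + - \<kappa> * c = 0"
    using \<kappa> by (simp add: algebra_simps)
  then obtain b0' where "british_form I s00 ?s01 s02 ?s11 ?s12 s22 b0' (const5 c * ?s11 + const5 0 * ?s12) 0"
    using british_double_normalize[OF B2 s22' a1' a2'] by (elim exE) simp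
  then have B3: "british_form I s00 ?s01 s02 ?s11 ?s12 s22 b0' (const5 c * ?s11) 0" by simp
  show ?thesis
    by (rule scandinavian_double_reduced[OF nz B3 c s22' rel' m'])
qed

end

section \<open>Pencils of conics and the reduction to them\<close>

context six_points
begin

text \<open>Zero discriminant makes the first conic restrict on \<open>v0 = 0\<close> to a multiple
  of \<open>(v2 + \<kappa> v1)^2\<close>, or of \<open>v1^2\<close> up to a swap. In the coordinate
  \<open>v2 + \<kappa> v1\<close> it expresses \<open>s22\<close> by the first row. The second conic
  contains the line \<open>v0 = 0\<close>.\<close>

lemma scandinavian_pencil:
  assumes nz: "(2 :: 'k) \<noteq> 0" "(3 :: 'k) \<noteq> 0"
    and B: "british_form I s00 s01 s02 s11 s12 s22 a0 a1 a2"
    and a: "{a1, a2} \<subseteq> entry_span s00 s01 s02 s11 s12 s22"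
    and p: "const5 p00 * s00 + const5 p01 * s01 + const5 p02 * s02 + const5 p11 * s11 + const5 p12 * s12 + const5 p22 * s22 = 0"
    and disc: "p12 * p12 = 4 * p11 * p22" and nonzero: "p11 \<noteq> 0 \<or> p12 \<noteq> 0 \<or> p22 \<noteq> 0"
    and rel: "const5 m0 * s00 + const5 m1 * s01 + const5 m2 * s02 = 0"
    and m: "m0 \<noteq> 0 \<or> m1 \<noteq> 0 \<or> m2 \<noteq> 0"
  shows "scandinavian_form I"
proof -
  have main: "scandinavian_form I"
    if B: "british_form I s00 s01 s02 s11 s12 s22 a0 a1 a2"
      and a: "{a1, a2} \<subseteq> entry_span s00 s01 s02 s11 s12 s22"
      and p: "const5 p00 * s00 + const5 p01 * s01 + const5 p02 * s02 + const5 p11 * s11 + const5 p12 * s12 + const5 p22 * s22 = 0"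
      and disc: "p12 * p12 = 4 * p11 * p22" and p22: "p22 \<noteq> 0"
      and rel: "const5 m0 * s00 + const5 m1 * s01 + const5 m2 * s02 = 0"
      and m: "m0 \<noteq> 0 \<or> m1 \<noteq> 0 \<or> m2 \<noteq> 0"
    for s00 s01 s02 s11 s12 s22 a0 a1 a2 p00 p01 p02 p11 p12 p22 m0 m1 m2
  proof -
    define \<kappa> where "\<kappa> = inverse (2 * p22) * p12"
    have p12: "p12 = p22 * (2 * \<kappa>)"
    proof -
      have "p22 * (2 * \<kappa>) = (2 * p22) * inverse (2 * p22) * p12"
        by (simp add: \<kappa>_def mult_ac)
      then show ?thesis using nz(1) p22 by simp
    qed
    have "(4 * p22) * p11 = p12 * p12"
      unfolding disc by (simp only: mult_ac)
    also have "\<dots> = (2 * 2 * p22) * (p22 * (\<kappa> * \<kappa>))"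
      unfolding p12 by (simp only: mult_ac)
    also have "2 * 2 = (4 :: 'k)" by simp
    finally have "(4 * p22) * p11 = (4 * p22) * (p22 * (\<kappa> * \<kappa>))" .
    moreover have "(4 :: 'k) \<noteq> 0"
      using nz(1) by (metis mult_2 mult_eq_0_iff numeral_Bit0)
    ultimately have p11: "p11 = p22 * (\<kappa> * \<kappa>)"
      using p22 mult_left_cancel[of "4 * p22" p11 "p22 * (\<kappa> * \<kappa>)"] mult_eq_0_iff[of 4 p22] by blast
    let ?s02 = "s02 + const5 \<kappa> * s01"
    note B' = british_T21[OF B, of \<kappa>]
    have "const5 (inverse p22) * (const5 p00 * s00 + const5 p01 * s01 + const5 p02 * s02 + const5 p11 * s11 + const5 p12 * s12 + const5 p22 * s22) = 0"
      unfolding p by simp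
    then have eq: "const5 (inverse p22 * p00) * s00 + const5 (inverse p22 * p01) * s01 + const5 (inverse p22 * p02) * s02
      + const5 (\<kappa> * \<kappa>) * s11 + const5 (2 * \<kappa>) * s12 + s22 = 0"
      unfolding p11 p12 const5_hom(4)[of p22] distrib_left mult.assoc[symmetric] const5_hom(4)[symmetric]
      using p22 by simp
    have "s22 + const5 (2 * \<kappa>) * s12 + const5 (\<kappa> * \<kappa>) * s11
      = (const5 (inverse p22 * p00) * s00 + const5 (inverse p22 * p01) * s01 + const5 (inverse p22 * p02) * s02
      + const5 (\<kappa> * \<kappa>) * s11 + const5 (2 * \<kappa>) * s12 + s22)
      + const5 (- (inverse p22 * p00)) * s00 + const5 (- (inverse p22 * p01) + \<kappa> * (inverse p22 * p02)) * s01
      + const5 (- (inverse p22 * p02)) * ?s02"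
      by (simp add: algebra_simps)
    then have s22: "s22 + const5 (2 * \<kappa>) * s12 + const5 (\<kappa> * \<kappa>) * s11
      = const5 (- (inverse p22 * p00)) * s00 + const5 (- (inverse p22 * p01) + \<kappa> * (inverse p22 * p02)) * s01
      + const5 (- (inverse p22 * p02)) * ?s02"
      unfolding eq by (simp only: add_0)
    have rel': "const5 m0 * s00 + const5 (m1 - \<kappa> * m2) * s01 + const5 m2 * ?s02 = 0"
      using rel by (simp add: algebra_simps)
    have a': "{a1 - const5 \<kappa> * a2, a2} \<subseteq> entry_span s00 s01 ?s02 s11 (s12 + const5 \<kappa> * s11) (s22 + const5 (2 * \<kappa>) * s12 + const5 (\<kappa> * \<kappa>) * s11)"
      using a entry_span_T21[of s00 s01 s02 s11 s12 s22 \<kappa>]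
      by (simp only: insert_subset empty_subsetI simp_thms) (blast intro: entry_span_diff entry_span_scale)
    show ?thesis
      by (rule scandinavian_double[OF nz B' a' s22 rel']) (use m in auto)
  qed
  show ?thesis
  proof (cases "p22 = 0")
    case False
    then show ?thesis by (rule main[OF B a p disc _ rel m])
  next
    case True
    then have "p12 = 0" using disc by simp
    then have p11: "p11 \<noteq> 0" using nonzero True by simp
    have p': "const5 p00 * s00 + const5 p02 * s02 + const5 p01 * s01 + const5 p22 * s22 + const5 p12 * s12 + const5 p11 * s11 = 0"
      using p by (simp add: add_ac)
    have rel': "const5 m0 * s00 + const5 m2 * s02 + const5 m1 * s01 = 0"
      using rel by (simp add: add_ac)
    have a': "{a2, a1} \<subseteq> entry_span s00 s02 s01 s22 s12 s11"
      using a by (simp add: entry_span_swap12)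
    have disc': "p12 * p12 = 4 * p22 * p11" using disc by simp
    show ?thesis
      by (rule main[OF british_swap12[OF B] a' p' disc' p11 rel']) (use m in auto)
  qed
qed

text \<open>As \<open>a0\<close> is outside the span, the entries of \<open>S\<close> span at most
  four dimensions and satisfy two independent relations. Unless some discriminant is nonzero, the
  pencil contains a relation supported on the first row.\<close>

lemma scandinavian_of_reduced_british:
  assumes nz: "(2 :: 'k) \<noteq> 0" "(3 :: 'k) \<noteq> 0"
    and B: "british_form I s00 s01 s02 s11 s12 s22 a0 a1 a2"
    and a: "{a1, a2} \<subseteq> entry_span s00 s01 s02 s11 s12 s22" and a0: "a0 \<notin> entry_span s00 s01 s02 s11 s12 s22"
  shows "scandinavian_form I"
proof (rule ccontr)
  assume contr: "\<not> scandinavian_form I"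
  let ?E = "entry_span s00 s01 s02 s11 s12 s22"
  define f where "f = (\<lambda>i::nat. [s00, s01, s02, s11, s12, s22] ! i)"
  have forms: "{s00, s01, s02, s11, s12, s22, a0} \<subseteq> forms 1"
    using B by (simp add: british_form_def)
  have f_mem: "f i \<in> {s00, s01, s02, s11, s12, s22}" if "i < 6" for i
  proof -
    have "f i \<in> set [s00, s01, s02, s11, s12, s22]"
      unfolding f_def by (rule nth_mem) (use that in simp)
    then show ?thesis by simp
  qed
  have f_forms: "f i \<in> forms 1" if "i < 6" for i
    using f_mem[OF that] forms by blast
  have f_span: "f i \<in> ?E" if "i < 6" for i
    using f_mem[OF that] entry_span_base by blast
  define R where "R = (\<lambda>c :: nat \<Rightarrow> 'k. (\<Sum>i<6. const5 (c i) * f i) = 0)"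
  have R_iff: "R c \<longleftrightarrow> const5 (c 0) * s00 + const5 (c 1) * s01 + const5 (c 2) * s02 + const5 (c 3) * s11 + const5 (c 4) * s12 + const5 (c 5) * s22 = 0" for c
    by (simp add: R_def f_def eval_nat_numeral)
  have R_lincomb: "R (\<lambda>i. s * c i + t * d i)" if "R c" "R d" for s t c d
  proof -
    have "(\<Sum>i<6. const5 (s * c i + t * d i) * f i) = const5 s * (\<Sum>i<6. const5 (c i) * f i) + const5 t * (\<Sum>i<6. const5 (d i) * f i)"
      by (simp add: sum_distrib_left sum.distrib distrib_right mult.assoc)
    then show ?thesis using that by (simp add: R_def)
  qed
  have disc: "c 4 * c 4 = 4 * c 3 * c 5" if "R c" for c
    using scandinavian_discriminant[OF nz B a that[unfolded R_iff]] contr by blast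
  have "\<exists>c. (\<exists>i<6. c i \<noteq> 0) \<and> R c"
    unfolding R_def by (rule six_linear_forms_dependent[of f]) (use f_forms in blast)+
  then obtain c j where c: "R c" "j < 6" "c j \<noteq> 0" by blast
  \<comment> \<open>Replacing the entry at a position \<open>j\<close> occurring in the first
    relation by \<open>a0\<close> forces a second relation. It cannot involve \<open>a0\<close>,
    hence it has \<open>d j = 0\<close> and is independent of the first.\<close>
  define g where "g = f(j := a0)"
  have "g i \<in> forms 1" if "i < 6" for i
    using f_forms[OF that] forms by (simp add: g_def)
  then obtain d where d: "\<exists>i<6. d i \<noteq> 0" "(\<Sum>i<6. const5 (d i) * g i) = 0"
    by (rule six_linear_forms_dependent)
  have split: "(\<Sum>i<6. const5 (d i) * g i) = const5 (d j) * a0 + (\<Sum>i\<in>{..<6} - {j}. const5 (d i) * f i)"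
    using c(2) by (subst sum.remove[of "{..<6}" j]) (simp_all add: g_def)
  have dj: "d j = 0"
  proof (rule ccontr)
    assume dj: "d j \<noteq> 0"
    have "const5 (d j) * a0 = (\<Sum>i<6. const5 (d i) * g i) - (\<Sum>i\<in>{..<6} - {j}. const5 (d i) * f i)"
      unfolding split by simp
    also have "\<dots> \<in> ?E"
      unfolding d(2)
      by (intro entry_span_diff poly5.subspace_0[OF entry_span_subspace] poly5.subspace_sum[OF entry_span_subspace] entry_span_scale f_span) simp
    finally have "const5 (inverse (d j)) * (const5 (d j) * a0) \<in> ?E"
      by (rule entry_span_scale)
    then show False
      using a0 const5_inverse_mult[OF dj] by (simp add: mult.assoc[symmetric])
  qed
  have Rd: "R d"
  proof -
    have "(\<Sum>i<6. const5 (d i) * f i) = (\<Sum>i<6. const5 (d i) * g i)"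
      by (rule sum.cong) (simp_all add: g_def dj)
    then show ?thesis using d(2) by (simp add: R_def)
  qed
  obtain i where i: "i < 6" "d i \<noteq> 0" using d(1) by blast
  have first_row: "const5 (r 0) * s00 + const5 (r 1) * s01 + const5 (r 2) * s02 = 0" if "R r" "r 3 = 0" "r 4 = 0" "r 5 = 0" for r
    using that by (simp add: R_iff)
  have low: "k = 0 \<or> k = 1 \<or> k = 2" if "r k \<noteq> (0 :: 'k)" "k < 6" "r 3 = 0" "r 4 = 0" "r 5 = 0" for r and k :: nat
  proof -
    have "k = 0 \<or> k = 1 \<or> k = 2 \<or> k = 3 \<or> k = 4 \<or> k = 5" using that(2) by auto
    then show ?thesis using that by auto
  qed
  have pencil: False if "R p" "p 3 \<noteq> 0 \<or> p 4 \<noteq> 0 \<or> p 5 \<noteq> 0" "R r" "r 3 = 0" "r 4 = 0" "r 5 = 0" "k < 6" "r k \<noteq> 0" for p r k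
  proof -
    have "r 0 \<noteq> 0 \<or> r 1 \<noteq> 0 \<or> r 2 \<noteq> 0"
      using low[of r k] that by auto
    then show False
      using scandinavian_pencil[OF nz B a that(1)[unfolded R_iff] disc[OF that(1)] that(2) first_row[OF that(3-6)]] contr by blast
  qed
  show False
  proof (cases "c 3 = 0 \<and> c 4 = 0 \<and> c 5 = 0")
    case c0: True
    show False
    proof (cases "d 3 = 0 \<and> d 4 = 0 \<and> d 5 = 0")
      case True
      \<comment> \<open>Both relations concern only the first row and must be proportional, which
        \<open>c j ~= 0\<close>, \<open>d j = 0\<close> and \<open>d i ~= 0\<close> exclude.\<close>
      have minors: "c 1 * d 2 = c 2 * d 1 \<and> c 2 * d 0 = c 0 * d 2 \<and> c 0 * d 1 = c 1 * d 0"
        by (rule first_row_rank[OF B first_row first_row]) (use c0 True c(1) Rd in auto)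
      have "j = 0 \<or> j = 1 \<or> j = 2" by (rule low[of c]) (use c c0 in auto)
      moreover have "i = 0 \<or> i = 1 \<or> i = 2" by (rule low[of d]) (use i True in auto)
      ultimately show False
        using minors c(3) i(2) dj by auto
    next
      case False
      then show False using pencil[OF Rd _ c(1) _ _ _ c(2,3)] c0 by blast
    qed
  next
    case False
    \<comment> \<open>The polarized discriminant condition. The cone \<open>y^2 = 4 x z\<close>
      contains no plane through the origin, so the restrictions of the two relations to
      \<open>v0 = 0\<close> are proportional.\<close>
    have cd: "c 4 * d 4 + c 4 * d 4 = 4 * (c 3 * d 5) + 4 * (d 3 * c 5)"
      using disc[OF R_lincomb[OF c(1) Rd, of 1 1]] disc[OF c(1)] disc[OF Rd] by (simp add: algebra_simps)
    have four: "(4 :: 'k) \<noteq> 0"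
      using nz(1) by (metis mult_2 mult_eq_0_iff numeral_Bit0)
    have "\<exists>\<mu>. d 3 = \<mu> * c 3 \<and> d 4 = \<mu> * c 4 \<and> d 5 = \<mu> * c 5"
    proof (cases "c 3 = 0")
      case c3: True
      then have c4: "c 4 = 0" using disc[OF c(1)] by simp
      then have c5: "c 5 \<noteq> 0" using False c3 by simp
      have "4 * (d 3 * c 5) = 0" using cd by (simp only: c3 c4 mult_zero_left mult_zero_right add_0)
      then have "d 3 = 0" using four c5 by (simp only: mult_eq_0_iff simp_thms)
      moreover have "d 4 = 0" using disc[OF Rd] \<open>d 3 = 0\<close> by simp
      ultimately show ?thesis
        using c5 by (intro exI[of _ "d 5 * inverse (c 5)"]) (simp add: c3 c4)
    next
      case c3: False
      define \<mu> where "\<mu> = d 3 * inverse (c 3)"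
      have d3: "d 3 = \<mu> * c 3" using c3 by (simp add: \<mu>_def)
      have "(d 4 - \<mu> * c 4) * (d 4 - \<mu> * c 4) = d 4 * d 4 - \<mu> * (c 4 * d 4 + c 4 * d 4) + \<mu> * \<mu> * (c 4 * c 4)"
        by (simp add: algebra_simps)
      also have "\<dots> = 0"
        unfolding cd disc[OF c(1)] disc[OF Rd] d3 by (simp add: algebra_simps)
      finally have d4: "d 4 = \<mu> * c 4" by simp
      have "4 * (c 3 * d 5) = c 4 * d 4 + c 4 * d 4 - 4 * (d 3 * c 5)"
        unfolding cd by simp
      also have "\<dots> = \<mu> * (c 4 * c 4 + c 4 * c 4) - 4 * (\<mu> * c 3 * c 5)"
        unfolding d4 d3 by (simp add: algebra_simps)
      also have "\<dots> = 4 * (c 3 * (\<mu> * c 5))"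
        unfolding disc[OF c(1)] by (simp add: algebra_simps)
      finally have "d 5 = \<mu> * c 5"
        using four c3 by (simp only: mult_cancel_left simp_thms)
      then show ?thesis using d3 d4 by blast
    qed
    then obtain \<mu> where \<mu>: "d 3 = \<mu> * c 3" "d 4 = \<mu> * c 4" "d 5 = \<mu> * c 5" by blast
    \<comment> \<open>The member of the pencil that vanishes on \<open>v0 = 0\<close>. It is nonzero
      at \<open>j\<close> if \<open>\<mu>\<close> is nonzero, and equals \<open>d\<close>
      otherwise.\<close>
    define r where "r = (\<lambda>k. 1 * d k + (- \<mu>) * c k)"
    have Rr: "R r" unfolding r_def by (rule R_lincomb[OF Rd c(1)])
    have r0: "r 3 = 0" "r 4 = 0" "r 5 = 0" by (simp_all add: r_def \<mu>)
    have "\<exists>k<6. r k \<noteq> 0"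
    proof (cases "\<mu> = 0")
      case True
      then show ?thesis using i by (intro exI[of _ i]) (simp add: r_def)
    next
      case \<mu>0: False
      then show ?thesis using c(2,3) dj by (intro exI[of _ j]) (simp add: r_def)
    qed
    then obtain k where "k < 6" "r k \<noteq> 0" by blast
    then show False
      using pencil[OF c(1) _ Rr r0] False by blast
  qed
qed

lemma british_in_entries:
  assumes "british_form I s00 s01 s02 s11 s12 s22 a0 a1 a2"
  shows "I \<subseteq> ideal_mod.span {s00, s01, s02, s11, s12, s22}"
proof -
  let ?J = "ideal_mod.span {s00, s01, s02, s11, s12, s22}"
  have J: "ideal_mod.subspace ?J" by (rule ideal_mod.subspace_span)
  have l: "f * g \<in> ?J" if "f \<in> ?J" for f g
    using ideal_mod.subspace_scale[OF J that, of g] by (simp add: mult.commute)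
  have s: "{s00, s01, s02, s11, s12, s22} \<subseteq> ?J" by (rule ideal_mod.span_superset)
  have "british_gens 0 s00 s01 s02 s11 s12 s22 a0 a1 a2 \<subseteq> ?J"
    unfolding british_gens_0_subset_iff
    by (intro conjI ideal_mod.subspace_add[OF J] ideal_mod.subspace_diff[OF J] l) (use s in simp_all)
  then show ?thesis
    using assms ideal_mod.span_minimal[OF _ J] by (simp add: british_form_def)
qed

lemma scandinavian_of_british_form:
  assumes nz: "(2 :: 'k) \<noteq> 0" "(3 :: 'k) \<noteq> 0"
    and B: "british_form I s00 s01 s02 s11 s12 s22 a0 a1 a2"
  shows "scandinavian_form I"
proof -
  have main: "scandinavian_form I"
    if B: "british_form I s00 s01 s02 s11 s12 s22 a0 a1 a2" and a0: "a0 \<notin> entry_span s00 s01 s02 s11 s12 s22"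
    for s00 s01 s02 s11 s12 s22 a0 a1 a2
  proof -
    let ?E = "entry_span s00 s01 s02 s11 s12 s22"
    have forms: "{s00, s01, s02, s11, s12, s22} \<subseteq> forms 1" and a_forms: "a0 \<in> forms 1" "a1 \<in> forms 1" "a2 \<in> forms 1"
      using B by (simp_all add: british_form_def)
    have mod_ell: "\<exists>k. y - const5 k * ell \<in> ?E" if "y \<in> forms 1" for y
      using forms_1_span[OF forms british_in_entries[OF B] that] unfolding poly5.span_breakdown_eq entry_span_def .
    obtain k0 where k0: "a0 - const5 k0 * ell \<in> ?E" using mod_ell[OF a_forms(1)] by blast
    have "k0 \<noteq> 0" using k0 a0 by auto
    \<comment> \<open>Modulo the span of the entries all linear forms are multiples of
      \<open>ell\<close>, hence of \<open>a0\<close>, which is nonzero there. Suitable transvections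
      then move \<open>a1\<close> and \<open>a2\<close> into the span.\<close>
    have eliminate: "\<exists>\<kappa>. y - const5 \<kappa> * a0 \<in> ?E" if y: "y \<in> forms 1" for y
    proof -
      obtain k where k: "y - const5 k * ell \<in> ?E" using mod_ell[OF y] by blast
      define \<kappa> where "\<kappa> = k * inverse k0"
      have "k = \<kappa> * k0" using \<open>k0 \<noteq> 0\<close> by (simp add: \<kappa>_def)
      then have "y - const5 \<kappa> * a0 = (y - const5 k * ell) - const5 \<kappa> * (a0 - const5 k0 * ell)"
        by (simp add: algebra_simps)
      also have "\<dots> \<in> ?E" by (intro entry_span_diff entry_span_scale k k0)
      finally show ?thesis by (rule exI)
    qed
    obtain \<kappa> where \<kappa>: "a1 - const5 \<kappa> * a0 \<in> ?E" using eliminate[OF a_forms(2)] by blast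
    obtain \<mu> where \<mu>: "a2 - const5 \<mu> * a0 \<in> ?E" using eliminate[OF a_forms(3)] by blast
    note B' = british_T02[OF british_T01[OF B, of \<kappa>], of \<mu>]
    let ?s00 = "s00 + const5 (2 * \<kappa>) * s01 + const5 (\<kappa> * \<kappa>) * s11" and ?s01 = "s01 + const5 \<kappa> * s11" and ?s02 = "s02 + const5 \<kappa> * s12"
    let ?E' = "entry_span (?s00 + const5 (2 * \<mu>) * ?s02 + const5 (\<mu> * \<mu>) * s22) (?s01 + const5 \<mu> * s12) (?s02 + const5 \<mu> * s22) s11 s12 s22"
    have E: "?E \<subseteq> ?E'"
      by (rule order_trans[OF entry_span_T01 entry_span_T02])
    have base: "s00 \<in> ?E" "s01 \<in> ?E" "s02 \<in> ?E" "s11 \<in> ?E" "s12 \<in> ?E" "s22 \<in> ?E"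
      using entry_span_base[of s00 s01 s02 s11 s12 s22] by simp_all
    have "?E' \<subseteq> ?E"
      by (rule entry_span_subsetI, simp only: insert_subset empty_subsetI simp_thms)
        (intro conjI entry_span_add entry_span_scale base)
    then have "a0 \<notin> ?E'" using a0 by blast
    moreover have "{a1 - const5 \<kappa> * a0, a2 - const5 \<mu> * a0} \<subseteq> ?E'"
      using \<kappa> \<mu> E by blast
    ultimately show ?thesis
      by (intro scandinavian_of_reduced_british[OF nz B'])
  qed
  let ?E = "entry_span s00 s01 s02 s11 s12 s22"
  consider "{a0, a1, a2} \<subseteq> ?E" | "a0 \<notin> ?E" | "a1 \<notin> ?E" | "a2 \<notin> ?E" by blast
  then show ?thesis
  proof cases
    case 1
    then show ?thesis by (rule scandinavian_span_entries[OF nz B])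
  next
    case 2
    then show ?thesis by (rule main[OF B])
  next
    case 3
    then show ?thesis
      by (intro main[OF british_swap01[OF B]]) (simp add: entry_span_swap01[of s11])
  next
    case 4
    then show ?thesis
      by (intro main[OF british_swap01[OF british_swap12[OF B]]]) (simp add: entry_span_swap01[of s22] entry_span_swap12)
  qed
qed

end

section \<open>Matrices\<close>

lemma pick_2:
  assumes "i < (j::nat)"
  shows "pick {i, j} 0 = i" "pick {i, j} 1 = j"
proof -
  show 0: "pick {i, j} 0 = i" unfolding pick.simps by (rule Least_equality) (use assms in auto)
  show "pick {i, j} 1 = j" unfolding One_nat_def pick.simps(2) 0 by (rule Least_equality) (use assms in auto)
qed

lemma pick_4:
  assumes "i < (j::nat)" "j < k" "k < l"
  shows "pick {i, j, k, l} 0 = i" "pick {i, j, k, l} 1 = j" "pick {i, j, k, l} 2 = k" "pick {i, j, k, l} 3 = l"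
proof -
  show 0: "pick {i, j, k, l} 0 = i" unfolding pick.simps by (rule Least_equality) (use assms in auto)
  show 1: "pick {i, j, k, l} 1 = j" unfolding One_nat_def pick.simps(2) 0 by (rule Least_equality) (use assms in auto)
  show 2: "pick {i, j, k, l} 2 = k" unfolding numeral_2_eq_2 pick.simps(2) 1[unfolded One_nat_def pick.simps(2)]
    by (rule Least_equality) (use assms in auto)
  show "pick {i, j, k, l} 3 = l" unfolding numeral_3_eq_3 pick.simps(2) 2[unfolded numeral_2_eq_2 pick.simps(2)]
    by (rule Least_equality) (use assms in auto)
qed

lemma card_2_nat:
  assumes "card (I :: nat set) = 2"
  obtains i j where "i < j" "I = {i, j}"
proof -
  obtain i j where "I = {i, j}" "i \<noteq> j"
    using assms by (auto simp: card_2_iff)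
  then show ?thesis
    using that[of i j] that[of j i] by (cases "i < j") auto
qed

lemma card_4_nat:
  assumes "card (I :: nat set) = 4"
  obtains i j k l where "i < j" "j < k" "k < l" "I = {i, j, k, l}"
proof -
  define xs where "xs = sorted_list_of_set I"
  have "finite I" using assms by (metis card.infinite zero_neq_numeral)
  then have xs: "set xs = I" "sorted_wrt (<) xs" "length xs = 4"
    using assms by (simp_all add: xs_def)
  then obtain i j k l where "xs = [i, j, k, l]"
    by (auto simp: numeral_eq_Suc length_Suc_conv)
  then show ?thesis using that[of i j k l] xs by auto
qed

lemma submatrix_entry:
  assumes "A \<in> carrier_mat n m" "I \<subseteq> {..<n}" "J \<subseteq> {..<m}" "i < card I" "j < card J"
  shows "submatrix A I J $$ (i, j) = A $$ (pick I i, pick J j)"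
proof -
  have "{i. i < dim_row A \<and> i \<in> I} = I" "{j. j < dim_col A \<and> j \<in> J} = J"
    using assms by auto
  then show ?thesis using assms(4,5) by (simp add: submatrix_index)
qed

lemma det_2x2:
  fixes A :: "'a::comm_ring_1 mat"
  assumes A: "A \<in> carrier_mat 2 2"
  shows "det A = A $$ (0, 0) * A $$ (1, 1) - A $$ (0, 1) * A $$ (1, 0)"
proof -
  have mem: "mat_delete A 0 j \<in> carrier_mat 1 1" for j
    using mat_delete_carrier[OF A, of 0 j] by simp
  have "cofactor A 0 0 = A $$ (1, 1)" "cofactor A 0 1 = - A $$ (1, 0)"
    unfolding cofactor_def det_single[OF mem] using A by (simp_all add: mat_delete_def)
  then show ?thesis
    using laplace_expansion_row[OF A, of 0] by (simp add: numeral_2_eq_2)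
qed

lemma det_submatrix_2:
  fixes M :: "'a::comm_ring_1 mat"
  assumes M: "M \<in> carrier_mat n m" and "i < j" "j < n" "k < l" "l < m"
  shows "det (submatrix M {i, j} {k, l}) = M $$ (i, k) * M $$ (j, l) - M $$ (i, l) * M $$ (j, k)"
proof -
  have sub: "{i, j} \<subseteq> {..<n}" "{k, l} \<subseteq> {..<m}" and card: "card {i, j} = 2" "card {k, l} = 2"
    using assms by auto
  have "{i'. i' < dim_row M \<and> i' \<in> {i, j}} = {i, j}" "{j'. j' < dim_col M \<and> j' \<in> {k, l}} = {k, l}"
    using sub M by auto
  then have "submatrix M {i, j} {k, l} \<in> carrier_mat 2 2"
    using card by (intro carrier_matI) (simp_all only: dim_submatrix)
  then show ?thesis
    using submatrix_entry[OF M sub, of 0 0] submatrix_entry[OF M sub, of 0 1] submatrix_entry[OF M sub, of 1 0]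
      submatrix_entry[OF M sub, of 1 1] pick_2[OF assms(2)] pick_2[OF assms(4)] card
    by (simp add: det_2x2)
qed

lemma F2_eq_span_minors3:
  assumes M: "M \<in> carrier_mat 3 3"
  shows "F2 M = ideal_mod.span (minors3 (M $$ (0,0)) (M $$ (0,1)) (M $$ (0,2)) (M $$ (1,0)) (M $$ (1,1)) (M $$ (1,2))
    (M $$ (2,0)) (M $$ (2,1)) (M $$ (2,2)))"
proof -
  let ?m = "\<lambda>i j k l. M $$ (i, k) * M $$ (j, l) - M $$ (i, l) * M $$ (j, k)"
  have "{det (submatrix M I J) | I J. I \<subseteq> {..<3} \<and> J \<subseteq> {..<3} \<and> card I = 2 \<and> card J = 2}
    = {?m i j k l | i j k l. i < j \<and> j < 3 \<and> k < l \<and> l < 3}"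
  proof (intro subset_antisym subsetI)
    fix x assume "x \<in> {det (submatrix M I J) | I J. I \<subseteq> {..<3} \<and> J \<subseteq> {..<3} \<and> card I = 2 \<and> card J = 2}"
    then obtain I J where x: "x = det (submatrix M I J)" and IJ: "I \<subseteq> {..<3}" "J \<subseteq> {..<3}" "card I = 2" "card J = 2"
      by blast
    obtain i j where ij: "i < j" "I = {i, j}" using card_2_nat[OF IJ(3)] .
    obtain k l where kl: "k < l" "J = {k, l}" using card_2_nat[OF IJ(4)] .
    have "j < 3" "l < 3" using IJ ij kl by auto
    then have "x = ?m i j k l" unfolding x ij kl by (intro det_submatrix_2[OF M]) (use ij kl in auto)
    then show "x \<in> {?m i j k l | i j k l. i < j \<and> j < 3 \<and> k < l \<and> l < 3}"
      using ij(1) kl(1) \<open>j < 3\<close> \<open>l < 3\<close> by blast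
  next
    fix x assume "x \<in> {?m i j k l | i j k l. i < j \<and> j < 3 \<and> k < l \<and> l < 3}"
    then obtain i j k l where x: "x = ?m i j k l" and *: "i < j" "j < 3" "k < l" "l < 3" by blast
    have "x = det (submatrix M {i, j} {k, l})"
      unfolding x by (rule det_submatrix_2[OF M *, symmetric])
    moreover have "{i, j} \<subseteq> {..<3}" "{k, l} \<subseteq> {..<3}" "card {i, j} = 2" "card {k, l} = 2"
      using * by auto
    ultimately show "x \<in> {det (submatrix M I J) | I J. I \<subseteq> {..<3} \<and> J \<subseteq> {..<3} \<and> card I = 2 \<and> card J = 2}"
      by blast
  qed
  also have "\<dots> = minors3 (M $$ (0,0)) (M $$ (0,1)) (M $$ (0,2)) (M $$ (1,0)) (M $$ (1,1)) (M $$ (1,2))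
    (M $$ (2,0)) (M $$ (2,1)) (M $$ (2,2))" (is "_ = ?N")
  proof (intro subset_antisym subsetI)
    fix x assume "x \<in> {?m i j k l | i j k l. i < j \<and> j < 3 \<and> k < l \<and> l < 3}"
    then obtain i j k l where x: "x = ?m i j k l" and *: "i < j" "j < 3" "k < l" "l < 3" by blast
    have "(i, j) \<in> {(0, 1), (0, 2), (1, 2)}" "(k, l) \<in> {(0, 1), (0, 2), (1, 2)}" using * by auto
    then show "x \<in> ?N" unfolding x minors3_def by auto
  next
    fix x assume "x \<in> ?N"
    moreover have "?N \<subseteq> {?m i j k l | i j k l. i < j \<and> j < 3 \<and> k < l \<and> l < 3}"
    proof -
      have mem: "?m i j k l \<in> {?m i j k l | i j k l. i < j \<and> j < 3 \<and> k < l \<and> l < 3}"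
        if "i < j" "j < 3" "k < l" "l < 3" for i j k l using that by blast
      show ?thesis
        unfolding minors3_subset_iff by (intro conjI mem) simp_all
    qed
    ultimately show "x \<in> {?m i j k l | i j k l. i < j \<and> j < 3 \<and> k < l \<and> l < 3}" by (rule rev_subsetD)
  qed
  finally show ?thesis
    using M unfolding F2_def genideal_eq_span by simp
qed

definition pf :: "'a::comm_ring_1 mat \<Rightarrow> nat \<Rightarrow> nat \<Rightarrow> nat \<Rightarrow> nat \<Rightarrow> 'a" where
  "pf N i j k l = N $$ (i, j) * N $$ (k, l) - N $$ (i, k) * N $$ (j, l) + N $$ (i, l) * N $$ (j, k)"

lemma Pf4_eq_span:
  assumes N: "N \<in> carrier_mat 6 6"
  shows "Pf4 N = ideal_mod.span {pf N i j k l | i j k l. i < j \<and> j < k \<and> k < l \<and> l < 6}"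
proof -
  have pf: "pfaffian4 (submatrix N {i, j, k, l} {i, j, k, l}) = pf N i j k l" if *: "i < j" "j < k" "k < l" "l < 6" for i j k l
  proof -
    have sub: "{i, j, k, l} \<subseteq> {..<6}" and card: "card {i, j, k, l} = 4" using * by auto
    show ?thesis
      unfolding pfaffian4_def pf_def using card pick_4[OF *(1-3)] by (simp add: submatrix_entry[OF N sub sub])
  qed
  have "{pfaffian4 (submatrix N I I) | I. I \<subseteq> {..<6} \<and> card I = 4} = {pf N i j k l | i j k l. i < j \<and> j < k \<and> k < l \<and> l < 6}"
  proof (intro subset_antisym subsetI)
    fix x assume "x \<in> {pfaffian4 (submatrix N I I) | I. I \<subseteq> {..<6} \<and> card I = 4}"
    then obtain I where x: "x = pfaffian4 (submatrix N I I)" and I: "I \<subseteq> {..<6}" "card I = 4" by blast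
    obtain i j k l where *: "i < j" "j < k" "k < l" "I = {i, j, k, l}" using card_4_nat[OF I(2)] .
    then have "l < 6" using I(1) by auto
    then show "x \<in> {pf N i j k l | i j k l. i < j \<and> j < k \<and> k < l \<and> l < 6}"
      using pf[OF *(1-3)] * x by blast
  next
    fix x assume "x \<in> {pf N i j k l | i j k l. i < j \<and> j < k \<and> k < l \<and> l < 6}"
    then obtain i j k l where x: "x = pf N i j k l" and *: "i < j" "j < k" "k < l" "l < 6" by blast
    have "{i, j, k, l} \<subseteq> {..<6}" "card {i, j, k, l} = 4" using * by auto
    then show "x \<in> {pfaffian4 (submatrix N I I) | I. I \<subseteq> {..<6} \<and> card I = 4}"
      using pf[OF *] x by (intro CollectI exI[of _ "{i, j, k, l}"]) simp
  qed
  then show ?thesis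
    using N unfolding Pf4_def genideal_eq_span by simp
qed

text \<open>Of the fifteen pfaffians, three are the entries of \<open>S a\<close> and three are
  \<open>- q\<close> times these. The other nine are the entries of \<open>adj S + q a a^T\<close>
  up to sign, each off-diagonal one occurring twice.\<close>

lemma Pf4_eq_span_british_gens:
  assumes N: "N \<in> carrier_mat 6 6"
    and A: "N $$ (0,1) = a2" "N $$ (0,2) = - a1" "N $$ (1,2) = a0"
    and S: "N $$ (0,3) = s00" "N $$ (0,4) = s01" "N $$ (0,5) = s02" "N $$ (1,3) = s01" "N $$ (1,4) = s11" "N $$ (1,5) = s12"
      "N $$ (2,3) = s02" "N $$ (2,4) = s12" "N $$ (2,5) = s22"
    and B: "N $$ (3,4) = - (q * a2)" "N $$ (3,5) = q * a1" "N $$ (4,5) = - (q * a0)"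
  shows "Pf4 N = ideal_mod.span (british_gens q s00 s01 s02 s11 s12 s22 a0 a1 a2)"
  unfolding Pf4_eq_span[OF N]
proof (rule span_eqI)
  let ?J = "ideal_mod.span (british_gens q s00 s01 s02 s11 s12 s22 a0 a1 a2)"
  have J: "ideal_mod.subspace ?J" by (rule ideal_mod.subspace_span)
  have gens: "british_gens q s00 s01 s02 s11 s12 s22 a0 a1 a2 \<subseteq> ?J" by (rule ideal_mod.span_superset)
  have neg: "- x \<in> ?J" if "x \<in> ?J" for x by (rule ideal_mod.subspace_neg[OF J that])
  note g = gens[unfolded british_gens_subset_iff]
  have g00: "s11 * s22 - s12 * s12 + q * (a0 * a0) \<in> ?J" and g01: "s12 * s02 - s01 * s22 + q * (a0 * a1) \<in> ?J"
    and g02: "s01 * s12 - s02 * s11 + q * (a0 * a2) \<in> ?J" and g11: "s00 * s22 - s02 * s02 + q * (a1 * a1) \<in> ?J"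
    and g12: "s01 * s02 - s00 * s12 + q * (a1 * a2) \<in> ?J" and g22: "s00 * s11 - s01 * s01 + q * (a2 * a2) \<in> ?J"
    and r0: "s00 * a0 + s01 * a1 + s02 * a2 \<in> ?J" and r1: "s01 * a0 + s11 * a1 + s12 * a2 \<in> ?J" and r2: "s02 * a0 + s12 * a1 + s22 * a2 \<in> ?J"
    using g by simp_all
  note scaled = ideal_mod.subspace_scale[OF J, of _ "- q"]
  have pfs: "pf N 0 1 2 3 \<in> ?J" "pf N 0 1 2 4 \<in> ?J" "pf N 0 1 2 5 \<in> ?J" "pf N 0 1 3 4 \<in> ?J" "pf N 0 1 3 5 \<in> ?J"
    "pf N 0 1 4 5 \<in> ?J" "pf N 0 2 3 4 \<in> ?J" "pf N 0 2 3 5 \<in> ?J" "pf N 0 2 4 5 \<in> ?J" "pf N 0 3 4 5 \<in> ?J"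
    "pf N 1 2 3 4 \<in> ?J" "pf N 1 2 3 5 \<in> ?J" "pf N 1 2 4 5 \<in> ?J" "pf N 1 3 4 5 \<in> ?J" "pf N 2 3 4 5 \<in> ?J"
    subgoal using r0 by (simp add: pf_def A S B algebra_simps del: One_nat_def)
    subgoal using r1 by (simp add: pf_def A S B algebra_simps del: One_nat_def)
    subgoal using r2 by (simp add: pf_def A S B algebra_simps del: One_nat_def)
    subgoal using neg[OF g22] by (simp add: pf_def A S B algebra_simps del: One_nat_def)
    subgoal using g12 by (simp add: pf_def A S B algebra_simps del: One_nat_def)
    subgoal using neg[OF g02] by (simp add: pf_def A S B algebra_simps del: One_nat_def)
    subgoal using g12 by (simp add: pf_def A S B algebra_simps del: One_nat_def)
    subgoal using neg[OF g11] by (simp add: pf_def A S B algebra_simps del: One_nat_def)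
    subgoal using g01 by (simp add: pf_def A S B algebra_simps del: One_nat_def)
    subgoal using scaled[OF r0] by (simp add: pf_def A S B algebra_simps del: One_nat_def)
    subgoal using neg[OF g02] by (simp add: pf_def A S B algebra_simps del: One_nat_def)
    subgoal using g01 by (simp add: pf_def A S B algebra_simps del: One_nat_def)
    subgoal using neg[OF g00] by (simp add: pf_def A S B algebra_simps del: One_nat_def)
    subgoal using scaled[OF r1] by (simp add: pf_def A S B algebra_simps del: One_nat_def)
    subgoal using scaled[OF r2] by (simp add: pf_def A S B algebra_simps del: One_nat_def)
    done
  show "{pf N i j k l | i j k l. i < j \<and> j < k \<and> k < l \<and> l < 6} \<subseteq> ?J"
  proof
    fix x assume "x \<in> {pf N i j k l | i j k l. i < j \<and> j < k \<and> k < l \<and> l < 6}"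
    then obtain i j k l where x: "x = pf N i j k l" and *: "i < j" "j < k" "k < l" "l < 6" by blast
    have "l = 3 \<or> l = 4 \<or> l = 5" "k = 2 \<or> k = 3 \<or> k = 4" "j = 1 \<or> j = 2 \<or> j = 3" "i = 0 \<or> i = 1 \<or> i = 2"
      using * by auto
    then have "(i, j, k, l) \<in> {(0, 1, 2, 3), (0, 1, 2, 4), (0, 1, 2, 5), (0, 1, 3, 4), (0, 1, 3, 5), (0, 1, 4, 5), (0, 2, 3, 4), (0, 2, 3, 5), (0, 2, 4, 5), (0, 3, 4, 5), (1, 2, 3, 4), (1, 2, 3, 5), (1, 2, 4, 5), (1, 3, 4, 5), (2, 3, 4, 5)}"
      by (elim disjE) (use * in \<open>simp_all del: One_nat_def\<close>)
    then show "x \<in> ?J"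
      unfolding x insert_iff empty_iff prod.inject by (elim disjE conjE) (simp_all only: pfs)
  qed
next
  let ?P = "{pf N i j k l | i j k l. i < j \<and> j < k \<and> k < l \<and> l < 6}"
  let ?J = "ideal_mod.span ?P"
  have mem: "pf N i j k l \<in> ?J" if "i < j" "j < k" "k < l" "l < 6" for i j k l
    by (rule ideal_mod.span_base) (use that in blast)
  have mem': "- pf N i j k l \<in> ?J" if "i < j" "j < k" "k < l" "l < 6" for i j k l
    by (rule ideal_mod.span_neg[OF mem[OF that]])
  show "british_gens q s00 s01 s02 s11 s12 s22 a0 a1 a2 \<subseteq> ?J"
    unfolding british_gens_subset_iff
    apply (intro conjI)
    subgoal using mem'[of 1 2 4 5] by (simp add: pf_def A S B algebra_simps del: One_nat_def)
    subgoal using mem[of 0 2 4 5] by (simp add: pf_def A S B algebra_simps del: One_nat_def)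
    subgoal using mem'[of 0 1 4 5] by (simp add: pf_def A S B algebra_simps del: One_nat_def)
    subgoal using mem'[of 0 2 3 5] by (simp add: pf_def A S B algebra_simps del: One_nat_def)
    subgoal using mem[of 0 1 3 5] by (simp add: pf_def A S B algebra_simps del: One_nat_def)
    subgoal using mem'[of 0 1 3 4] by (simp add: pf_def A S B algebra_simps del: One_nat_def)
    subgoal using mem[of 0 1 2 3] by (simp add: pf_def A S B algebra_simps del: One_nat_def)
    subgoal using mem[of 0 1 2 4] by (simp add: pf_def A S B algebra_simps del: One_nat_def)
    subgoal using mem[of 0 1 2 5] by (simp add: pf_def A S B algebra_simps del: One_nat_def)
    done
qed

lemma british_iff:
  fixes I :: "'k::field poly5 set"
  shows "british I \<longleftrightarrow> (\<exists>q s00 s01 s02 s11 s12 s22 a0 a1 a2. {s00, s01, s02, s11, s12, s22, a0, a1, a2} \<subseteq> forms 1 \<and>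
    I = ideal_mod.span (british_gens (const5 q) s00 s01 s02 s11 s12 s22 a0 a1 a2))" (is "_ \<longleftrightarrow> ?R")
proof
  assume "british I"
  then obtain N where N: "N \<in> carrier_mat 6 6" "antisym_extrasym N" "elements_mat N \<subseteq> forms 1" "I = Pf4 N"
    unfolding british_def by blast
  then obtain A S q where A: "A \<in> carrier_mat 3 3" "transpose_mat A = - A" and S: "S \<in> carrier_mat 3 3" "transpose_mat S = S"
    and NAS: "N = four_block_mat A S (- S) (- (const5 q \<cdot>\<^sub>m A))"
    unfolding antisym_extrasym_def by blast
  have A_anti: "A $$ (j, i) = - A $$ (i, j)" if "i < 3" "j < 3" for i j
    using arg_cong[OF A(2), of "\<lambda>B. B $$ (i, j)"] A(1) that by simp
  have S_sym: "S $$ (j, i) = S $$ (i, j)" if "i < 3" "j < 3" for i j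
    using arg_cong[OF S(2), of "\<lambda>B. B $$ (i, j)"] S(1) that by simp
  have N_entry: "N $$ (i, j) \<in> forms 1" if "i < 6" "j < 6" for i j
    using N(1,3) that by (meson elements_matI subsetD)
  have left: "N $$ (i, j) = A $$ (i, j)" if "i < 3" "j < 3" for i j
    using that A(1) S(1) unfolding NAS by (subst index_mat_four_block) auto
  have right: "N $$ (i, 3 + j) = S $$ (i, j)" if "i < 3" "j < 3" for i j
    using that A(1) S(1) unfolding NAS by (subst index_mat_four_block) auto
  have lower: "N $$ (3 + i, 3 + j) = - (const5 q * A $$ (i, j))" if "i < 3" "j < 3" for i j
    using that A(1) S(1) unfolding NAS by (subst index_mat_four_block) auto
  have I: "I = ideal_mod.span (british_gens (const5 q) (S $$ (0,0)) (S $$ (0,1)) (S $$ (0,2)) (S $$ (1,1)) (S $$ (1,2)) (S $$ (2,2))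
    (A $$ (1,2)) (A $$ (2,0)) (A $$ (0,1)))"
    unfolding N(4)
    by (rule Pf4_eq_span_british_gens[OF N(1)])
      (use left[of 0 1] left[of 0 2] left[of 1 2] right[of 0 0] right[of 0 1] right[of 0 2] right[of 1 0] right[of 1 1] right[of 1 2]
        right[of 2 0] right[of 2 1] right[of 2 2] lower[of 0 1] lower[of 0 2] lower[of 1 2]
        A_anti[of 0 2] S_sym[of 0 1] S_sym[of 0 2] S_sym[of 1 2] in simp_all)
  have "{S $$ (0,0), S $$ (0,1), S $$ (0,2), S $$ (1,1), S $$ (1,2), S $$ (2,2), A $$ (1,2), A $$ (2,0), A $$ (0,1)} \<subseteq> forms 1"
    using N_entry[of 0 3] N_entry[of 0 4] N_entry[of 0 5] N_entry[of 1 4] N_entry[of 1 5] N_entry[of 2 5] N_entry[of 1 2] N_entry[of 2 0] N_entry[of 0 1]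
      left[of 0 1] left[of 2 0] left[of 1 2] right[of 0 0] right[of 0 1] right[of 0 2] right[of 1 1] right[of 1 2] right[of 2 2]
    by simp
  with I show ?R by blast
next
  assume ?R
  then obtain q s00 s01 s02 s11 s12 s22 a0 a1 a2 where forms: "{s00, s01, s02, s11, s12, s22, a0, a1, a2} \<subseteq> forms 1"
    and I: "I = ideal_mod.span (british_gens (const5 q) s00 s01 s02 s11 s12 s22 a0 a1 a2)"
    by blast
  define A where "A = Matrix.mat 3 3 (\<lambda>(i, j). [[0, a2, - a1], [- a2, 0, a0], [a1, - a0, 0]] ! i ! j)"
  define S where "S = Matrix.mat 3 3 (\<lambda>(i, j). [[s00, s01, s02], [s01, s11, s12], [s02, s12, s22]] ! i ! j)"
  define N where "N = four_block_mat A S (- S) (- (const5 q \<cdot>\<^sub>m A))"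
  have A: "A \<in> carrier_mat 3 3" and S: "S \<in> carrier_mat 3 3"
    unfolding A_def S_def by (rule mat_carrier)+
  then have N: "N \<in> carrier_mat 6 6"
    using four_block_carrier_mat[of A 3 3 "- (const5 q \<cdot>\<^sub>m A)" 3 3] by (simp add: N_def)
  have small: "i = 0 \<or> i = 1 \<or> i = 2" if "i < 3" for i :: nat using that by auto
  have A_forms: "A $$ (i, j) \<in> forms 1" if "i < 3" "j < 3" for i j
    using small[OF that(1)] small[OF that(2)] forms by (auto simp: A_def forms_uminus)
  have S_forms: "S $$ (i, j) \<in> forms 1" if "i < 3" "j < 3" for i j
    using small[OF that(1)] small[OF that(2)] forms by (auto simp: S_def)
  have "transpose_mat A = - A"
  proof (rule eq_matI)
    fix i j assume "i < dim_row (- A)" "j < dim_col (- A)"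
    then have ij: "i < 3" "j < 3" using A by auto
    show "transpose_mat A $$ (i, j) = (- A) $$ (i, j)"
      using small[OF ij(1)] small[OF ij(2)] by (auto simp: A_def)
  qed (use A in auto)
  moreover have "transpose_mat S = S"
  proof (rule eq_matI)
    fix i j assume "i < dim_row S" "j < dim_col S"
    then have ij: "i < 3" "j < 3" using S by auto
    show "transpose_mat S $$ (i, j) = S $$ (i, j)"
      using small[OF ij(1)] small[OF ij(2)] by (auto simp: S_def)
  qed (use S in auto)
  ultimately have "antisym_extrasym N"
    unfolding antisym_extrasym_def N_def using A S by blast
  moreover have "elements_mat N \<subseteq> forms 1"
  proof
    fix x assume "x \<in> elements_mat N"
    then obtain i j where ij: "i < 6" "j < 6" "x = N $$ (i, j)" using elements_matD[of x N] N by auto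
    show "x \<in> forms 1"
      unfolding ij(3) N_def using ij(1,2) A S A_forms S_forms
      by (subst index_mat_four_block) (auto simp: forms_uminus forms_scale)
  qed
  moreover have "I = Pf4 N"
    unfolding I
    by (rule Pf4_eq_span_british_gens[OF N, symmetric])
      (use A S in \<open>simp_all add: N_def, simp_all add: A_def S_def numeral_eq_Suc\<close>)
  ultimately show "british I"
    unfolding british_def using N by blast
qed

lemma scandinavian_iff:
  fixes I :: "'k::field poly5 set"
  assumes "ideal_depth poly5_ring I = 4"
  shows "scandinavian I \<longleftrightarrow> scandinavian_form I"
proof
  assume "scandinavian I"
  then obtain M where M: "M \<in> carrier_mat 3 3" "elements_mat M \<subseteq> forms 1" "I = F2 M"
    unfolding scandinavian_def by blast
  have "M $$ (i, j) \<in> forms 1" if "i < 3" "j < 3" for i j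
    using M(1,2) that by (meson elements_matI subsetD)
  then have "{M $$ (0,0), M $$ (0,1), M $$ (0,2), M $$ (1,0), M $$ (1,1), M $$ (1,2), M $$ (2,0), M $$ (2,1), M $$ (2,2)} \<subseteq> forms 1"
    by simp
  then show "scandinavian_form I"
    unfolding scandinavian_form_def M(3) F2_eq_span_minors3[OF M(1)] by blast
next
  assume "scandinavian_form I"
  then obtain m00 m01 m02 m10 m11 m12 m20 m21 m22 where forms: "{m00, m01, m02, m10, m11, m12, m20, m21, m22} \<subseteq> forms 1"
    and I: "I = ideal_mod.span (minors3 m00 m01 m02 m10 m11 m12 m20 m21 m22)"
    unfolding scandinavian_form_def by (elim exE conjE)
  define M where "M = Matrix.mat 3 3 (\<lambda>(i, j). [[m00, m01, m02], [m10, m11, m12], [m20, m21, m22]] ! i ! j)"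
  have M: "M \<in> carrier_mat 3 3" unfolding M_def by (rule mat_carrier)
  have "I = F2 M"
    unfolding F2_eq_span_minors3[OF M] I by (simp add: M_def)
  moreover have "elements_mat M \<subseteq> forms 1"
  proof
    fix x assume "x \<in> elements_mat M"
    then obtain i j where ij: "i < 3" "j < 3" "x = M $$ (i, j)" using elements_matD[of x M] M by auto
    have small: "i = 0 \<or> i = 1 \<or> i = 2" if "i < 3" for i :: nat using that by auto
    show "x \<in> forms 1"
      using small[OF ij(1)] small[OF ij(2)] forms unfolding ij(3) by (auto simp: M_def)
  qed
  ultimately show "scandinavian I"
    unfolding scandinavian_def using M assms by auto
qed

lemma british_of_scandinavian_form:
  fixes I :: "'k::field poly5 set"
  assumes two: "(2 :: 'k) \<noteq> 0" and "scandinavian_form I"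
  shows "british I"
proof -
  from assms(2) obtain m00 m01 m02 m10 m11 m12 m20 m21 m22 where forms: "{m00, m01, m02, m10, m11, m12, m20, m21, m22} \<subseteq> forms 1"
    and I: "I = ideal_mod.span (minors3 m00 m01 m02 m10 m11 m12 m20 m21 m22)"
    unfolding scandinavian_form_def by (elim exE conjE)
  define h where "h = inverse (2 :: 'k)"
  have half: "const5 h * f + const5 h * f = f" for f
  proof -
    have "h + h = 1" unfolding h_def using two by (metis mult_2 right_inverse)
    then show ?thesis by (simp only: distrib_right[symmetric] const5_hom(3)[symmetric]) simp
  qed
  let ?s = "\<lambda>f g. const5 h * f + const5 h * g" and ?a = "\<lambda>f g. const5 h * f - const5 h * g"
  \<comment> \<open>The explicit factor 1 is the \<open>r\<close> of
    \<open>minors3_sym_plus_antisym\<close>, so that the split matrix matches that lemma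
    literally.\<close>
  have sum: "?s f g + 1 * ?a f g = f" "?s g f - 1 * ?a f g = g" "?s f g - 1 * ?a f g = g" "?s f g + 1 * ?a g f = g" "?s f g - 1 * ?a g f = f" for f g
    using half[of f] half[of g] by (simp_all add: algebra_simps)
  have "ideal_mod.span (minors3 m00 (?s m01 m10 + 1 * ?a m01 m10) (?s m02 m20 - 1 * ?a m20 m02) (?s m01 m10 - 1 * ?a m01 m10) m11
      (?s m12 m21 + 1 * ?a m12 m21) (?s m02 m20 + 1 * ?a m20 m02) (?s m12 m21 - 1 * ?a m12 m21) m22)
    = ideal_mod.span (british_gens (1 * 1) m00 (?s m01 m10) (?s m02 m20) m11 (?s m12 m21) m22 (?a m12 m21) (?a m20 m02) (?a m01 m10))"
    by (rule span_eqI[OF minors3_sym_plus_antisym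
          minors3_sym_plus_antisym_converse[OF half_const5[OF two], of 1]]) simp
  then have "I = ideal_mod.span (british_gens (const5 1) m00 (?s m01 m10) (?s m02 m20) m11 (?s m12 m21) m22 (?a m12 m21) (?a m20 m02) (?a m01 m10))"
    unfolding I sum by simp
  moreover have "{m00, ?s m01 m10, ?s m02 m20, m11, ?s m12 m21, m22, ?a m12 m21, ?a m20 m02, ?a m01 m10} \<subseteq> forms 1"
    using forms by (simp add: forms_add forms_diff forms_scale)
  ultimately show ?thesis
    unfolding british_iff by (intro exI conjI)
qed

lemma six_points_Hilb6_P4:
  fixes I :: "'k::alg_closed_field poly5 set"
  assumes "I \<in> Hilb6_P4"
  shows "six_points I"
proof
  have hom: "ideal I poly5_ring" "I = ideal_mod.span (I \<inter> (\<Union>d. forms d))" and sat: "saturated I"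
    and hf: "\<forall>\<^sub>F d in sequentially. hilbert_function I d = 6"
    using assms by (simp_all add: Hilb6_P4_def homogeneous_ideal_def genideal_eq_span)
  show "ideal_mod.subspace I" using hom(1) by (simp add: ideal_iff_subspace)
  show "comp d f \<in> I" if "f \<in> I" for f d
  proof -
    have "f \<in> ideal_mod.span (I \<inter> (\<Union>d. forms d))" using that hom(2) by simp
    from comp_span[OF this, of d] show ?thesis using hom(2) by simp
  qed
  show "f \<in> I" if "\<And>g. g \<in> forms n \<Longrightarrow> g * f \<in> I" for f n
    using sat that unfolding saturated_def by blast
  show "\<exists>d0. \<forall>d\<ge>d0. hilbert_function I d = 6"
    using hf by (simp add: eventually_sequentially)
qed

theorem proposition6p4p3:
  fixes I :: "'k :: alg_closed_field poly5 set"
  assumes "CHAR('k) \<noteq> 2" and "CHAR('k) \<noteq> 3"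
    and "I \<in> Hilb6_aG_0_P4 TYPE('m)"
  shows "british I \<longleftrightarrow> scandinavian I"
proof -
  note nz = two_three_nonzero[OF assms(1,2)]
  interpret six_points I
    by (rule six_points_Hilb6_P4) (use assms(3) in \<open>simp add: Hilb6_aG_0_P4_def\<close>)
  have "scandinavian_form I" if "british I"
  proof -
    obtain q s00 s01 s02 s11 s12 s22 a0 a1 a2 where forms: "{s00, s01, s02, s11, s12, s22, a0, a1, a2} \<subseteq> forms 1"
      and I: "I = ideal_mod.span (british_gens (const5 q) s00 s01 s02 s11 s12 s22 a0 a1 a2)"
      using \<open>british I\<close> unfolding british_iff by (elim exE conjE)
    show ?thesis
    proof (cases "q = 0")
      case True
      then have "british_form I s00 s01 s02 s11 s12 s22 a0 a1 a2"
        using forms I by (simp add: british_form_def)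
      then show ?thesis by (rule scandinavian_of_british_form[OF nz])
    next
      case False
      obtain r where "1 * r * r + 0 * r + - q = 0"
        using quadratic_root[of 1 0 "- q"] by auto
      then have r: "r * r = q" by simp
      then have "r \<noteq> 0" using False by auto
      then show ?thesis
        using scandinavian_form_of_square[OF nz(1) _ forms, of r] I r by simp
    qed
  qed
  then show ?thesis
    using british_of_scandinavian_form[OF nz(1)] scandinavian_iff[OF ideal_depth_eq_4] by blast
qed

end
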